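(* Let $M^n\subset\mathbb{R}^{n+m}$ be the graph of an asymptotically flat map $f:\mathbb{R}^n\to\mathbb{R}^m$, endowed with the natural metric. Assume that $M$ has nonnegative scalar curvature and flat normal fiber bundle. Then the ADM mass of $M$ is nonnegative.
   Context: Here $n\ge 2$, $m\ge 1$; repeated indices are summed, with $i,j\in\{1,\dots,n\}$, $\alpha\in\{1,\dots,m\}$; $\omega_{n-1}$ is the volume of the unit sphere in $\mathbb{R}^n$. Asymptotically flat map: a $C^2$ map $f=(f^1,\dots,f^m):\mathbb{R}^n\to\mathbb{R}^m$ is asymptotically flat if the scalar curvature $S$ of its graph with the natural metric, viewed as a function of $x\in\mathbb{R}^n$, is integrable over $\mathbb{R}^n$, and there is a constant $p>\frac{n-2}{2}$ such that $f^\alpha_i=\partial f^\alpha/\partial x_i=O(|x|^{-p/2})$ and $f^\alpha_{ij}=\partial^2 f^\alpha/\partial x_i\partial x_j=O(|x|^{-p/2-1})$ at infinity, for all $\alpha,i,j$. Natural metric: the metric induced from $\mathbb{R}^{n+m}$ on $M=\{(x,f(x))\}$; in the graph coordinates $x$, $g_{ij}=\delta_{ij}+f^\alpha_i f^\alpha_j$. ADM mass (computed in the graph coordinates $x$): $$m_{ADM}=\lim_{r\to\infty}\frac{1}{2(n-1)\omega_{n-1}}\int_{S_r}(g_{iji}-g_{iij})\,\nu_j\,d\mu,$$ where $g_{ijk}=\partial g_{ij}/\partial x_k$, $S_r=\{|x|=r\}$, $\nu=x/r$, and $d\mu$ is the Euclidean area element of $S_r$. Flat normal fiber bundle: the normal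 curvature tensor $R^\perp$ of $M\subset\mathbb{R}^{n+m}$ vanishes identically (equivalently, by Ricci's equation, the shape operators commute at each point). *)

theory Defs
  imports "HOL-Analysis.Analysis" "HOL-Library.Landau_Symbols"
begin

section \<open>Partial derivatives and regularity\<close>

definition pd :: "'n \<Rightarrow> (real^'n \<Rightarrow> 'b::real_normed_vector) \<Rightarrow> real^'n \<Rightarrow> 'b" where
  "pd i h x = frechet_derivative h (at x) (axis i 1)"

primrec Ck :: "nat \<Rightarrow> (real^'n \<Rightarrow> 'b::real_normed_vector) \<Rightarrow> bool" where
  "Ck 0 h \<longleftrightarrow> continuous_on UNIV h"
| "Ck (Suc k) h \<longleftrightarrow> (\<forall>x. h differentiable (at x)) \<and> (\<forall>i. Ck k (pd i h))"


section \<open>The graph as a submanifold of the product space\<close>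

definition graph_map :: "(real^'n \<Rightarrow> real^'m) \<Rightarrow> real^'n \<Rightarrow> (real^'n) \<times> (real^'m)" where
  "graph_map f x = (x, f x)"

definition tangent :: "(real^'n \<Rightarrow> real^'m) \<Rightarrow> real^'n \<Rightarrow> 'n \<Rightarrow> (real^'n) \<times> (real^'m)" where
  "tangent f x i = pd i (graph_map f) x"

definition induced_metric :: "(real^'n \<Rightarrow> real^'m) \<Rightarrow> real^'n \<Rightarrow> real^'n^'n" where
  "induced_metric f x = (\<chi> i j. tangent f x i \<bullet> tangent f x j)"

definition inverse_metric :: "(real^'n \<Rightarrow> real^'m) \<Rightarrow> real^'n \<Rightarrow> real^'n^'n" where
  "inverse_metric f x = matrix_inv (induced_metric f x)"

definition normal_part ::
    "(real^'n \<Rightarrow> real^'m) \<Rightarrow> real^'n \<Rightarrow> (real^'n) \<times> (real^'m) \<Rightarrow> (real^'n) \<times> (real^'m)" where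
  "normal_part f x v =
     v - (\<Sum>l\<in>UNIV. (\<Sum>k\<in>UNIV. inverse_metric f x $ l $ k * (tangent f x k \<bullet> v)) *\<^sub>R tangent f x l)"

definition is_normal :: "(real^'n \<Rightarrow> real^'m) \<Rightarrow> real^'n \<Rightarrow> (real^'n) \<times> (real^'m) \<Rightarrow> bool" where
  "is_normal f x v \<longleftrightarrow> (\<forall>i. tangent f x i \<bullet> v = 0)"

definition second_ff :: "(real^'n \<Rightarrow> real^'m) \<Rightarrow> real^'n \<Rightarrow> 'n \<Rightarrow> 'n \<Rightarrow> (real^'n) \<times> (real^'m)" where
  "second_ff f x i j = normal_part f x (pd i (pd j (graph_map f)) x)"


section \<open>Curvature of the graph of a twice continuously differentiable map\<close>

text \<open>
  If \<open>f\<close> is only of class \<open>C\<^sup>2\<close>, the induced metric is of class \<open>C\<^sup>1\<close> and both the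
  Levi-Civita connection and the normal connection have merely continuous coefficients, so their
  curvatures cannot be computed by differentiating connection coefficients.  As usual for
  submanifolds of class \<open>C\<^sup>2\<close>, the curvature tensors are therefore given by the equations of
  Gauss and Ricci.  Theorems \<open>scalar_curvature_eq_intrinsic\<close> and
  \<open>normal_curvature_eq_connection\<close> at the end of this theory show that for \<open>f\<close> of class \<open>C\<^sup>3\<close>
  these are the scalar curvature computed from the metric by Christoffel symbols, and the
  curvature of the normal connection.
\<close>

definition riemann :: "(real^'n \<Rightarrow> real^'m) \<Rightarrow> real^'n \<Rightarrow> 'n \<Rightarrow> 'n \<Rightarrow> 'n \<Rightarrow> 'n \<Rightarrow> real" where
  "riemann f x i j k l =
     second_ff f x i l \<bullet> second_ff f x j k - second_ff f x i k \<bullet> second_ff f x j l"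

text \<open>The sign convention is that of \<open>riemann f x i j k l = \<langle>R(\<partial>\<^sub>i,\<partial>\<^sub>j)\<partial>\<^sub>k, \<partial>\<^sub>l\<rangle>\<close>, so that round
  spheres have positive scalar curvature.\<close>

definition scalar_curvature :: "(real^'n \<Rightarrow> real^'m) \<Rightarrow> real^'n \<Rightarrow> real" where
  "scalar_curvature f x =
     (\<Sum>i\<in>UNIV. \<Sum>j\<in>UNIV. \<Sum>k\<in>UNIV. \<Sum>l\<in>UNIV.
        inverse_metric f x $ i $ l * inverse_metric f x $ j $ k * riemann f x i j k l)"

text \<open>\<open>shape_operator f x \<xi>\<close> is the matrix of \<open>A\<^sub>\<xi>\<close> in the coordinate frame, that is,
  \<open>A\<^sub>\<xi> \<partial>\<^sub>j = (\<Sum>l. shape_operator f x \<xi> $ l $ j *\<^sub>R \<partial>\<^sub>l)\<close> and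
  \<open>\<langle>A\<^sub>\<xi> \<partial>\<^sub>j, \<partial>\<^sub>k\<rangle> = \<langle>B(\<partial>\<^sub>j, \<partial>\<^sub>k), \<xi>\<rangle>\<close>.\<close>

definition shape_operator ::
    "(real^'n \<Rightarrow> real^'m) \<Rightarrow> real^'n \<Rightarrow> (real^'n) \<times> (real^'m) \<Rightarrow> real^'n^'n" where
  "shape_operator f x \<xi> =
     (\<chi> l j. \<Sum>k\<in>UNIV. inverse_metric f x $ l $ k * (second_ff f x j k \<bullet> \<xi>))"

text \<open>\<open>R\<^sup>\<bottom>(\<partial>\<^sub>i,\<partial>\<^sub>j)\<xi> = B(\<partial>\<^sub>i, A\<^sub>\<xi> \<partial>\<^sub>j) - B(A\<^sub>\<xi> \<partial>\<^sub>i, \<partial>\<^sub>j)\<close>\<close>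

definition normal_curvature ::
    "(real^'n \<Rightarrow> real^'m) \<Rightarrow> real^'n \<Rightarrow> 'n \<Rightarrow> 'n \<Rightarrow> (real^'n) \<times> (real^'m) \<Rightarrow> (real^'n) \<times> (real^'m)" where
  "normal_curvature f x i j \<xi> =
     (\<Sum>l\<in>UNIV. shape_operator f x \<xi> $ l $ j *\<^sub>R second_ff f x i l
              - shape_operator f x \<xi> $ l $ i *\<^sub>R second_ff f x l j)"

definition flat_normal_bundle :: "(real^'n \<Rightarrow> real^'m) \<Rightarrow> bool" where
  "flat_normal_bundle f \<longleftrightarrow>
     (\<forall>x i j \<xi>. is_normal f x \<xi> \<longrightarrow> normal_curvature f x i j \<xi> = 0)"


section \<open>Asymptotically flat maps\<close>

definition asymptotically_flat :: "(real^'n \<Rightarrow> real^'m) \<Rightarrow> bool" where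
  "asymptotically_flat f \<longleftrightarrow>
     Ck 2 f \<and>
     integrable lborel (scalar_curvature f) \<and>
     (\<exists>p > (real CARD('n) - 2) / 2.
        (\<forall>\<alpha> i. (\<lambda>x. pd i (\<lambda>y. f y $ \<alpha>) x) \<in> O[at_infinity](\<lambda>x. norm x powr (- p / 2))) \<and>
        (\<forall>\<alpha> i j. (\<lambda>x. pd j (pd i (\<lambda>y. f y $ \<alpha>)) x)
                     \<in> O[at_infinity](\<lambda>x. norm x powr (- p / 2 - 1))))"


section \<open>ADM mass\<close>

text \<open>
  Euclidean area measure of the sphere of radius \<open>r\<close> about the origin: the area of \<open>A\<close> is
  \<open>DIM('a) / r\<close> times the volume of the cone \<open>{t *\<^sub>R a |t a. 0 < t \<and> t < 1 \<and> a \<in> A}\<close>.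
  It is a measure on the whole space, concentrated on the sphere.
\<close>

definition sphere_area :: "real \<Rightarrow> 'a::euclidean_space measure" where
  "sphere_area r =
     scale_measure (ennreal (real DIM('a) / r))
       (distr (restrict_space lborel (ball 0 r - {0})) borel (\<lambda>x. (r / norm x) *\<^sub>R x))"

definition unit_sphere_volume :: "'a::euclidean_space itself \<Rightarrow> real" where
  "unit_sphere_volume _ = measure (sphere_area 1 :: 'a measure) (sphere 0 1)"

definition ADM_flux :: "(real^'n \<Rightarrow> real^'n^'n) \<Rightarrow> real \<Rightarrow> real" where
  "ADM_flux g r =
     1 / (2 * (real CARD('n) - 1) * unit_sphere_volume TYPE(real^'n)) *
     (\<integral>x. (\<Sum>i\<in>UNIV. \<Sum>j\<in>UNIV.
             (pd i (\<lambda>y. g y $ i $ j) x - pd j (\<lambda>y. g y $ i $ i) x) * (x $ j / r))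
        \<partial>sphere_area r)"

definition ADM_mass :: "(real^'n \<Rightarrow> real^'n^'n) \<Rightarrow> real" where
  "ADM_mass g = Lim at_top (ADM_flux g)"


section \<open>Consistency of the definitions\<close>

subsection \<open>Calculus of partial derivatives\<close>

lemma pd_eqI:
  assumes "(h has_derivative h') (at x)" shows "pd i h x = h' (axis i 1)"
  using frechet_derivative_at[OF assms] by (simp add: pd_def[symmetric])

lemma has_derivative_frechet:
  assumes "h differentiable (at x)"
  shows "(h has_derivative frechet_derivative h (at x)) (at x)"
  using assms frechet_derivative_works by blast

lemma pd_bounded_linear:
  assumes "bounded_linear L" "h differentiable (at x)"
  shows "(\<lambda>y. L (h y)) differentiable (at x)" "pd i (\<lambda>y. L (h y)) x = L (pd i h x)"
proof -
  have "((\<lambda>y. L (h y)) has_derivative (\<lambda>v. L (frechet_derivative h (at x) v))) (at x)"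
    by (rule bounded_linear.has_derivative[OF assms(1) has_derivative_frechet[OF assms(2)]])
  then show "(\<lambda>y. L (h y)) differentiable (at x)" "pd i (\<lambda>y. L (h y)) x = L (pd i h x)"
    by (auto simp: pd_eqI pd_def[symmetric] differentiable_def)
qed

lemma pd_bounded_bilinear:
  assumes "bounded_bilinear B" "u differentiable (at x)" "v differentiable (at x)"
  shows "(\<lambda>y. B (u y) (v y)) differentiable (at x)"
    and "pd i (\<lambda>y. B (u y) (v y)) x = B (pd i u x) (v x) + B (u x) (pd i v x)"
proof -
  have "((\<lambda>y. B (u y) (v y)) has_derivative
      (\<lambda>d. B (u x) (frechet_derivative v (at x) d) + B (frechet_derivative u (at x) d) (v x))) (at x)"
    by (rule bounded_bilinear.FDERIV[OF assms(1) has_derivative_frechet[OF assms(2)]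
          has_derivative_frechet[OF assms(3)]])
  then show "(\<lambda>y. B (u y) (v y)) differentiable (at x)"
      "pd i (\<lambda>y. B (u y) (v y)) x = B (pd i u x) (v x) + B (u x) (pd i v x)"
    by (auto simp: pd_eqI pd_def[symmetric] differentiable_def)
qed

lemmas pd_inner = pd_bounded_bilinear[OF bounded_bilinear_inner]
lemmas pd_mult = pd_bounded_bilinear[OF bounded_bilinear_mult]
lemmas pd_scaleR = pd_bounded_bilinear[OF bounded_bilinear_scaleR]

lemma pd_sum:
  assumes "\<And>k. k \<in> K \<Longrightarrow> h k differentiable (at x)"
  shows "(\<lambda>y. \<Sum>k\<in>K. h k y) differentiable (at x)"
    and "pd i (\<lambda>y. \<Sum>k\<in>K. h k y) x = (\<Sum>k\<in>K. pd i (h k) x)"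
proof -
  have "((\<lambda>y. \<Sum>k\<in>K. h k y) has_derivative (\<lambda>d. \<Sum>k\<in>K. frechet_derivative (h k) (at x) d)) (at x)"
    by (intro has_derivative_sum has_derivative_frechet assms)
  then show "(\<lambda>y. \<Sum>k\<in>K. h k y) differentiable (at x)"
      "pd i (\<lambda>y. \<Sum>k\<in>K. h k y) x = (\<Sum>k\<in>K. pd i (h k) x)"
    by (auto simp: pd_eqI pd_def[symmetric] differentiable_def)
qed

lemma pd_diff:
  assumes "u differentiable (at x)" "v differentiable (at x)"
  shows "pd i (\<lambda>y. u y - v y) x = pd i u x - pd i v x"
  using pd_eqI[OF has_derivative_diff[OF has_derivative_frechet[OF assms(1)] has_derivative_frechet[OF assms(2)]]]
  by (simp add: pd_def[symmetric])

lemma pd_add: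
  assumes "u differentiable (at x)" "v differentiable (at x)"
  shows "pd i (\<lambda>y. u y + v y) x = pd i u x + pd i v x"
  using pd_eqI[OF has_derivative_add[OF has_derivative_frechet[OF assms(1)] has_derivative_frechet[OF assms(2)]]]
  by (simp add: pd_def[symmetric])

lemma pd_line:
  assumes "h differentiable (at (a + t *\<^sub>R axis i 1))"
  shows "((\<lambda>t. h (a + t *\<^sub>R axis i 1)) has_vector_derivative pd i h (a + t *\<^sub>R axis i 1)) (at t)"
proof -
  have "((\<lambda>t. h (a + t *\<^sub>R axis i 1)) has_derivative
     (\<lambda>s. frechet_derivative h (at (a + t *\<^sub>R axis i 1)) (s *\<^sub>R axis i 1))) (at t)"
    by (rule has_derivative_compose[where f = "\<lambda>t. a + t *\<^sub>R axis i 1",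
          OF _ has_derivative_frechet[OF assms]]) (auto intro!: derivative_eq_intros)
  moreover have "linear (frechet_derivative h (at (a + t *\<^sub>R axis i 1)))"
    using assms linear_frechet_derivative by blast
  ultimately show ?thesis
    by (simp add: has_vector_derivative_def pd_def linear_scale)
qed

lemma mixed_difference_mvt:
  fixes h :: "real^'n \<Rightarrow> real"
  assumes "Ck 2 h" "0 < (t::real)"
  obtains a b where "0 \<le> a" "a \<le> t" "0 \<le> b" "b \<le> t"
    "h (x + t *\<^sub>R axis i 1 + t *\<^sub>R axis j 1) - h (x + t *\<^sub>R axis i 1) - h (x + t *\<^sub>R axis j 1) + h x
       = t * t * pd j (pd i h) (x + a *\<^sub>R axis i 1 + b *\<^sub>R axis j 1)"
proof -
  have D: "\<And>y. h differentiable (at y)" "\<And>i y. pd i h differentiable (at y)"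
    using assms(1) by (auto simp: numeral_2_eq_2)
  define ei ej :: "real^'n" where "ei = axis i 1" and "ej = axis j 1"
  define \<phi> where "\<phi> s = h ((x + t *\<^sub>R ej) + s *\<^sub>R ei) - h (x + s *\<^sub>R ei)" for s
  have "(\<phi> has_real_derivative (pd i h ((x + t *\<^sub>R ej) + s *\<^sub>R ei) - pd i h (x + s *\<^sub>R ei))) (at s)" for s
    unfolding has_real_derivative_iff_has_vector_derivative \<phi>_def ei_def
    by (intro has_vector_derivative_diff pd_line D)
  from MVT2[OF assms(2) this] obtain a where a: "0 < a" "a < t"
    "\<phi> t - \<phi> 0 = t * (pd i h ((x + t *\<^sub>R ej) + a *\<^sub>R ei) - pd i h (x + a *\<^sub>R ei))" by auto
  have "((\<lambda>s. pd i h ((x + a *\<^sub>R ei) + s *\<^sub>R ej)) has_real_derivative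
          pd j (pd i h) ((x + a *\<^sub>R ei) + s *\<^sub>R ej)) (at s)" for s
    unfolding has_real_derivative_iff_has_vector_derivative ej_def by (intro pd_line D)
  from MVT2[OF assms(2) this] obtain b where b: "0 < b" "b < t"
    "pd i h ((x + a *\<^sub>R ei) + t *\<^sub>R ej) - pd i h ((x + a *\<^sub>R ei) + 0 *\<^sub>R ej)
       = t * pd j (pd i h) ((x + a *\<^sub>R ei) + b *\<^sub>R ej)" by auto
  show ?thesis
    using a b by (intro that[of a b]) (auto simp: \<phi>_def ei_def ej_def algebra_simps)
qed

lemma pd_commute_real:
  fixes h :: "real^'n \<Rightarrow> real"
  assumes "Ck 2 h"
  shows "pd i (pd j h) x = pd j (pd i h) x"
proof (rule ccontr)
  assume ne: "pd i (pd j h) x \<noteq> pd j (pd i h) x"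
  define e where "e = \<bar>pd i (pd j h) x - pd j (pd i h) x\<bar> / 2"
  have e: "e > 0" using ne by (simp add: e_def)
  have C: "\<And>i j. isCont (pd i (pd j h)) x"
    using assms by (auto simp: numeral_2_eq_2 continuous_on_eq_continuous_at)
  obtain d1 where d1: "d1 > 0" "\<And>y. dist y x < d1 \<Longrightarrow> \<bar>pd i (pd j h) y - pd i (pd j h) x\<bar> < e"
    using C[of i j] e unfolding continuous_at_eps_delta dist_real_def by blast
  obtain d2 where d2: "d2 > 0" "\<And>y. dist y x < d2 \<Longrightarrow> \<bar>pd j (pd i h) y - pd j (pd i h) x\<bar> < e"
    using C[of j i] e unfolding continuous_at_eps_delta dist_real_def by blast
  define t where "t = min d1 d2 / 3"
  have t: "t > 0" "2 * t < d1" "2 * t < d2" using d1 d2 by (auto simp: t_def)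
  have near: "dist (x + a *\<^sub>R axis k 1 + b *\<^sub>R axis l 1) x \<le> 2 * t"
    if "0 \<le> a" "a \<le> t" "0 \<le> b" "b \<le> t" for a b k l
  proof -
    have "norm (a *\<^sub>R axis k (1::real) + b *\<^sub>R axis l 1 :: real^'n) \<le> \<bar>a\<bar> + \<bar>b\<bar>"
      by (rule order_trans[OF norm_triangle_ineq])
         (simp add: norm_eq_sqrt_inner[of "axis _ _"] inner_axis_axis)
    then show ?thesis using that by (simp add: dist_norm add.assoc)
  qed
  obtain a b where ab: "0 \<le> a" "a \<le> t" "0 \<le> b" "b \<le> t"
    "h (x + t *\<^sub>R axis i 1 + t *\<^sub>R axis j 1) - h (x + t *\<^sub>R axis i 1) - h (x + t *\<^sub>R axis j 1) + h x
       = t * t * pd j (pd i h) (x + a *\<^sub>R axis i 1 + b *\<^sub>R axis j 1)"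
    using mixed_difference_mvt[OF assms t(1)] by blast
  obtain a' b' where ab': "0 \<le> a'" "a' \<le> t" "0 \<le> b'" "b' \<le> t"
    "h (x + t *\<^sub>R axis j 1 + t *\<^sub>R axis i 1) - h (x + t *\<^sub>R axis j 1) - h (x + t *\<^sub>R axis i 1) + h x
       = t * t * pd i (pd j h) (x + a' *\<^sub>R axis j 1 + b' *\<^sub>R axis i 1)"
    using mixed_difference_mvt[OF assms t(1)] by blast
  have "t * t * pd j (pd i h) (x + a *\<^sub>R axis i 1 + b *\<^sub>R axis j 1)
      = t * t * pd i (pd j h) (x + a' *\<^sub>R axis j 1 + b' *\<^sub>R axis i 1)"
    using ab(5) ab'(5) by (simp add: algebra_simps)
  then have eq: "pd j (pd i h) (x + a *\<^sub>R axis i 1 + b *\<^sub>R axis j 1)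
      = pd i (pd j h) (x + a' *\<^sub>R axis j 1 + b' *\<^sub>R axis i 1)" using t by simp
  have 1: "\<bar>pd j (pd i h) (x + a *\<^sub>R axis i 1 + b *\<^sub>R axis j 1) - pd j (pd i h) x\<bar> < e"
    using near[of a b i j] ab(1-4) t by (intro d2(2)) linarith
  have 2: "\<bar>pd i (pd j h) (x + a' *\<^sub>R axis j 1 + b' *\<^sub>R axis i 1) - pd i (pd j h) x\<bar> < e"
    using near[of a' b' j i] ab'(1-4) t by (intro d1(2)) linarith
  have False if "p = q" "\<bar>p - c\<bar> < \<bar>d - c\<bar> / 2" "\<bar>q - d\<bar> < \<bar>d - c\<bar> / 2" for c d p q :: real
    using that by (simp add: abs_if split: if_splits)
  from this[OF eq 1[unfolded e_def] 2[unfolded e_def]] show False .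
qed

lemma Ck_bounded_linear:
  assumes "bounded_linear L"
  shows "Ck k h \<Longrightarrow> Ck k (\<lambda>y. L (h y))"
proof (induction k arbitrary: h)
  case 0
  then show ?case using assms by (auto intro: bounded_linear.continuous_on)
next
  case (Suc k)
  have "pd i (\<lambda>y. L (h y)) = (\<lambda>y. L (pd i h y))" for i
    using Suc.prems pd_bounded_linear(2)[OF assms] by fastforce
  moreover have "(\<lambda>y. L (h y)) differentiable (at x)" for x
    using Suc.prems by (intro pd_bounded_linear(1)[OF assms]) auto
  ultimately show ?case using Suc by simp
qed

lemma pd_commute:
  fixes h :: "real^'n \<Rightarrow> 'b::euclidean_space"
  assumes "Ck 2 h"
  shows "pd i (pd j h) x = pd j (pd i h) x"
proof (rule euclidean_eqI)
  fix b :: 'b assume "b \<in> Basis"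
  have L: "bounded_linear (\<lambda>v. v \<bullet> b)" by (rule bounded_linear_inner_left)
  have D: "\<And>y. h differentiable (at y)" "\<And>i y. pd i h differentiable (at y)"
    using assms by (auto simp: numeral_2_eq_2)
  have "pd i (\<lambda>y. h y \<bullet> b) = (\<lambda>y. pd i h y \<bullet> b)" for i
    by (auto intro!: ext pd_bounded_linear[OF L] D)
  then have "pd j (pd i (\<lambda>y. h y \<bullet> b)) x = pd j (pd i h) x \<bullet> b" for i j
    using pd_bounded_linear(2)[OF L D(2)] by simp
  then show "pd i (pd j h) x \<bullet> b = pd j (pd i h) x \<bullet> b"
    using pd_commute_real[OF Ck_bounded_linear[OF L assms], of i j x] by simp
qed


subsection \<open>The induced metric\<close>

lemma has_derivative_graph_map:
  assumes "f differentiable (at x)"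
  shows "(graph_map f has_derivative (\<lambda>v. (v, frechet_derivative f (at x) v))) (at x)"
  unfolding graph_map_def[abs_def]
  by (intro has_derivative_Pair has_derivative_ident has_derivative_frechet assms)

lemma tangent_eq:
  assumes "f differentiable (at x)"
  shows "tangent f x i = (axis i 1, pd i f x)"
  using pd_eqI[OF has_derivative_graph_map[OF assms]] by (simp add: tangent_def pd_def[symmetric])

theorem induced_metric_eq:
  assumes "f differentiable (at x)"
  shows "induced_metric f x $ i $ j
    = (if i = j then 1 else 0) + (\<Sum>\<alpha>\<in>UNIV. pd i (\<lambda>y. f y $ \<alpha>) x * pd j (\<lambda>y. f y $ \<alpha>) x)"
  using pd_bounded_linear(2)[OF bounded_linear_vec_nth assms]
  by (simp add: induced_metric_def tangent_eq[OF assms] inner_vec_def[of "pd i f x"] inner_axis_axis)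

lemma Ck_const: "Ck k (\<lambda>x::real^'n. c)"
proof (induction k arbitrary: c)
  case (Suc k)
  have "pd i (\<lambda>x. c) = (\<lambda>x. 0)" for i :: 'n by (rule ext) (simp add: pd_eqI[OF has_derivative_const])
  with Suc show ?case by simp
qed simp

lemma Ck_Pair: "Ck k u \<Longrightarrow> Ck k v \<Longrightarrow> Ck k (\<lambda>x. (u x, v x))"
proof (induction k arbitrary: u v)
  case 0 then show ?case by (auto intro: continuous_on_Pair)
next
  case (Suc k)
  have D: "((\<lambda>x. (u x, v x)) has_derivative
      (\<lambda>d. (frechet_derivative u (at x) d, frechet_derivative v (at x) d))) (at x)" for x
    using Suc.prems by (auto intro!: has_derivative_Pair has_derivative_frechet)
  then have "pd i (\<lambda>x. (u x, v x)) = (\<lambda>x. (pd i u x, pd i v x))" for i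
    by (intro ext) (simp add: pd_eqI[OF D] pd_def[symmetric])
  with Suc D show ?case by (auto simp: differentiable_def)
qed

lemma Ck_graph_map: "Ck k f \<Longrightarrow> Ck k (graph_map f)"
proof -
  have "Ck k (\<lambda>x::real^'n. x)"
  proof (cases k)
    case (Suc l)
    have "pd i (\<lambda>x::real^'n. x) = (\<lambda>x. axis i 1)" for i :: 'n
      by (rule ext) (simp add: pd_eqI[OF has_derivative_ident])
    moreover have "Ck l (\<lambda>x::real^'n. axis i 1 :: real^'n)" for i by (rule Ck_const)
    ultimately show ?thesis using Suc by simp
  qed simp
  then show "Ck k f \<Longrightarrow> Ck k (graph_map f)"
    unfolding graph_map_def[abs_def] by (rule Ck_Pair)
qed

lemma induced_metric_pos:
  assumes "f differentiable (at x)"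
  shows "v \<bullet> (induced_metric f x *v v) \<ge> v \<bullet> v"
proof -
  define w where "w = (\<Sum>i\<in>UNIV. v $ i *\<^sub>R tangent f x i)"
  have "v \<bullet> (induced_metric f x *v v)
      = (\<Sum>i\<in>UNIV. \<Sum>j\<in>UNIV. v $ i * v $ j * (tangent f x i \<bullet> tangent f x j))"
    by (simp add: inner_vec_def[of v] matrix_vector_mult_def induced_metric_def sum_distrib_left mult_ac inner_commute)
  also have "\<dots> = w \<bullet> w"
    by (simp add: w_def inner_sum_left inner_sum_right sum_distrib_left mult_ac inner_commute)
  also have "w \<bullet> w = fst w \<bullet> fst w + snd w \<bullet> snd w" by (simp add: inner_prod_def)
  also have "fst w = v"
    by (simp add: w_def fst_sum tangent_eq[OF assms] basis_expansion scalar_mult_eq_scaleR[symmetric])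
  finally show ?thesis by simp
qed

lemma inverse_metric:
  assumes "f differentiable (at x)"
  shows "induced_metric f x ** inverse_metric f x = mat 1"
    and "inverse_metric f x ** induced_metric f x = mat 1"
    and "det (induced_metric f x) \<noteq> 0"
proof -
  have "v = 0" if "induced_metric f x *v v = 0" for v
    using induced_metric_pos[OF assms, of v] that
    by (metis inner_eq_zero_iff inner_ge_zero inner_zero_right order_antisym)
  then have "invertible (induced_metric f x)"
    using invertible_left_inverse matrix_left_invertible_ker by blast
  then show "induced_metric f x ** inverse_metric f x = mat 1"
      "inverse_metric f x ** induced_metric f x = mat 1"
      "det (induced_metric f x) \<noteq> 0"
    using someI_ex[of "\<lambda>A'. induced_metric f x ** A' = mat 1 \<and> A' ** induced_metric f x = mat 1"]
      invertible_det_nz[of "induced_metric f x"]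
    unfolding inverse_metric_def invertible_def matrix_inv_def by auto
qed

lemma sum_inverse_metric:
  assumes "f differentiable (at x)"
  shows "(\<Sum>k\<in>UNIV. induced_metric f x $ i $ k * inverse_metric f x $ k $ j) = (if i = j then 1 else 0)"
    and "(\<Sum>k\<in>UNIV. inverse_metric f x $ i $ k * induced_metric f x $ k $ j) = (if i = j then 1 else 0)"
  using inverse_metric(1,2)[OF assms] by (auto simp: vec_eq_iff matrix_matrix_mult_def mat_def)

lemma induced_metric_sym: "induced_metric f x $ i $ j = induced_metric f x $ j $ i"
  by (simp add: induced_metric_def inner_commute)

lemma metric_inverse_sum:
  assumes "f differentiable (at x)"
  shows "(\<Sum>k\<in>UNIV. induced_metric f x $ i $ k * (\<Sum>l\<in>UNIV. inverse_metric f x $ k $ l * c l)) = c i"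
    and "(\<Sum>k\<in>UNIV. inverse_metric f x $ i $ k * (\<Sum>l\<in>UNIV. induced_metric f x $ k $ l * c l)) = c i"
proof -
  have "(\<Sum>k\<in>UNIV. A i k * (\<Sum>l\<in>UNIV. A' k l * c l)) = (\<Sum>l\<in>UNIV. (\<Sum>k\<in>UNIV. A i k * A' k l) * c l)"
    for A A' :: "'a \<Rightarrow> 'a \<Rightarrow> real"
    by (simp add: sum_distrib_left sum_distrib_right mult.assoc) (rule sum.swap)
  note * = this
  show "(\<Sum>k\<in>UNIV. induced_metric f x $ i $ k * (\<Sum>l\<in>UNIV. inverse_metric f x $ k $ l * c l)) = c i"
    by (subst *) (simp add: sum_inverse_metric[OF assms] if_distrib[of "\<lambda>c. c * _"] cong: if_cong)
  show "(\<Sum>k\<in>UNIV. inverse_metric f x $ i $ k * (\<Sum>l\<in>UNIV. induced_metric f x $ k $ l * c l)) = c i"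
    by (subst *) (simp add: sum_inverse_metric[OF assms] if_distrib[of "\<lambda>c. c * _"] cong: if_cong)
qed

lemma normal_part_normal:
  assumes "f differentiable (at x)"
  shows "tangent f x i \<bullet> normal_part f x v = 0"
  using metric_inverse_sum(1)[OF assms, of i "\<lambda>k. tangent f x k \<bullet> v"]
  by (simp add: normal_part_def inner_diff_right inner_sum_right induced_metric_def mult.commute)

lemma normal_part_of_normal: "is_normal f x v \<Longrightarrow> normal_part f x v = v"
  by (simp add: is_normal_def normal_part_def)

lemma normal_part_add: "normal_part f x (u + v) = normal_part f x u + normal_part f x v"
  by (simp add: normal_part_def inner_add_right algebra_simps sum.distrib)

lemma normal_part_scaleR: "normal_part f x (c *\<^sub>R v) = c *\<^sub>R normal_part f x v"
  by (simp add: normal_part_def algebra_simps scaleR_sum_right sum_distrib_left)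

lemma normal_part_sum: "normal_part f x (\<Sum>k\<in>K. h k) = (\<Sum>k\<in>K. normal_part f x (h k))"
proof (cases "finite K")
  case True
  then show ?thesis
    by (induction K) (auto simp: normal_part_add, simp add: normal_part_def)
qed (simp add: normal_part_def)

lemma normal_part_tangent:
  assumes "f differentiable (at x)"
  shows "normal_part f x (tangent f x i) = 0"
proof -
  have "(\<Sum>k\<in>UNIV. inverse_metric f x $ l $ k * (tangent f x k \<bullet> tangent f x i)) = (if l = i then 1 else 0)" for l
    using sum_inverse_metric(2)[OF assms, of l i] by (simp add: induced_metric_def)
  then show ?thesis by (simp add: normal_part_def if_distrib[of "\<lambda>c. c *\<^sub>R _"] cong: if_cong)
qed

lemma solution_differentiable:
  fixes f :: "real^'n \<Rightarrow> real^'m"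
  assumes f: "\<And>y. f differentiable (at y)" "\<And>i. pd i f differentiable (at x)"
    and c: "\<And>l. (\<lambda>y. c y l) differentiable (at x)"
  shows "(\<lambda>y. \<Sum>l\<in>UNIV. inverse_metric f y $ k $ l * c y l) differentiable (at x)"
proof -
  have G: "(\<lambda>y. induced_metric f y $ i $ j) differentiable (at x)" for i j
    by (simp add: induced_metric_def tangent_eq[OF f(1)] inner_axis_axis
        differentiable_add pd_inner(1)[OF f(2) f(2)])
  have detd: "(\<lambda>y. det (M y)) differentiable (at x)"
    if "\<And>i j. (\<lambda>y. M y $ i $ j) differentiable (at x)" for M :: "real^'n \<Rightarrow> real^'n^'n"
  proof -
    have "(\<lambda>y. \<Prod>i\<in>UNIV. M y $ i $ p i) differentiable (at x)" for p
      unfolding differentiable_def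
      by (rule exI, rule has_derivative_prod, rule has_derivative_frechet, rule that)
    then show ?thesis unfolding det_def
      by (intro pd_sum(1) differentiable_mult differentiable_const)
  qed
  have "(\<Sum>l\<in>UNIV. inverse_metric f y $ k $ l * c y l)
     = det (\<chi> i j. if j = k then c y i else induced_metric f y $ i $ j) / det (induced_metric f y)" for y
  proof -
    define v where "v = (\<chi> k. \<Sum>l\<in>UNIV. inverse_metric f y $ k $ l * c y l)"
    have 1: "induced_metric f y *v v = (\<chi> i. c y i)"
      using metric_inverse_sum(1)[OF f(1)] by (simp add: v_def vec_eq_iff matrix_vector_mult_def)
    have "v $ k = det (\<chi> i j. if j = k then (\<chi> i. c y i) $ i else induced_metric f y $ i $ j)
        / det (induced_metric f y)"
      by (subst cramer[OF inverse_metric(3)[OF f(1)], THEN iffD1, OF 1]) simp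
    then show ?thesis by (simp add: v_def cong: if_cong)
  qed
  moreover have "(\<lambda>y. det (\<chi> i j. if j = k then c y i else induced_metric f y $ i $ j)
      / det (induced_metric f y)) differentiable (at x)"
  proof (intro differentiable_divide detd)
    show "(\<lambda>y. (\<chi> i j. if j = k then c y i else induced_metric f y $ i $ j) $ i $ j)
        differentiable (at x)" for i j
      by (cases "j = k") (simp_all add: G c)
  qed (use G inverse_metric(3)[OF f(1)] in auto)
  ultimately show ?thesis by simp
qed


subsection \<open>Gauss equation\<close>

definition christoffel :: "(real^'n \<Rightarrow> real^'n^'n) \<Rightarrow> 'n \<Rightarrow> 'n \<Rightarrow> 'n \<Rightarrow> real^'n \<Rightarrow> real" where
  "christoffel g k i j x = (\<Sum>l\<in>UNIV. matrix_inv (g x) $ k $ l *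
     ((pd i (\<lambda>y. g y $ j $ l) x + pd j (\<lambda>y. g y $ i $ l) x - pd l (\<lambda>y. g y $ i $ j) x) / 2))"

text \<open>The coefficients \<open>R\<^sup>l\<close> in \<open>R(\<partial>\<^sub>i,\<partial>\<^sub>j)\<partial>\<^sub>k = (\<Sum>l. R\<^sup>l *\<^sub>R \<partial>\<^sub>l)\<close>.\<close>

definition metric_riemann :: "(real^'n \<Rightarrow> real^'n^'n) \<Rightarrow> 'n \<Rightarrow> 'n \<Rightarrow> 'n \<Rightarrow> 'n \<Rightarrow> real^'n \<Rightarrow> real" where
  "metric_riemann g l i j k x =
     pd i (christoffel g l j k) x - pd j (christoffel g l i k) x
     + (\<Sum>s\<in>UNIV. christoffel g l i s x * christoffel g s j k x
                - christoffel g l j s x * christoffel g s i k x)"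

definition metric_scalar_curvature :: "(real^'n \<Rightarrow> real^'n^'n) \<Rightarrow> real^'n \<Rightarrow> real" where
  "metric_scalar_curvature g x =
     (\<Sum>j\<in>UNIV. \<Sum>k\<in>UNIV. matrix_inv (g x) $ j $ k * (\<Sum>i\<in>UNIV. metric_riemann g i i j k x))"

lemma Ck3D:
  fixes f :: "real^'n \<Rightarrow> real^'m"
  assumes "Ck 3 f"
  defines "F \<equiv> graph_map f"
  shows "f differentiable (at x)" "pd i f differentiable (at x)"
    "F differentiable (at x)" "pd i F differentiable (at x)" "pd i (pd j F) differentiable (at x)"
    "pd i (pd j F) x = pd j (pd i F) x" "pd i (pd j (pd k F)) x = pd j (pd i (pd k F)) x"
proof -
  have F: "Ck 3 F" unfolding F_def by (rule Ck_graph_map[OF assms(1)])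
  show "f differentiable (at x)" "pd i f differentiable (at x)"
    "F differentiable (at x)" "pd i F differentiable (at x)" "pd i (pd j F) differentiable (at x)"
    using assms(1) F by (auto simp: numeral_3_eq_3)
  have drop: "Ck (Suc k) h \<Longrightarrow> Ck k h" for k and h :: "real^'n \<Rightarrow> (real^'n) \<times> (real^'m)"
    by (induction k arbitrary: h)
       (auto intro: continuous_at_imp_continuous_on differentiable_imp_continuous_within)
  show "pd i (pd j F) x = pd j (pd i F) x"
    by (rule pd_commute, rule drop) (use F in \<open>simp add: numeral_3_eq_3 numeral_2_eq_2\<close>)
  show "pd i (pd j (pd k F)) x = pd j (pd i (pd k F)) x"
    by (rule pd_commute) (use F in \<open>simp add: numeral_3_eq_3 numeral_2_eq_2\<close>)
qed

lemma pd_induced_metric: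
  assumes "Ck 3 f"
  shows "(\<lambda>y. induced_metric f y $ i $ j) differentiable (at x)"
    and "pd k (\<lambda>y. induced_metric f y $ i $ j) x
      = pd k (pd i (graph_map f)) x \<bullet> tangent f x j + tangent f x i \<bullet> pd k (pd j (graph_map f)) x"
  using pd_inner[OF Ck3D(4)[OF assms] Ck3D(4)[OF assms]]
  by (simp_all add: induced_metric_def tangent_def)

lemma christoffel_induced_metric:
  assumes "Ck 3 f"
  shows "christoffel (induced_metric f) k i j x
    = (\<Sum>l\<in>UNIV. inverse_metric f x $ k $ l * (tangent f x l \<bullet> pd i (pd j (graph_map f)) x))"
proof -
  have "(pd i (\<lambda>y. induced_metric f y $ j $ l) x + pd j (\<lambda>y. induced_metric f y $ i $ l) x
      - pd l (\<lambda>y. induced_metric f y $ i $ j) x) / 2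
    = tangent f x l \<bullet> pd i (pd j (graph_map f)) x" for l
    using inner_commute[of "tangent f x l" "pd i (pd j (graph_map f)) x"]
      inner_commute[of "tangent f x j" "pd i (pd l (graph_map f)) x"]
    unfolding pd_induced_metric(2)[OF assms]
      Ck3D(6)[OF assms, of j i x] Ck3D(6)[OF assms, of l i x] Ck3D(6)[OF assms, of l j x]
    by simp
  then show ?thesis by (simp add: christoffel_def inverse_metric_def)
qed

theorem gauss_equation:
  fixes f :: "real^'n \<Rightarrow> real^'m"
  assumes "Ck 3 f"
  shows "(\<Sum>m\<in>UNIV. induced_metric f x $ l $ m * metric_riemann (induced_metric f) m i j k x)
    = riemann f x i j k l"
proof -
  note D = Ck3D[OF assms]
  define F where "F = graph_map f"
  define T where "T = (\<lambda>i. pd i F)"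
  define T2 where "T2 = (\<lambda>i j. pd i (pd j F))"
  define G where "G = (\<lambda>i j y. induced_metric f y $ i $ j)"
  define \<Gamma> where "\<Gamma> = (\<lambda>k i j. christoffel (induced_metric f) k i j)"
  have tan: "tangent f y i = T i y" for y i by (simp add: tangent_def T_def F_def)
  have dT: "T i differentiable (at y)" "T2 i j differentiable (at y)" "pd i (T j) = T2 i j"
    and sym: "T2 i j y = T2 j i y" "pd i (T2 j k) y = pd j (T2 i k) y" for i j k y
    using D by (auto simp: T_def T2_def F_def)
  have dG: "G i j differentiable (at y)" for i j y
    using pd_induced_metric(1)[OF assms] by (simp add: G_def)
  have pG: "pd k (G i j) y = T2 k i y \<bullet> T j y + T i y \<bullet> T2 k j y" for k i j y
    using pd_induced_metric(2)[OF assms] by (simp add: G_def tan T2_def F_def)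
  have \<Gamma>: "\<Gamma> k i j y = (\<Sum>l\<in>UNIV. inverse_metric f y $ k $ l * (T l y \<bullet> T2 i j y))" for k i j y
    by (simp add: \<Gamma>_def christoffel_induced_metric[OF assms] tan T2_def F_def)
  have d\<Gamma>: "\<Gamma> k i j differentiable (at y)" for k i j y
  proof -
    have "(\<lambda>y. \<Sum>l\<in>UNIV. inverse_metric f y $ k $ l * (T l y \<bullet> T2 i j y)) differentiable (at y)"
      by (intro solution_differentiable D(1,2) pd_inner(1) dT)
    then show ?thesis by (simp add: \<Gamma>[abs_def, symmetric] \<Gamma>[symmetric])
  qed
  have low: "(\<Sum>m\<in>UNIV. G l m y * \<Gamma> m i j y) = T l y \<bullet> T2 i j y" for l i j y
    unfolding G_def \<Gamma> by (rule metric_inverse_sum(1)[OF D(1)])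
  have low': "(\<Sum>m\<in>UNIV. pd i (G l m) x * \<Gamma> m j k x + G l m x * pd i (\<Gamma> m j k) x)
      = T2 i l x \<bullet> T2 j k x + T l x \<bullet> pd i (T2 j k) x" for l i j k
  proof -
    have "pd i (\<lambda>y. \<Sum>m\<in>UNIV. G l m y * \<Gamma> m j k y) x = pd i (\<lambda>y. T l y \<bullet> T2 j k y) x"
      by (simp add: low)
    then show ?thesis
      by (simp add: pd_sum(2) pd_mult pd_inner(2) dG d\<Gamma> dT)
  qed
  have B: "second_ff f x i j = T2 i j x - (\<Sum>m\<in>UNIV. \<Gamma> m i j x *\<^sub>R T m x)" for i j
    by (simp add: second_ff_def normal_part_def \<Gamma> tan T2_def F_def)
  have BB: "T2 i j x \<bullet> second_ff f x k l = second_ff f x i j \<bullet> second_ff f x k l" for i j k l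
  proof -
    have "T m x \<bullet> second_ff f x k l = 0" for m
      using normal_part_normal[OF D(1)] by (simp add: second_ff_def tan)
    then show ?thesis
      by (simp add: B[of i j] inner_diff_left inner_sum_left)
  qed
  have "(\<Sum>m\<in>UNIV. G l m x * metric_riemann (induced_metric f) m i j k x)
    = (\<Sum>m\<in>UNIV. G l m x * pd i (\<Gamma> m j k) x) - (\<Sum>m\<in>UNIV. G l m x * pd j (\<Gamma> m i k) x)
      + (\<Sum>m\<in>UNIV. G l m x * (\<Sum>s\<in>UNIV. \<Gamma> m i s x * \<Gamma> s j k x - \<Gamma> m j s x * \<Gamma> s i k x))"
    by (simp add: metric_riemann_def \<Gamma>_def[symmetric] algebra_simps sum.distrib sum_subtractf)
  also have "(\<Sum>m\<in>UNIV. G l m x * (\<Sum>s\<in>UNIV. \<Gamma> m i s x * \<Gamma> s j k x - \<Gamma> m j s x * \<Gamma> s i k x))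
    = (\<Sum>s\<in>UNIV. (T l x \<bullet> T2 i s x) * \<Gamma> s j k x) - (\<Sum>s\<in>UNIV. (T l x \<bullet> T2 j s x) * \<Gamma> s i k x)"
  proof -
    have "(\<Sum>m\<in>UNIV. G l m x * (\<Sum>s\<in>UNIV. \<Gamma> m i s x * c s)) = (\<Sum>s\<in>UNIV. (T l x \<bullet> T2 i s x) * c s)" for i c
      unfolding low[symmetric] sum_distrib_left sum_distrib_right mult.assoc by (rule sum.swap)
    then show ?thesis by (simp add: sum_subtractf right_diff_distrib)
  qed
  also have "(\<Sum>m\<in>UNIV. G l m x * pd i (\<Gamma> m j k) x) = T2 i l x \<bullet> T2 j k x + T l x \<bullet> pd i (T2 j k) x
      - (\<Sum>m\<in>UNIV. (T2 i l x \<bullet> T m x) * \<Gamma> m j k x) - (\<Sum>m\<in>UNIV. (T l x \<bullet> T2 i m x) * \<Gamma> m j k x)"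
    using low'[of i l j k] by (simp add: pG sum.distrib algebra_simps)
  also have "(\<Sum>m\<in>UNIV. G l m x * pd j (\<Gamma> m i k) x) = T2 j l x \<bullet> T2 i k x + T l x \<bullet> pd j (T2 i k) x
      - (\<Sum>m\<in>UNIV. (T2 j l x \<bullet> T m x) * \<Gamma> m i k x) - (\<Sum>m\<in>UNIV. (T l x \<bullet> T2 j m x) * \<Gamma> m i k x)"
    using low'[of j l i k] by (simp add: pG sum.distrib algebra_simps)
  finally have "(\<Sum>m\<in>UNIV. G l m x * metric_riemann (induced_metric f) m i j k x)
    = T2 i l x \<bullet> second_ff f x j k - T2 j l x \<bullet> second_ff f x i k"
    by (simp add: sym(2)[of i j k] B inner_diff_right inner_sum_right mult.commute)
  then show ?thesis
    unfolding BB riemann_def G_def by (simp add: inner_commute)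
qed

theorem scalar_curvature_eq_intrinsic:
  fixes f :: "real^'n \<Rightarrow> real^'m"
  assumes "Ck 3 f"
  shows "scalar_curvature f x = metric_scalar_curvature (induced_metric f) x"
proof -
  define H where "H = (\<lambda>i j. inverse_metric f x $ i $ j)"
  have up: "metric_riemann (induced_metric f) i i j k x = (\<Sum>l\<in>UNIV. H i l * riemann f x i j k l)" for i j k
    unfolding H_def gauss_equation[OF assms, symmetric]
    by (rule metric_inverse_sum(2)[OF Ck3D(1)[OF assms], symmetric])
  have "scalar_curvature f x
      = (\<Sum>i\<in>UNIV. \<Sum>j\<in>UNIV. \<Sum>k\<in>UNIV. H j k * metric_riemann (induced_metric f) i i j k x)"
    by (simp add: scalar_curvature_def up H_def sum_distrib_left mult_ac)
  also have "\<dots> = (\<Sum>j\<in>UNIV. \<Sum>i\<in>UNIV. \<Sum>k\<in>UNIV. H j k * metric_riemann (induced_metric f) i i j k x)"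
    by (rule sum.swap)
  also have "\<dots> = (\<Sum>j\<in>UNIV. \<Sum>k\<in>UNIV. \<Sum>i\<in>UNIV. H j k * metric_riemann (induced_metric f) i i j k x)"
    by (intro sum.cong refl sum.swap)
  finally show ?thesis
    by (simp add: metric_scalar_curvature_def H_def inverse_metric_def sum_distrib_left)
qed


subsection \<open>Ricci equation\<close>

text \<open>The normal connection: covariant derivative of a normal field \<open>\<nu>\<close> in direction \<open>\<partial>\<^sub>i\<close>.\<close>

definition normal_conn ::
    "(real^'n \<Rightarrow> real^'m) \<Rightarrow> 'n \<Rightarrow> (real^'n \<Rightarrow> (real^'n) \<times> (real^'m)) \<Rightarrow> real^'n \<Rightarrow> (real^'n) \<times> (real^'m)" where
  "normal_conn f i \<nu> x = normal_part f x (pd i \<nu> x)"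

theorem normal_curvature_eq_connection:
  fixes f :: "real^'n \<Rightarrow> real^'m"
  assumes "Ck 3 f" "Ck 2 \<nu>" "\<And>y. is_normal f y (\<nu> y)"
  shows "normal_conn f i (normal_conn f j \<nu>) x - normal_conn f j (normal_conn f i \<nu>) x
    = normal_curvature f x i j (\<nu> x)"
proof -
  note D = Ck3D[OF assms(1)]
  define T where "T = (\<lambda>i. pd i (graph_map f))"
  define T2 where "T2 = (\<lambda>i j. pd i (pd j (graph_map f)))"
  have tan: "tangent f y i = T i y" for y i by (simp add: tangent_def T_def)
  have dT: "T i differentiable (at y)" "T2 i j differentiable (at y)" "pd i (T j) = T2 i j"
    and sym: "T2 i j y = T2 j i y" for i j y
    using D by (auto simp: T_def T2_def)
  have d\<nu>: "\<nu> differentiable (at y)" "pd i \<nu> differentiable (at y)" for i y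
    using assms(2) by (auto simp: numeral_2_eq_2)
  have n: "T l y \<bullet> \<nu> y = 0" for l y using assms(3) by (simp add: is_normal_def tan)
  have weingarten: "T l y \<bullet> pd j \<nu> y = - (T2 j l y \<bullet> \<nu> y)" for l j y
  proof -
    have "pd j (\<lambda>y. T l y \<bullet> \<nu> y) y = 0"
      unfolding n by (simp add: pd_eqI[OF has_derivative_const])
    then show ?thesis by (simp add: pd_inner(2) dT d\<nu>)
  qed
  define a where "a = (\<lambda>l j y. \<Sum>k\<in>UNIV. inverse_metric f y $ l $ k * (T2 j k y \<bullet> \<nu> y))"
  have da: "a l j differentiable (at y)" for l j y
    unfolding a_def by (intro solution_differentiable D(1,2) pd_inner(1) dT d\<nu>)
  have B\<nu>: "second_ff f y j k \<bullet> \<nu> y = T2 j k y \<bullet> \<nu> y" for y j k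
    using n by (simp add: second_ff_def normal_part_def tan inner_diff_left inner_sum_left T2_def)
  have shape: "shape_operator f x (\<nu> x) $ l $ j = a l j x" for l j
    by (simp add: shape_operator_def a_def B\<nu>)
  have conn: "normal_conn f j \<nu> = (\<lambda>y. pd j \<nu> y + (\<Sum>l\<in>UNIV. a l j y *\<^sub>R T l y))" for j
    by (rule ext) (simp add: normal_conn_def normal_part_def tan weingarten a_def sum_negf)
  have "pd i (normal_conn f j \<nu>) x
      = pd i (pd j \<nu>) x + (\<Sum>l\<in>UNIV. pd i (a l j) x *\<^sub>R T l x + a l j x *\<^sub>R T2 i l x)" for i j
    unfolding conn
    by (simp add: pd_add pd_sum pd_scaleR d\<nu> da dT)
  then have "normal_conn f i (normal_conn f j \<nu>) x
      = normal_part f x (pd i (pd j \<nu>) x) + (\<Sum>l\<in>UNIV. a l j x *\<^sub>R second_ff f x i l)" for i j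
    using normal_part_tangent[OF D(1)]
    by (simp add: normal_conn_def[of f i "normal_conn f j \<nu>"] normal_part_add normal_part_sum
        normal_part_scaleR second_ff_def T2_def tan)
  moreover have "second_ff f x j l = second_ff f x l j" for l
    using sym by (simp add: second_ff_def T2_def)
  ultimately show ?thesis
    by (simp add: normal_curvature_def shape pd_commute[OF assms(2), of i j x] sum_subtractf)
qed


subsection \<open>Area of spheres\<close>

lemma unit_sphere_volume_eq:
  "unit_sphere_volume TYPE('a::euclidean_space) = real DIM('a) * unit_ball_vol (real DIM('a))"
proof -
  define M where "M = restrict_space lborel (ball 0 1 - {0} :: 'a set)"
  have meas: "(\<lambda>x::'a. (1 / norm x) *\<^sub>R x) \<in> M \<rightarrow>\<^sub>M borel"
    unfolding M_def by (rule measurable_restrict_space1) measurable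
  have "emeasure (distr M borel (\<lambda>x. (1 / norm x) *\<^sub>R x)) (sphere 0 1) = emeasure M (space M)"
    by (subst emeasure_distr[OF meas])
       (auto simp: M_def space_restrict_space intro!: arg_cong[where f = "emeasure _"])
  also have "\<dots> = emeasure lborel (ball 0 1 - {0} :: 'a set)"
    by (simp add: M_def space_restrict_space emeasure_restrict_space)
  also have "\<dots> = emeasure lborel (ball (0::'a) 1)"
    by (subst emeasure_Diff) (auto simp: emeasure_ball)
  finally show ?thesis
    by (simp add: unit_sphere_volume_def sphere_area_def measure_def M_def[symmetric] emeasure_ball
        enn2real_mult)
qed

end

theory Submission
  imports Defs
begin

text \<open>
  The mass is the flux at infinity of a vector field, and the total flux of a vector field is the
  integral of its divergence.  Write \<open>g\<close> for the induced metric, \<open>g\<^sup>i\<^sup>j\<close> for its inverse, and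
  let indices of \<open>f\<close> denote partial derivatives.  The relevant field is
  \<open>X\<^sup>j = g\<^sup>i\<^sup>k g\<^sup>j\<^sup>l (\<partial>\<^sub>k g\<^sub>i\<^sub>l - \<partial>\<^sub>l g\<^sub>i\<^sub>k) = (\<Sum>\<alpha>. g\<^sup>i\<^sup>k g\<^sup>j\<^sup>l (f\<^sub>i\<^sub>k f\<^sub>l - f\<^sub>i\<^sub>l f\<^sub>k))\<close>,
  where each \<open>f\<close> in the last sum stands for the component \<open>f\<^sup>\<alpha>\<close>; it is called \<open>mass_field\<close> below.

  With \<open>H\<^sub>\<alpha>\<close> the Hessian of \<open>f\<^sup>\<alpha>\<close> and \<open>p\<^sub>\<alpha> = g\<^sup>-\<^sup>1 \<nabla>f\<^sup>\<alpha>\<close>, the Euclidean divergence of \<open>X\<close> is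
  the scalar curvature plus
  \<open>\<Sum>\<alpha> \<beta>. p\<^sub>\<alpha> \<bullet> (H\<^sub>\<alpha> g\<^sup>-\<^sup>1 H\<^sub>\<beta> - H\<^sub>\<beta> g\<^sup>-\<^sup>1 H\<^sub>\<alpha>) p\<^sub>\<beta>\<close>.
  By the equation of Ricci the commutators vanish when the normal bundle is flat
  (\<open>flat_normal_bundle_commute\<close>), so the divergence of \<open>X\<close> is the scalar curvature
  (\<open>divergence_flux_coeff\<close>), and the flux of \<open>X\<close> through the sphere of radius \<open>r\<close> is the
  integral of the scalar curvature over the ball of radius \<open>r\<close> (\<open>flux_mass_field\<close>).
  Near infinity \<open>X\<close> differs from the field \<open>\<partial>\<^sub>i g\<^sub>i\<^sub>j - \<partial>\<^sub>j g\<^sub>i\<^sub>i\<close> that defines the mass only by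
  terms of degree at least four in the derivatives of \<open>f\<close>, which are \<open>O(|x|\<^sup>-\<^sup>2\<^sup>p\<^sup>-\<^sup>1)\<close>
  (\<open>mass_field_minus_ADM_field_decay\<close>).  Since \<open>2 p > n - 2\<close>, their flux through large spheres
  tends to zero.  Hence the mass exists and is a nonnegative multiple of the integral of the scalar
  curvature over \<open>\<real>\<^sup>n\<close> (\<open>ADM_flux_tendsto\<close>).

  One difficulty remains: \<open>f\<close> is only twice continuously differentiable, so \<open>X\<close> is merely
  continuous and its divergence exists only in the weak sense.  The formal third derivatives of
  \<open>f\<close> cancel because \<open>X\<^sup>j\<close> is a sum of terms \<open>c\<^sup>j\<^sup>i \<partial>\<^sub>i u\<close> with \<open>c\<close> and \<open>u\<close> of class \<open>C\<^sup>1\<close>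
  and \<open>c\<close> antisymmetric.  Such terms are integrated by parts through
  \<open>\<integral> \<partial>\<^sub>j w \<partial>\<^sub>i u = \<integral> \<partial>\<^sub>i w \<partial>\<^sub>j u\<close> (\<open>integral_pd_swap\<close>), which asks for one derivative of
  each factor only.  Testing with radial cutoffs that drop from \<open>1\<close> to \<open>0\<close> in a shell of
  vanishing thickness then turns the weak identity into the flux identity on each single sphere
  (\<open>thin_shell_limit\<close>).
\<close>

section \<open>Integration by parts against Lipschitz test functions\<close>

lemma lborel_integral_translate:
  fixes F :: "'a::euclidean_space \<Rightarrow> real"
  assumes [measurable]: "F \<in> borel_measurable borel"
  shows "(\<integral>x. F (x + c) \<partial>lborel) = (\<integral>x. F x \<partial>lborel)"
proof -
  have "(\<integral>x. F x \<partial>lborel) = (\<integral>x. F x \<partial>distr lborel borel ((+) c))"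
    by (simp only: lborel_distr_plus)
  also have "\<dots> = (\<integral>x. F (c + x) \<partial>lborel)" by (rule integral_distr) auto
  finally show ?thesis by (simp add: add.commute)
qed

lemma integrable_bounded_support:
  fixes f :: "'a::euclidean_space \<Rightarrow> real"
  assumes "f \<in> borel_measurable borel" "\<And>x. \<bar>f x\<bar> \<le> B" "\<And>x. R < norm x \<Longrightarrow> f x = 0"
  shows "integrable lborel f"
proof (rule Bochner_Integration.integrable_bound)
  show "integrable lborel (\<lambda>x::'a. indicator (cball 0 R) x *\<^sub>R B)"
    by (rule borel_integrable_compact) auto
  show "AE x in lborel. norm (f x) \<le> norm (indicator (cball 0 R) x *\<^sub>R B)"
  proof (rule AE_I2)
    show "norm (f x) \<le> norm (indicator (cball 0 R) x *\<^sub>R B)" for x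
      using assms(2)[of x] assms(3)[of x] by (cases "norm x \<le> R") auto
  qed
qed (use assms in auto)

lemma difference_quotient_sequence:
  fixes h :: "real \<Rightarrow> real"
  assumes "(h has_real_derivative D) (at 0)"
  shows "(\<lambda>k. (h (1 / real (Suc k)) - h 0) * real (Suc k)) \<longlonglongrightarrow> D"
    and "(\<lambda>k. (h (- (1 / real (Suc k))) - h 0) * real (Suc k)) \<longlonglongrightarrow> - D"
proof -
  have lim: "((\<lambda>t. (h t - h 0) / t) \<longlongrightarrow> D) (at 0)"
    using assms by (simp add: DERIV_def)
  have s: "(\<lambda>k. 1 / real (Suc k)) \<longlonglongrightarrow> 0" 
    using LIMSEQ_inverse_real_of_nat by (simp add: inverse_eq_divide)
  have "filterlim (\<lambda>k. 1 / real (Suc k)) (at 0) sequentially"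
    using s by (intro filterlim_atI) auto
  from filterlim_compose[OF lim this]
  show "(\<lambda>k. (h (1 / real (Suc k)) - h 0) * real (Suc k)) \<longlonglongrightarrow> D" by simp
  have "filterlim (\<lambda>k. - (1 / real (Suc k))) (at 0) sequentially"
    using tendsto_minus[OF s] by (intro filterlim_atI) auto
  from tendsto_minus[OF filterlim_compose[OF lim this]]
  show "(\<lambda>k. (h (- (1 / real (Suc k))) - h 0) * real (Suc k)) \<longlonglongrightarrow> - D" by simp
qed

text \<open>
  The difference quotients of \<open>F\<close> have integral zero by translation invariance, and the Lipschitz
  bound dominates them.  Differentiability is asked for only almost everywhere, so that piecewise
  linear cutoff functions are covered.
\<close>

lemma integral_directional_derivative_eq_0:
  fixes F G :: "'a::euclidean_space \<Rightarrow> real"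
  assumes F: "integrable lborel F" and G: "G \<in> borel_measurable borel"
    and lip: "\<And>x t. \<bar>t\<bar> \<le> 1 \<Longrightarrow> \<bar>F (x + t *\<^sub>R e) - F x\<bar> \<le> K * \<bar>t\<bar>"
    and supp: "\<And>x. R < norm x \<Longrightarrow> F x = 0"
    and deriv: "AE x in lborel. ((\<lambda>t. F (x + t *\<^sub>R e)) has_real_derivative G x) (at 0)"
  shows "(\<integral>x. G x \<partial>lborel) = 0"
proof -
  define Q where "Q k x = (F (x + (1 / real (Suc k)) *\<^sub>R e) - F x) * real (Suc k)" for k x
  have Fm[measurable]: "F \<in> borel_measurable borel" using F by auto
  have Ft: "integrable lborel (\<lambda>x. F (x + c))" for c
  proof -
    have "integrable (distr lborel borel ((+) c)) F" using F by (simp only: lborel_distr_plus)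
    then show ?thesis by (subst (asm) integrable_distr_eq) (auto simp: add.commute)
  qed
  have Q0: "(\<integral>x. Q k x \<partial>lborel) = 0" for k
    using F Ft by (simp add: Q_def lborel_integral_translate)
  have "(\<lambda>k. \<integral>x. Q k x \<partial>lborel) \<longlonglongrightarrow> (\<integral>x. G x \<partial>lborel)"
  proof (rule integral_dominated_convergence)
    show "integrable lborel (\<lambda>x. indicator (cball 0 (\<bar>R\<bar> + norm e)) x *\<^sub>R K)"
      by (rule borel_integrable_compact) auto
    show "AE x in lborel. (\<lambda>k. Q k x) \<longlonglongrightarrow> G x"
      using deriv
    proof eventually_elim
      case (elim x)
      from difference_quotient_sequence(1)[OF elim] show ?case by (simp add: Q_def)
    qed
    show "AE x in lborel. norm (Q k x) \<le> indicator (cball 0 (\<bar>R\<bar> + norm e)) x *\<^sub>R K" for k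
    proof (rule AE_I2)
      fix x
      show "norm (Q k x) \<le> indicator (cball 0 (\<bar>R\<bar> + norm e)) x *\<^sub>R K"
      proof (cases "norm x \<le> \<bar>R\<bar> + norm e")
        case True
        then show ?thesis
          using lip[of "1 / real (Suc k)" x]
          by (simp add: Q_def abs_mult pos_le_divide_eq del: of_nat_Suc)
      next
        case False
        have "norm ((1 / real (Suc k)) *\<^sub>R e) \<le> norm e"
          by (simp add: field_simps mult_left_le)
        moreover have "norm x \<le> norm (x + (1 / real (Suc k)) *\<^sub>R e) + norm ((1 / real (Suc k)) *\<^sub>R e)"
          using norm_triangle_ineq4[of "x + (1 / real (Suc k)) *\<^sub>R e" "(1 / real (Suc k)) *\<^sub>R e"] by simp
        ultimately have "R < norm (x + (1 / real (Suc k)) *\<^sub>R e)" "R < norm x"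
          using False norm_ge_zero[of e] by linarith+
        then show ?thesis using supp False by (simp add: Q_def)
      qed
    qed
    show "Q k \<in> borel_measurable lborel" for k unfolding Q_def[abs_def] by measurable
  qed (use G in auto)
  then show ?thesis unfolding Q0 by (simp add: LIMSEQ_const_iff)
qed

lemma Ck1D:
  fixes u :: "real^'n \<Rightarrow> 'b::real_normed_vector"
  assumes "Ck 1 u"
  shows "u differentiable (at x)" "continuous_on S (pd i u)" "continuous_on S u"
proof -
  show d: "u differentiable (at x)" for x using assms by simp
  show "continuous_on S (pd i u)" using assms by (auto intro: continuous_on_subset)
  show "continuous_on S u"
    using d by (intro continuous_at_imp_continuous_on ballI differentiable_imp_continuous_within)
qed

text \<open>
  A single constant for the values, the partial derivatives and the increments along the axes keeps
  the later domination arguments short.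
\<close>

lemma Ck1_locally_lipschitz:
  fixes u :: "real^'n \<Rightarrow> real"
  assumes u: "Ck 1 u"
  obtains K where "K \<ge> 0" "\<And>x. norm x \<le> R \<Longrightarrow> \<bar>u x\<bar> \<le> K" "\<And>i x. norm x \<le> R \<Longrightarrow> \<bar>pd i u x\<bar> \<le> K"
    "\<And>i x t. norm x \<le> R \<Longrightarrow> \<bar>t\<bar> \<le> 1 \<Longrightarrow> \<bar>u (x + t *\<^sub>R axis i 1) - u x\<bar> \<le> K * \<bar>t\<bar>"
proof -
  define C where "C = cball (0::real^'n) (R + 1)"
  have "\<exists>B. \<forall>x\<in>C. \<bar>h x\<bar> \<le> B" if "continuous_on C h" for h :: "real^'n \<Rightarrow> real"
    using compact_imp_bounded[OF compact_continuous_image[OF that]]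
    by (auto simp: C_def bounded_iff)
  note bd = this
  obtain B where B: "\<And>x. x \<in> C \<Longrightarrow> \<bar>u x\<bar> \<le> B" using bd[OF Ck1D(3)[OF u]] by blast
  have "\<forall>i. \<exists>B. \<forall>x\<in>C. \<bar>pd i u x\<bar> \<le> B" using bd[OF Ck1D(2)[OF u]] by blast
  then obtain B' where B': "\<And>i x. x \<in> C \<Longrightarrow> \<bar>pd i u x\<bar> \<le> B' i" by metis
  define K where "K = \<bar>B\<bar> + (\<Sum>i\<in>UNIV. \<bar>B' i\<bar>)"
  have sB: "0 \<le> (\<Sum>i\<in>UNIV. \<bar>B' i\<bar>)" by (simp add: sum_nonneg)
  have BK: "B \<le> K" "0 \<le> K" using sB abs_ge_self[of B] abs_ge_zero[of B] unfolding K_def by linarith+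
  have B'K: "B' i \<le> K" for i
  proof -
    have "\<bar>B' i\<bar> \<le> (\<Sum>i\<in>UNIV. \<bar>B' i\<bar>)" by (rule member_le_sum) auto
    then show ?thesis by (simp add: K_def)
  qed
  show ?thesis
  proof (rule that)
    show "K \<ge> 0" by fact
    show "\<bar>u x\<bar> \<le> K" if "norm x \<le> R" for x
      using B[of x] BK that by (simp add: C_def)
    have pK: "\<bar>pd i u x\<bar> \<le> K" if "x \<in> C" for i x
      using B'[of x i] B'K[of i] that by simp
    then show "\<bar>pd i u x\<bar> \<le> K" if "norm x \<le> R" for i x
      using that by (simp add: C_def)
    show "\<bar>u (x + t *\<^sub>R axis i 1) - u x\<bar> \<le> K * \<bar>t\<bar>" if x: "norm x \<le> R" and t: "\<bar>t\<bar> \<le> 1" for i x t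
    proof -
      have "norm (u (x + t *\<^sub>R axis i 1) - u (x + 0 *\<^sub>R axis i 1)) \<le> K * norm (t - 0)"
      proof (rule field_differentiable_bound[where S = "{-1..1}" and f = "\<lambda>s. u (x + s *\<^sub>R axis i 1)"])
        fix s :: real assume s: "s \<in> {-1..1}"
        show "((\<lambda>s. u (x + s *\<^sub>R axis i 1)) has_field_derivative pd i u (x + s *\<^sub>R axis i 1))
            (at s within {-1..1})"
          unfolding has_real_derivative_iff_has_vector_derivative
          by (rule has_vector_derivative_at_within[OF pd_line[OF Ck1D(1)[OF u]]])
        have "norm (x + s *\<^sub>R axis i 1) \<le> R + 1"
          using norm_triangle_ineq[of x "s *\<^sub>R axis i 1"] x s by (auto simp: norm_axis_1)
        then show "norm (pd i u (x + s *\<^sub>R axis i 1)) \<le> K" using pK by (simp add: C_def)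
      qed (use t in auto)
      then show ?thesis by simp
    qed
  qed
qed

text \<open>
  \<open>G i\<close> is a version of the \<open>i\<close>-th partial derivative of \<open>w\<close>, prescribed everywhere but
  compared with \<open>w\<close> only almost everywhere: it has to be Borel measurable, which a function with
  arbitrary values on a null set need not be.  Only increments along the axes enter the arguments,
  hence the form of the Lipschitz condition.
\<close>

definition lipschitz_test :: "(real^'n \<Rightarrow> real) \<Rightarrow> ('n \<Rightarrow> real^'n \<Rightarrow> real) \<Rightarrow> bool" where
  "lipschitz_test w G \<longleftrightarrow>
     continuous_on UNIV w \<and> (\<forall>i. G i \<in> borel_measurable borel) \<and>
     (\<exists>R K. 0 \<le> K \<and> (\<forall>x. R < norm x \<longrightarrow> w x = 0 \<and> (\<forall>i. G i x = 0)) \<and>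
        (\<forall>i x. \<bar>G i x\<bar> \<le> K) \<and>
        (\<forall>i x t. \<bar>t\<bar> \<le> 1 \<longrightarrow> \<bar>w (x + t *\<^sub>R axis i 1) - w x\<bar> \<le> K * \<bar>t\<bar>)) \<and>
     (AE x in lborel. \<forall>i. ((\<lambda>t. w (x + t *\<^sub>R axis i 1)) has_real_derivative G i x) (at 0))"

lemma lipschitz_testE:
  assumes "lipschitz_test w G"
  obtains R K where "0 \<le> K" "\<And>x. R < norm x \<Longrightarrow> w x = 0" "\<And>i x. R < norm x \<Longrightarrow> G i x = 0"
    "\<And>x. \<bar>w x\<bar> \<le> K" "\<And>i x. \<bar>G i x\<bar> \<le> K"
    "\<And>i x t. \<bar>t\<bar> \<le> 1 \<Longrightarrow> \<bar>w (x + t *\<^sub>R axis i 1) - w x\<bar> \<le> K * \<bar>t\<bar>"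
proof -
  obtain R K where RK: "0 \<le> K" "\<And>x. R < norm x \<Longrightarrow> w x = 0 \<and> (\<forall>i. G i x = 0)"
    "\<And>i x. \<bar>G i x\<bar> \<le> K" "\<And>i x t. \<bar>t\<bar> \<le> 1 \<Longrightarrow> \<bar>w (x + t *\<^sub>R axis i 1) - w x\<bar> \<le> K * \<bar>t\<bar>"
    using assms unfolding lipschitz_test_def by blast
  have c: "continuous_on (cball 0 R) w"
    using assms by (auto simp: lipschitz_test_def intro: continuous_on_subset)
  obtain B where "\<forall>x\<in>cball 0 R. \<bar>w x\<bar> \<le> B"
    using compact_imp_bounded[OF compact_continuous_image[OF c]] by (auto simp: bounded_iff)
  then have B: "\<And>x. norm x \<le> R \<Longrightarrow> \<bar>w x\<bar> \<le> B" by simp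
  have *: "\<bar>w x\<bar> \<le> max K B" for x
    using B[of x] RK(1) RK(2)[of x] by (cases "norm x \<le> R") auto
  have **: "K * \<bar>t\<bar> \<le> max K B * \<bar>t\<bar>" for t by (rule mult_right_mono) auto
  show ?thesis
  proof (rule that[of "max K B" R])
    show "\<bar>G i x\<bar> \<le> max K B" for i x using RK(3)[of i x] by simp
    show "\<bar>w (x + t *\<^sub>R axis i 1) - w x\<bar> \<le> max K B * \<bar>t\<bar>" if "\<bar>t\<bar> \<le> 1" for i x t
      using RK(4)[OF that, where x = x and i = i] ** order_trans by blast
  qed (use RK * in auto)
qed

lemma lipschitz_test_measurable:
  assumes "lipschitz_test w G"
  shows "w \<in> borel_measurable borel" "G i \<in> borel_measurable borel"
  using assms by (auto simp: lipschitz_test_def intro: borel_measurable_continuous_onI)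

lemma lipschitz_test_mult:
  fixes w b :: "real^'n \<Rightarrow> real"
  assumes w: "lipschitz_test w G" and b: "Ck 1 b"
  shows "lipschitz_test (\<lambda>x. w x * b x) (\<lambda>i x. G i x * b x + w x * pd i b x)"
proof -
  obtain R K where RK: "0 \<le> K" "\<And>x. R < norm x \<Longrightarrow> w x = 0" "\<And>i x. R < norm x \<Longrightarrow> G i x = 0"
    "\<And>x. \<bar>w x\<bar> \<le> K" "\<And>i x. \<bar>G i x\<bar> \<le> K"
    "\<And>i x t. \<bar>t\<bar> \<le> 1 \<Longrightarrow> \<bar>w (x + t *\<^sub>R axis i 1) - w x\<bar> \<le> K * \<bar>t\<bar>"
    by (rule lipschitz_testE[OF w], rule that)
  obtain L where L: "L \<ge> 0" "\<And>x. norm x \<le> R + 2 \<Longrightarrow> \<bar>b x\<bar> \<le> L"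
    "\<And>i x. norm x \<le> R + 2 \<Longrightarrow> \<bar>pd i b x\<bar> \<le> L"
    "\<And>i x t. norm x \<le> R + 2 \<Longrightarrow> \<bar>t\<bar> \<le> 1 \<Longrightarrow> \<bar>b (x + t *\<^sub>R axis i 1) - b x\<bar> \<le> L * \<bar>t\<bar>"
    by (rule Ck1_locally_lipschitz[OF b], rule that)
  have [measurable]: "w \<in> borel_measurable borel" "G i \<in> borel_measurable borel"
    "b \<in> borel_measurable borel" "pd i b \<in> borel_measurable borel" for i
    using lipschitz_test_measurable[OF w] Ck1D[OF b]
    by (auto intro: borel_measurable_continuous_onI)
  have bound: "\<bar>G i x * b x + w x * pd i b x\<bar> \<le> 2 * K * L" for i x
  proof (cases "norm x \<le> R")
    case True
    then have "\<bar>G i x * b x\<bar> \<le> K * L" "\<bar>w x * pd i b x\<bar> \<le> K * L"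
      unfolding abs_mult using RK L by (auto intro!: mult_mono)
    then show ?thesis by linarith
  next
    case False
    then show ?thesis using RK L by simp
  qed
  have lip: "\<bar>w (x + t *\<^sub>R axis i 1) * b (x + t *\<^sub>R axis i 1) - w x * b x\<bar> \<le> 2 * K * L * \<bar>t\<bar>"
    if t: "\<bar>t\<bar> \<le> 1" for i x t
  proof -
    define y where "y = x + t *\<^sub>R axis i 1"
    have ny: "norm y \<le> norm x + 1" "norm x \<le> norm y + 1"
      using norm_triangle_ineq[of x "t *\<^sub>R axis i 1"] norm_triangle_ineq4[of y "t *\<^sub>R axis i 1"] t
      by (auto simp: y_def norm_axis_1)
    show ?thesis
    proof (cases "norm x \<le> R + 1")
      case True
      have "\<bar>(w y - w x) * b y\<bar> \<le> (K * \<bar>t\<bar>) * L" "\<bar>w x * (b y - b x)\<bar> \<le> K * (L * \<bar>t\<bar>)"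
        unfolding abs_mult using RK L True ny t by (auto intro!: mult_mono simp: y_def)
      moreover have "w y * b y - w x * b x = (w y - w x) * b y + w x * (b y - b x)"
        by (simp add: algebra_simps)
      ultimately show ?thesis unfolding y_def[symmetric] by (simp add: mult_ac)
    next
      case False
      then show ?thesis using RK(1,2) L(1) ny by (simp add: y_def[symmetric])
    qed
  qed
  have "AE x in lborel. \<forall>i. ((\<lambda>t. w (x + t *\<^sub>R axis i 1)) has_real_derivative G i x) (at 0)"
    using w by (simp add: lipschitz_test_def)
  then have "AE x in lborel. \<forall>i. ((\<lambda>t. w (x + t *\<^sub>R axis i 1) * b (x + t *\<^sub>R axis i 1))
      has_real_derivative (G i x * b x + w x * pd i b x)) (at 0)"
  proof eventually_elim
    case (elim x)
    have "((\<lambda>t. b (x + t *\<^sub>R axis i 1)) has_real_derivative pd i b x) (at 0)" for i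
      using pd_line[of b x 0 i] Ck1D(1)[OF b]
      by (simp add: has_real_derivative_iff_has_vector_derivative)
    then show ?case using elim by (auto intro!: derivative_eq_intros)
  qed
  moreover have "continuous_on UNIV (\<lambda>x. w x * b x)"
    using w Ck1D[OF b] by (auto simp: lipschitz_test_def intro: continuous_on_mult)
  moreover have "0 \<le> 2 * K * L" using RK(1) L(1) by simp
  ultimately show ?thesis
    unfolding lipschitz_test_def
  proof (intro conjI)
    show "\<forall>i. (\<lambda>x. G i x * b x + w x * pd i b x) \<in> borel_measurable borel"
      by (rule allI) measurable
    show "\<exists>R K. 0 \<le> K \<and> (\<forall>x. R < norm x \<longrightarrow> w x * b x = 0 \<and> (\<forall>i. G i x * b x + w x * pd i b x = 0)) \<and>
        (\<forall>i x. \<bar>G i x * b x + w x * pd i b x\<bar> \<le> K) \<and>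
        (\<forall>i x t. \<bar>t\<bar> \<le> 1 \<longrightarrow>
           \<bar>w (x + t *\<^sub>R axis i 1) * b (x + t *\<^sub>R axis i 1) - w x * b x\<bar> \<le> K * \<bar>t\<bar>)"
      by (rule exI[of _ R], rule exI[of _ "2 * K * L"]) (use bound lip RK(1-3) L(1) in simp)
  qed
qed

lemma integral_lipschitz_test_eq_0:
  assumes "lipschitz_test w G"
  shows "(\<integral>x. G i x \<partial>lborel) = 0"
proof -
  obtain R K where RK: "0 \<le> K" "\<And>x. R < norm x \<Longrightarrow> w x = 0" "\<And>i x. R < norm x \<Longrightarrow> G i x = 0"
    "\<And>x. \<bar>w x\<bar> \<le> K" "\<And>i x. \<bar>G i x\<bar> \<le> K"
    "\<And>i x t. \<bar>t\<bar> \<le> 1 \<Longrightarrow> \<bar>w (x + t *\<^sub>R axis i 1) - w x\<bar> \<le> K * \<bar>t\<bar>"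
    by (rule lipschitz_testE[OF assms], rule that)
  show ?thesis
  proof (rule integral_directional_derivative_eq_0[where F = w and K = K and R = R])
    show "integrable lborel w"
      using RK by (intro integrable_bounded_support[of w K R] lipschitz_test_measurable[OF assms])
    show "AE x in lborel. ((\<lambda>t. w (x + t *\<^sub>R axis i 1)) has_real_derivative G i x) (at 0)"
      using assms by (auto simp: lipschitz_test_def)
  qed (use RK lipschitz_test_measurable[OF assms] in auto)
qed

lemma pd_translate:
  fixes u :: "real^'n \<Rightarrow> 'b::real_normed_vector"
  assumes "u differentiable (at (x + c))"
  shows "(\<lambda>x. u (x + c)) differentiable (at x)" "pd i (\<lambda>x. u (x + c)) x = pd i u (x + c)"
proof -
  have "((\<lambda>x. u (x + c)) has_derivative frechet_derivative u (at (x + c))) (at x)"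
    by (rule has_derivative_compose[where f = "\<lambda>x. x + c", OF _ has_derivative_frechet[OF assms]])
       (auto intro!: derivative_eq_intros)
  then show "(\<lambda>x. u (x + c)) differentiable (at x)" "pd i (\<lambda>x. u (x + c)) x = pd i u (x + c)"
    by (auto simp: pd_eqI pd_def[symmetric] differentiable_def)
qed

text \<open>
  For smooth \<open>u\<close> both sides equal \<open>- \<integral> w \<partial>\<^sub>i \<partial>\<^sub>j u\<close>.  To avoid second derivatives of \<open>u\<close>, the
  derivative \<open>\<partial>\<^sub>i u\<close> is replaced by a difference quotient, the \<open>j\<close>-derivative is moved from \<open>w\<close>
  to that quotient, and a translation then moves the difference quotient from \<open>\<partial>\<^sub>j u\<close> back to \<open>w\<close>.
\<close>

lemma integral_pd_swap:
  fixes u :: "real^'n \<Rightarrow> real"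
  assumes w: "lipschitz_test w G" and u: "Ck 1 u"
  shows "(\<integral>x. G j x * pd i u x \<partial>lborel) = (\<integral>x. G i x * pd j u x \<partial>lborel)"
proof -
  obtain R K where RK: "0 \<le> K" "\<And>x. R < norm x \<Longrightarrow> w x = 0" "\<And>i x. R < norm x \<Longrightarrow> G i x = 0"
    "\<And>x. \<bar>w x\<bar> \<le> K" "\<And>i x. \<bar>G i x\<bar> \<le> K"
    "\<And>i x t. \<bar>t\<bar> \<le> 1 \<Longrightarrow> \<bar>w (x + t *\<^sub>R axis i 1) - w x\<bar> \<le> K * \<bar>t\<bar>"
    by (rule lipschitz_testE[OF w], rule that)
  obtain L where L: "L \<ge> 0" "\<And>x. norm x \<le> R + 2 \<Longrightarrow> \<bar>u x\<bar> \<le> L"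
    "\<And>i x. norm x \<le> R + 2 \<Longrightarrow> \<bar>pd i u x\<bar> \<le> L"
    "\<And>i x t. norm x \<le> R + 2 \<Longrightarrow> \<bar>t\<bar> \<le> 1 \<Longrightarrow> \<bar>u (x + t *\<^sub>R axis i 1) - u x\<bar> \<le> L * \<bar>t\<bar>"
    by (rule Ck1_locally_lipschitz[OF u], rule that)
  have [measurable]: "w \<in> borel_measurable borel" "G i \<in> borel_measurable borel"
    "u \<in> borel_measurable borel" "pd i u \<in> borel_measurable borel" for i
    using lipschitz_test_measurable[OF w] Ck1D[OF u]
    by (auto intro: borel_measurable_continuous_onI)
  define e :: "real^'n" where "e = axis i 1"
  define h where "h k = 1 / real (Suc k)" for k
  have h: "0 < h k" "h k \<le> 1" "h k * real (Suc k) = 1" for k by (auto simp: h_def)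
  have near: "norm (x + t *\<^sub>R e) \<le> norm x + 1" "norm x \<le> norm (x + t *\<^sub>R e) + 1" if "\<bar>t\<bar> \<le> 1" for x t
    using norm_triangle_ineq[of x "t *\<^sub>R e"] norm_triangle_ineq4[of "x + t *\<^sub>R e" "t *\<^sub>R e"] that
    by (auto simp: e_def norm_axis_1)
  have supp: "w y = 0" if "R + 1 < norm x" "norm x \<le> norm y + 1" for x y using that RK(2) by simp
  \<comment> \<open>Summation by parts: the step \<open>h k\<close> in direction \<open>i\<close> passes from \<open>u\<close> to \<open>w\<close> with reversed sign.\<close>
  have step: "(\<integral>x. G j x * ((u (x + h k *\<^sub>R e) - u x) * real (Suc k)) \<partial>lborel)
      = - (\<integral>x. ((w (x - h k *\<^sub>R e) - w x) * real (Suc k)) * pd j u x \<partial>lborel)" for k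
  proof -
    define c where "c = h k *\<^sub>R e"
    have c: "norm (x + c) \<le> norm x + 1" "norm x \<le> norm (x + c) + 1"
      "norm (x - c) \<le> norm x + 1" "norm x \<le> norm (x - c) + 1" for x
      using near[of "h k" x] near[of "- h k" x] h[of k] by (auto simp: c_def)
    have uc: "Ck 1 (\<lambda>x. u (x + c) - u x)" and pc: "pd j (\<lambda>x. u (x + c) - u x) x = pd j u (x + c) - pd j u x" for x
    proof -
      have p: "pd j (\<lambda>x. u (x + c) - u x) = (\<lambda>x. pd j u (x + c) - pd j u x)" for j
        by (rule ext) (simp add: pd_diff pd_translate Ck1D(1)[OF u])
      then show "pd j (\<lambda>x. u (x + c) - u x) x = pd j u (x + c) - pd j u x" by simp
      have "continuous_on UNIV (\<lambda>x. pd j u (x + c) - pd j u x)" for j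
        by (intro continuous_intros continuous_on_compose2[OF Ck1D(2)[OF u]] Ck1D(2)[OF u]) auto
      then show "Ck 1 (\<lambda>x. u (x + c) - u x)"
        using Ck1D(1)[OF u] by (auto simp: p intro!: differentiable_diff pd_translate(1))
    qed
    have t: "lipschitz_test (\<lambda>x. w x * (u (x + c) - u x))
       (\<lambda>i x. G i x * (u (x + c) - u x) + w x * pd i (\<lambda>x. u (x + c) - u x) x)"
      by (rule lipschitz_test_mult[OF w uc])
    have wu: "\<bar>w y * pd j u x\<bar> \<le> K * L" if "norm x \<le> norm y + 1" for x y
    proof (cases "norm y \<le> R")
      case True
      then show ?thesis unfolding abs_mult using RK L that by (intro mult_mono) auto
    qed (use RK L in simp)
    have i1: "integrable lborel (\<lambda>x. G j x * (u (x + c) - u x))"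
    proof (rule integrable_bounded_support[of _ "K * L" R])
      show "\<bar>G j x * (u (x + c) - u x)\<bar> \<le> K * L" for x
      proof (cases "norm x \<le> R")
        case True
        have "\<bar>u (x + c) - u x\<bar> \<le> L * \<bar>h k\<bar>"
          using L(4)[of x "h k" i] True h[of k] by (simp add: c_def e_def)
        also have "\<dots> \<le> L" using h[of k] L(1) by (simp add: mult_left_le)
        finally show ?thesis unfolding abs_mult using RK L by (intro mult_mono) auto
      qed (use RK L in simp)
    qed (use RK in auto)
    have i2: "integrable lborel (\<lambda>x. w x * pd j u (x + c))" "integrable lborel (\<lambda>x. w x * pd j u x)"
      "integrable lborel (\<lambda>x. w (x - c) * pd j u x)"
      using wu c supp[OF _ c(4)] RK(2)
      by (auto intro!: integrable_bounded_support[of _ "K * L" "R + 1"])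
    have "0 = (\<integral>x. G j x * (u (x + c) - u x) + w x * (pd j u (x + c) - pd j u x) \<partial>lborel)"
      using integral_lipschitz_test_eq_0[OF t, of j] by (simp add: pc)
    also have "\<dots> = (\<integral>x. G j x * (u (x + c) - u x) \<partial>lborel)
        + ((\<integral>x. w x * pd j u (x + c) \<partial>lborel) - (\<integral>x. w x * pd j u x \<partial>lborel))"
      using i1 i2 by (simp add: right_diff_distrib[of "w _"])
    also have "(\<integral>x. w x * pd j u (x + c) \<partial>lborel) = (\<integral>x. w (x - c) * pd j u x \<partial>lborel)"
      using lborel_integral_translate[of "\<lambda>x. w (x - c) * pd j u x" c] by simp
    finally have "(\<integral>x. G j x * (u (x + c) - u x) \<partial>lborel)
        = - (\<integral>x. (w (x - c) - w x) * pd j u x \<partial>lborel)"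
      using i2 by (simp add: left_diff_distrib)
    then show ?thesis
      by (simp add: c_def[symmetric] mult.assoc[symmetric] mult.commute[of _ "pd j u _"])
  qed
  have l1: "(\<lambda>k. \<integral>x. G j x * ((u (x + h k *\<^sub>R e) - u x) * real (Suc k)) \<partial>lborel)
      \<longlonglongrightarrow> (\<integral>x. G j x * pd i u x \<partial>lborel)"
  proof (rule integral_dominated_convergence)
    show "integrable lborel (\<lambda>x::real^'n. indicator (cball 0 R) x *\<^sub>R (K * L))"
      by (rule borel_integrable_compact) auto
    show "AE x in lborel. (\<lambda>k. G j x * ((u (x + h k *\<^sub>R e) - u x) * real (Suc k)))
        \<longlonglongrightarrow> G j x * pd i u x"
    proof (intro AE_I2 tendsto_mult tendsto_const)
      fix x
      have "((\<lambda>t. u (x + t *\<^sub>R e)) has_real_derivative pd i u x) (at 0)"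
        using pd_line[of u x 0 i] Ck1D(1)[OF u]
        by (simp add: has_real_derivative_iff_has_vector_derivative e_def)
      from difference_quotient_sequence(1)[OF this]
      show "(\<lambda>k. (u (x + h k *\<^sub>R e) - u x) * real (Suc k)) \<longlonglongrightarrow> pd i u x" by (simp add: h_def)
    qed
    show "AE x in lborel. norm (G j x * ((u (x + h k *\<^sub>R e) - u x) * real (Suc k)))
        \<le> indicator (cball 0 R) x *\<^sub>R (K * L)" for k
    proof (rule AE_I2)
      fix x
      show "norm (G j x * ((u (x + h k *\<^sub>R e) - u x) * real (Suc k)))
        \<le> indicator (cball 0 R) x *\<^sub>R (K * L)"
      proof (cases "norm x \<le> R")
        case True
        have "\<bar>u (x + h k *\<^sub>R e) - u x\<bar> * real (Suc k) \<le> L * \<bar>h k\<bar> * real (Suc k)"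
          using L(4)[of x "h k" i] True h[of k] by (intro mult_right_mono) (auto simp: e_def)
        also have "\<dots> = L" using h[of k] by (simp add: mult.assoc)
        finally have "\<bar>(u (x + h k *\<^sub>R e) - u x) * real (Suc k)\<bar> \<le> L" by (simp add: abs_mult)
        then show ?thesis using True RK L unfolding real_norm_def abs_mult[of "G j x"]
          by (auto intro!: mult_mono)
      qed (use RK in simp)
    qed
  qed (measurable)
  have l2: "(\<lambda>k. \<integral>x. ((w (x - h k *\<^sub>R e) - w x) * real (Suc k)) * pd j u x \<partial>lborel)
      \<longlonglongrightarrow> (\<integral>x. - G i x * pd j u x \<partial>lborel)"
  proof (rule integral_dominated_convergence)
    show "integrable lborel (\<lambda>x::real^'n. indicator (cball 0 (R + 1)) x *\<^sub>R (K * L))"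
      by (rule borel_integrable_compact) auto
    have "AE x in lborel. \<forall>i. ((\<lambda>t. w (x + t *\<^sub>R axis i 1)) has_real_derivative G i x) (at 0)"
      using w by (simp add: lipschitz_test_def)
    then show "AE x in lborel. (\<lambda>k. ((w (x - h k *\<^sub>R e) - w x) * real (Suc k)) * pd j u x)
        \<longlonglongrightarrow> - G i x * pd j u x"
    proof eventually_elim
      case (elim x)
      then have "((\<lambda>t. w (x + t *\<^sub>R e)) has_real_derivative G i x) (at 0)" by (simp add: e_def)
      from difference_quotient_sequence(2)[OF this]
      show ?case by (intro tendsto_mult tendsto_const) (simp add: h_def)
    qed
    show "AE x in lborel. norm (((w (x - h k *\<^sub>R e) - w x) * real (Suc k)) * pd j u x)
        \<le> indicator (cball 0 (R + 1)) x *\<^sub>R (K * L)" for k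
    proof (rule AE_I2)
      fix x
      show "norm (((w (x - h k *\<^sub>R e) - w x) * real (Suc k)) * pd j u x)
        \<le> indicator (cball 0 (R + 1)) x *\<^sub>R (K * L)"
      proof (cases "norm x \<le> R + 1")
        case True
        have "\<bar>w (x - h k *\<^sub>R e) - w x\<bar> * real (Suc k) \<le> K * \<bar>- h k\<bar> * real (Suc k)"
          using RK(6)[of "- h k" x i] h[of k] by (intro mult_right_mono) (auto simp: e_def)
        also have "\<dots> = K" using h[of k] by (simp add: mult.assoc)
        finally have "\<bar>(w (x - h k *\<^sub>R e) - w x) * real (Suc k)\<bar> \<le> K" by (simp add: abs_mult)
        then show ?thesis using True RK L unfolding real_norm_def abs_mult[of _ "pd j u x"]
          by (auto intro!: mult_mono)
      next
        case False
        then show ?thesis using supp[of x] near[of "- h k" x] h[of k] by simp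
      qed
    qed
  qed (measurable)
  have "(\<integral>x. G j x * pd i u x \<partial>lborel) = - (\<integral>x. - G i x * pd j u x \<partial>lborel)"
    using LIMSEQ_unique[OF l1[unfolded step] tendsto_minus[OF l2]] .
  then show ?thesis by simp
qed

section \<open>Integrals over spheres as limits of integrals over thin shells\<close>

lemma sphere_area_integral:
  fixes h :: "'a::euclidean_space \<Rightarrow> real"
  assumes r: "r > 0" and h[measurable]: "h \<in> borel_measurable borel"
  shows "(\<integral>x. h x \<partial>sphere_area r)
    = real DIM('a) / r * (\<integral>x. indicator (ball 0 r - {0}) x * h ((r / norm x) *\<^sub>R x) \<partial>lborel)"
proof -
  define M :: "'a measure" where "M = restrict_space lborel (ball 0 r - {0})"
  define D where "D = distr M borel (\<lambda>x::'a. (r / norm x) *\<^sub>R x)"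
  have meas: "(\<lambda>x::'a. (r / norm x) *\<^sub>R x) \<in> M \<rightarrow>\<^sub>M borel"
    unfolding M_def by (rule measurable_restrict_space1) measurable
  have "scale_measure (ennreal (real DIM('a) / r)) D = density D (\<lambda>_. ennreal (real DIM('a) / r))"
    by (rule measure_eqI) (auto simp: emeasure_density_const)
  then have "(\<integral>x. h x \<partial>sphere_area r) = (\<integral>x. h x \<partial>density D (\<lambda>_. ennreal (real DIM('a) / r)))"
    by (simp add: sphere_area_def D_def M_def)
  also have "\<dots> = (\<integral>x. (real DIM('a) / r) *\<^sub>R h x \<partial>D)"
    by (rule integral_density) (use r in \<open>auto simp: D_def\<close>)
  also have "\<dots> = real DIM('a) / r * (\<integral>x. h x \<partial>D)" by simp
  also have "(\<integral>x. h x \<partial>D) = (\<integral>x. h ((r / norm x) *\<^sub>R x) \<partial>M)"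
    unfolding D_def by (rule integral_distr[OF meas]) measurable
  also have "\<dots> = (\<integral>x. indicator (ball 0 r - {0}) x *\<^sub>R h ((r / norm x) *\<^sub>R x) \<partial>lborel)"
    unfolding M_def by (rule integral_restrict_space) auto
  finally show ?thesis by simp
qed

text \<open>
  A function that is constant on rays sees a dilation only through the Jacobian.
\<close>

lemma integral_homogeneous_ball:
  fixes H :: "'a::euclidean_space \<Rightarrow> real"
  assumes [measurable]: "H \<in> borel_measurable borel"
    and hom: "\<And>c x. c > 0 \<Longrightarrow> H (c *\<^sub>R x) = H x" and rs: "r > 0" "s > 0"
  shows "(\<integral>x. indicator (ball 0 s) x * H x \<partial>lborel)
    = (s / r) ^ DIM('a) * (\<integral>x. indicator (ball 0 r) x * H x \<partial>lborel)"
proof -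
  define c where "c = s / r"
  have c: "c > 0" using rs by (simp add: c_def)
  have m: "(\<lambda>x. indicator (ball 0 s) x * H x) \<in> borel_measurable borel"
    by (intro borel_measurable_times borel_measurable_indicator assms(1)) auto
  have "(\<integral>x. indicator (ball 0 s) x * H x \<partial>lborel)
      = (\<integral>x. indicator (ball 0 s) x * H x
           \<partial>density (distr lborel borel (\<lambda>x::'a. 0 + c *\<^sub>R x)) (\<lambda>_. ennreal (\<bar>c\<bar> ^ DIM('a))))"
    using lborel_affine[of c "0::'a"] c by simp
  also have "\<dots> = (\<integral>x. \<bar>c\<bar> ^ DIM('a) *\<^sub>R (indicator (ball 0 s) x * H x)
      \<partial>distr lborel borel (\<lambda>x::'a. 0 + c *\<^sub>R x))"
    by (rule integral_density) (use m in auto)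
  also have "\<dots> = (\<integral>x. \<bar>c\<bar> ^ DIM('a) *\<^sub>R (indicator (ball 0 s) (0 + c *\<^sub>R x) * H (0 + c *\<^sub>R x)) \<partial>lborel)"
    by (rule integral_distr) (use m in auto)
  also have "\<dots> = (\<integral>x. c ^ DIM('a) * (indicator (ball 0 r) x * H x) \<partial>lborel)"
  proof -
    have "(c *\<^sub>R x \<in> ball 0 s) = (x \<in> ball 0 r)" for x :: 'a
      using rs by (simp add: c_def field_simps)
    then show ?thesis using c by (simp add: hom indicator_def)
  qed
  finally show ?thesis by (simp add: c_def)
qed

text \<open>
  On a thin shell \<open>k\<close> is uniformly close to its radial extension \<open>H\<close> from the sphere, and the
  integral of \<open>H\<close> over the shell is computed by scaling.  Since the area measure is defined through
  cones, the same scaling identifies the limit.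
\<close>

lemma thin_shell_limit:
  fixes k :: "'a::euclidean_space \<Rightarrow> real"
  assumes r: "r > 0" and k[measurable]: "k \<in> borel_measurable borel" and cont: "continuous_on (UNIV - {0}) k"
  shows "(\<lambda>m. real (Suc m) * (\<integral>x. indicator {x. r \<le> norm x \<and> norm x < r + 1 / real (Suc m)} x * k x \<partial>lborel))
    \<longlonglongrightarrow> (\<integral>x. k x \<partial>sphere_area r)"
proof -
  define n where "n = DIM('a)"
  define d where "d m = 1 / real (Suc m)" for m
  have d: "0 < d m" "d m \<le> 1" "d m * real (Suc m) = 1" for m by (auto simp: d_def)
  define A where "A m = {x::'a. r \<le> norm x \<and> norm x < r + d m}" for m
  define H where "H x = k ((r / norm x) *\<^sub>R x)" for x
  have Hm[measurable]: "H \<in> borel_measurable borel" unfolding H_def by measurable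
  have Am[measurable]: "A m \<in> sets borel" for m unfolding A_def by measurable
  have hom: "H (c *\<^sub>R x) = H x" if "c > 0" for c x using that by (simp add: H_def)
  define C where "C = cball (0::'a) (r + 1) - ball 0 r"
  have C: "compact C" "C \<subseteq> UNIV - {0}" "y \<in> C \<longleftrightarrow> r \<le> norm y \<and> norm y \<le> r + 1" for y
    using r by (auto simp: C_def compact_diff)
  have kC: "continuous_on C k" using cont C(2) continuous_on_subset by blast
  obtain B0 where "\<forall>x\<in>C. \<bar>k x\<bar> \<le> B0"
    using compact_imp_bounded[OF compact_continuous_image[OF kC C(1)]] by (auto simp: bounded_iff)
  \<comment> \<open>The origin needs its own bound: the quotient by its norm is \<open>0\<close>, so \<open>H 0 = k 0\<close>.\<close>
  define B where "B = max \<bar>B0\<bar> \<bar>k 0\<bar>"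
  have kB: "\<bar>k x\<bar> \<le> B" if "x \<in> C" for x
    using \<open>\<forall>x\<in>C. \<bar>k x\<bar> \<le> B0\<close> that by (force simp: B_def)
  have HB: "\<bar>H x\<bar> \<le> B" for x
  proof (cases "x = 0")
    case False
    then have "(r / norm x) *\<^sub>R x \<in> C" using r by (simp add: C(3))
    then show ?thesis unfolding H_def by (rule kB)
  qed (simp add: H_def B_def)
  have B: "B \<ge> 0" by (simp add: B_def)
  have iH: "integrable lborel (\<lambda>x. indicator (ball 0 s) x * H x)" for s
    by (rule integrable_bounded_support[of _ B s]) (auto simp: indicator_def HB B)
  have iAk: "integrable lborel (\<lambda>x. indicator (A m) x * k x)" for m
    using d[of m]
    by (intro integrable_bounded_support[of _ B "r + 1"]) (auto simp: indicator_def B A_def C(3) intro!: kB)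
  have iAH: "integrable lborel (\<lambda>x. indicator (A m) x * H x)" for m
    using d[of m]
    by (intro integrable_bounded_support[of _ B "r + 1"]) (auto simp: indicator_def B A_def HB)
  have iA: "integrable lborel (\<lambda>x. indicator (A m) x * c)" for m and c :: real
    using d[of m]
    by (intro integrable_bounded_support[of _ "\<bar>c\<bar>" "r + 1"]) (auto simp: indicator_def A_def)
  \<comment> \<open>The volume of the shell divided by its thickness, in units of the volume of the ball.\<close>
  define w where "w m = (((r + d m) / r) ^ n - 1) * real (Suc m)" for m
  have shell: "real (Suc m) * (\<integral>x. indicator (A m) x * F x \<partial>lborel)
      = w m * (\<integral>x. indicator (ball 0 r) x * F x \<partial>lborel)"
    if [measurable]: "F \<in> borel_measurable borel" and h: "\<And>c x. c > 0 \<Longrightarrow> F (c *\<^sub>R x) = F x"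
      and i: "\<And>s. integrable lborel (\<lambda>x. indicator (ball 0 s) x * F x)" for F :: "'a \<Rightarrow> real" and m
  proof -
    have "indicator (A m) x * F x = indicator (ball 0 (r + d m)) x * F x - indicator (ball 0 r) x * F x" for x
      using d(1)[of m] by (auto simp: indicator_def A_def)
    then have "(\<integral>x. indicator (A m) x * F x \<partial>lborel)
        = (\<integral>x. indicator (ball 0 (r + d m)) x * F x \<partial>lborel) - (\<integral>x. indicator (ball 0 r) x * F x \<partial>lborel)"
      using i by simp
    also have "\<dots> = (((r + d m) / r) ^ n - 1) * (\<integral>x. indicator (ball 0 r) x * F x \<partial>lborel)"
      using integral_homogeneous_ball[OF _ h r, of "r + d m"] r d(1)[of m]
      by (simp add: n_def left_diff_distrib)
    finally show ?thesis by (simp add: w_def)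
  qed
  have w: "w \<longlonglongrightarrow> real n / r"
  proof -
    have "((\<lambda>t. ((r + t) / r) ^ n) has_real_derivative real n / r) (at 0)"
      using r by (auto intro!: derivative_eq_intros)
    from difference_quotient_sequence(1)[OF this]
    show ?thesis using r by (simp add: w_def[abs_def] d_def)
  qed
  define V :: real where "V = (\<integral>x. indicator (ball (0::'a) r) x * 1 \<partial>lborel)"
  have V: "V \<ge> 0" by (simp add: V_def)
  have near: "\<exists>N. \<forall>m\<ge>N. \<bar>real (Suc m) * (\<integral>x. indicator (A m) x * k x \<partial>lborel)
      - w m * (\<integral>x. indicator (ball 0 r) x * H x \<partial>lborel)\<bar> \<le> e * (w m * V)" if e: "e > 0" for e
  proof -
    obtain \<delta> where \<delta>: "\<delta> > 0" "\<And>x y. x \<in> C \<Longrightarrow> y \<in> C \<Longrightarrow> dist y x < \<delta> \<Longrightarrow> dist (k y) (k x) < e"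
      using compact_uniformly_continuous[OF kC C(1), unfolded uniformly_continuous_on_def, rule_format, OF e]
      by blast
    obtain N where N: "inverse (real (Suc N)) < \<delta>" using reals_Archimedean[OF \<delta>(1)] by blast
    show ?thesis
    proof (intro exI allI impI)
      fix m assume m: "m \<ge> N"
      then have dm: "d m < \<delta>" using N le_imp_inverse_le[of "real (Suc N)" "real (Suc m)"]
        by (simp add: d_def inverse_eq_divide)
      have pt: "\<bar>indicator (A m) x * k x - indicator (A m) x * H x\<bar> \<le> indicator (A m) x * e" for x
      proof (cases "x \<in> A m")
        case True
        then have x: "r \<le> norm x" "norm x < r + d m" by (auto simp: A_def)
        define y where "y = (r / norm x) *\<^sub>R x"
        have "x \<in> C" "y \<in> C" using x r d[of m] by (auto simp: C(3) y_def)
        moreover have "dist y x < \<delta>"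
        proof -
          have "x - y = ((norm x - r) / norm x) *\<^sub>R x"
            using x r by (simp add: y_def diff_divide_distrib scaleR_left_diff_distrib)
          then have "norm (x - y) = norm x - r" using x r by auto
          then show ?thesis using x dm by (simp add: dist_norm norm_minus_commute)
        qed
        ultimately have "\<bar>k y - k x\<bar> < e" using \<delta>(2) by (auto simp: dist_real_def)
        then show ?thesis using True by (simp add: H_def y_def)
      qed simp
      have "\<bar>(\<integral>x. indicator (A m) x * k x - indicator (A m) x * H x \<partial>lborel)\<bar>
          \<le> (\<integral>x. \<bar>indicator (A m) x * k x - indicator (A m) x * H x\<bar> \<partial>lborel)"
        by (rule integral_abs_bound)
      also have "\<dots> \<le> (\<integral>x. indicator (A m) x * e \<partial>lborel)"
        using iAk iAH iA pt by (intro integral_mono) auto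
      also have "\<dots> = e * (\<integral>x. indicator (A m) x * 1 \<partial>lborel)" by simp
      finally have le: "\<bar>(\<integral>x. indicator (A m) x * k x \<partial>lborel) - (\<integral>x. indicator (A m) x * H x \<partial>lborel)\<bar>
          \<le> e * (\<integral>x. indicator (A m) x * 1 \<partial>lborel)"
        using iAk iAH by simp
      have "\<bar>real (Suc m) * (\<integral>x. indicator (A m) x * k x \<partial>lborel)
          - real (Suc m) * (\<integral>x. indicator (A m) x * H x \<partial>lborel)\<bar>
        \<le> e * (real (Suc m) * (\<integral>x. indicator (A m) x * 1 \<partial>lborel))"
        using mult_left_mono[OF le, of "real (Suc m)"]
        by (simp add: right_diff_distrib[symmetric] abs_mult mult_ac)
      moreover have "real (Suc m) * (\<integral>x. indicator (A m) x * 1 \<partial>lborel) = w m * V"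
        unfolding V_def
      proof (rule shell)
        show "integrable lborel (\<lambda>x. indicator (ball (0::'a) s) x * (1::real))" for s
          by (rule integrable_bounded_support[of _ 1 s]) (auto simp: indicator_def)
      qed auto
      ultimately show "\<bar>real (Suc m) * (\<integral>x. indicator (A m) x * k x \<partial>lborel)
          - w m * (\<integral>x. indicator (ball 0 r) x * H x \<partial>lborel)\<bar> \<le> e * (w m * V)"
        using shell[OF Hm hom iH] by simp
    qed
  qed
  have "(\<lambda>m. real (Suc m) * (\<integral>x. indicator (A m) x * k x \<partial>lborel)
      - w m * (\<integral>x. indicator (ball 0 r) x * H x \<partial>lborel)) \<longlonglongrightarrow> 0"
  proof (rule LIMSEQ_I)
    fix \<epsilon> :: real assume \<epsilon>: "\<epsilon> > 0"
    define q where "q = (real n / r + 1) * V + 1"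
    have q: "q > 0" unfolding q_def using V r by (simp add: add_nonneg_pos)
    obtain N where N: "\<And>m. m \<ge> N \<Longrightarrow> \<bar>real (Suc m) * (\<integral>x. indicator (A m) x * k x \<partial>lborel)
      - w m * (\<integral>x. indicator (ball 0 r) x * H x \<partial>lborel)\<bar> \<le> \<epsilon> / q * (w m * V)"
      using near[of "\<epsilon> / q"] \<epsilon> q by auto
    obtain M where M: "\<And>m. m \<ge> M \<Longrightarrow> \<bar>w m - real n / r\<bar> < 1"
      using LIMSEQ_D[OF w, of 1] by auto
    show "\<exists>no. \<forall>m\<ge>no. norm (real (Suc m) * (\<integral>x. indicator (A m) x * k x \<partial>lborel)
      - w m * (\<integral>x. indicator (ball 0 r) x * H x \<partial>lborel) - 0) < \<epsilon>"
    proof (intro exI allI impI)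
      fix m assume m: "m \<ge> max N M"
      have "w m * V \<le> (real n / r + 1) * V" using M[of m] m V by (intro mult_right_mono) auto
      then have "w m * V < q" by (simp add: q_def)
      then have "\<epsilon> / q * (w m * V) < \<epsilon> / q * q" using \<epsilon> q by (intro mult_strict_left_mono) auto
      also have "\<dots> = \<epsilon>" using q by simp
      finally show "norm (real (Suc m) * (\<integral>x. indicator (A m) x * k x \<partial>lborel)
        - w m * (\<integral>x. indicator (ball 0 r) x * H x \<partial>lborel) - 0) < \<epsilon>"
        using N[of m] m by simp
    qed
  qed
  from tendsto_add[OF this tendsto_mult[OF w tendsto_const[of "\<integral>x. indicator (ball 0 r) x * H x \<partial>lborel"]]]
  have "(\<lambda>m. real (Suc m) * (\<integral>x. indicator (A m) x * k x \<partial>lborel))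
      \<longlonglongrightarrow> real n / r * (\<integral>x. indicator (ball 0 r) x * H x \<partial>lborel)" by simp
  moreover have "(\<integral>x. k x \<partial>sphere_area r) = real n / r * (\<integral>x. indicator (ball 0 r) x * H x \<partial>lborel)"
  proof -
    have "AE x::'a in lborel. x \<noteq> 0" by (rule AE_lborel_singleton)
    then have "AE x in lborel. indicator (ball 0 r - {0}) x * H x = indicator (ball 0 r) x * H x"
      by eventually_elim (simp add: indicator_def)
    then have "(\<integral>x. indicator (ball 0 r - {0}) x * H x \<partial>lborel) = (\<integral>x. indicator (ball 0 r) x * H x \<partial>lborel)"
      by (intro integral_cong_AE borel_measurable_times borel_measurable_indicator) auto
    then show ?thesis unfolding sphere_area_integral[OF r k] by (simp add: n_def H_def)
  qed
  ultimately show ?thesis by (simp add: A_def d_def)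
qed

definition radial_cutoff :: "real \<Rightarrow> real \<Rightarrow> 'a::real_normed_vector \<Rightarrow> real" where
  "radial_cutoff r \<delta> x = max 0 (min 1 ((r + \<delta> - norm x) / \<delta>))"

text \<open>
  The gradient points inwards with length \<open>1 / \<delta>\<close> on the shell.  It is undefined on the two
  bounding spheres, which form a null set; there the value is fixed so that the shell is half open
  and equals the difference of two balls.
\<close>

lemma radial_cutoff_lipschitz_test:
  assumes r: "r > 0" "\<delta> > 0"
  shows "lipschitz_test (radial_cutoff r \<delta> :: real^'n \<Rightarrow> real)
    (\<lambda>i x. - (indicator {x. r \<le> norm x \<and> norm x < r + \<delta>} x * (x $ i / norm x) / \<delta>))"
  (is "lipschitz_test ?w ?G")
proof -
  have lip: "\<bar>?w y - ?w x\<bar> \<le> 1 / \<delta> * norm (y - x)" for x y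
  proof -
    have "\<bar>?w y - ?w x\<bar> \<le> \<bar>(r + \<delta> - norm y) / \<delta> - (r + \<delta> - norm x) / \<delta>\<bar>"
      unfolding radial_cutoff_def by linarith
    also have "\<dots> = \<bar>norm y - norm x\<bar> / \<delta>" using r by (simp add: field_simps diff_divide_distrib[symmetric])
    also have "\<dots> \<le> norm (y - x) / \<delta>" using r norm_triangle_ineq3[of y x] by (simp add: divide_right_mono)
    finally show ?thesis by simp
  qed
  have "AE x in lborel. x \<notin> sphere (0::real^'n) r \<and> x \<notin> sphere (0::real^'n) (r + \<delta>)"
  proof -
    have "sphere (0::real^'n) s \<in> null_sets lborel" for s
      using negligible_sphere[of "0::real^'n" s] by (auto simp: null_sets_completion_iff negligible_iff_null_sets)
    from this[of r] this[of "r + \<delta>"] show ?thesis by (intro AE_conjI AE_not_in)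
  qed
  then have "AE x in lborel. \<forall>i. ((\<lambda>t. ?w (x + t *\<^sub>R axis i 1)) has_real_derivative ?G i x) (at 0)"
  proof eventually_elim
    case (elim x)
    show ?case
    proof
      fix i :: 'n
      have cn: "continuous_on UNIV (\<lambda>t. norm (x + t *\<^sub>R axis i (1::real)))" by (intro continuous_intros)
      consider "norm x < r" | "norm x > r + \<delta>" | "r < norm x" "norm x < r + \<delta>" using elim by fastforce
      then show "((\<lambda>t. ?w (x + t *\<^sub>R axis i 1)) has_real_derivative ?G i x) (at 0)"
      proof cases
        case 1
        have a: "open {t. norm (x + t *\<^sub>R axis i (1::real)) < r}"
          by (intro open_Collect_less cn continuous_on_const)
        have c: "1 = ?w (x + t *\<^sub>R axis i 1)" if "t \<in> {t. norm (x + t *\<^sub>R axis i (1::real)) < r}" for t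
          using that r by (simp add: radial_cutoff_def)
        have b: "0 \<in> {t. norm (x + t *\<^sub>R axis i (1::real)) < r}" using 1 by simp
        have "((\<lambda>t. ?w (x + t *\<^sub>R axis i 1)) has_real_derivative 0) (at 0)"
          by (rule has_field_derivative_transform_within_open[OF DERIV_const a b c])
        then show ?thesis using 1 r by simp
      next
        case 2
        have a: "open {t. r + \<delta> < norm (x + t *\<^sub>R axis i (1::real))}"
          by (intro open_Collect_less cn continuous_on_const)
        have c: "0 = ?w (x + t *\<^sub>R axis i 1)" if "t \<in> {t. r + \<delta> < norm (x + t *\<^sub>R axis i (1::real))}" for t
          using that r by (simp add: radial_cutoff_def field_simps)
        have b: "0 \<in> {t. r + \<delta> < norm (x + t *\<^sub>R axis i (1::real))}" using 2 by simp
        have "((\<lambda>t. ?w (x + t *\<^sub>R axis i 1)) has_real_derivative 0) (at 0)"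
          by (rule has_field_derivative_transform_within_open[OF DERIV_const a b c])
        then show ?thesis using 2 r by simp
      next
        case 3
        have x: "x \<noteq> 0" using 3 r by auto
        have "((\<lambda>t. norm (x + t *\<^sub>R axis i 1)) has_derivative (\<lambda>s. (s *\<^sub>R axis i 1) \<bullet> sgn x)) (at 0)"
        proof (rule has_derivative_compose[where g = norm and g' = "\<lambda>h. h \<bullet> sgn x"
              and f = "\<lambda>t. x + t *\<^sub>R axis i 1" and f' = "\<lambda>s. s *\<^sub>R axis i 1"])
          show "((\<lambda>t. x + t *\<^sub>R axis i 1) has_derivative (\<lambda>s. s *\<^sub>R axis i 1)) (at 0)"
            by (auto intro!: derivative_eq_intros)
          show "(norm has_derivative (\<lambda>h. h \<bullet> sgn x)) (at (x + 0 *\<^sub>R axis i 1))"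
            using has_derivative_norm[OF x] by simp
        qed
        moreover have "(\<lambda>s. (s *\<^sub>R axis i 1) \<bullet> sgn x) = (*) (x $ i / norm x)"
          by (auto simp: sgn_div_norm inner_axis' field_simps)
        ultimately have "((\<lambda>t. norm (x + t *\<^sub>R axis i 1)) has_real_derivative (x $ i / norm x)) (at 0)"
          unfolding has_field_derivative_def by simp
        then have D: "((\<lambda>t. (r + \<delta> - norm (x + t *\<^sub>R axis i 1)) / \<delta>) has_real_derivative - (x $ i / norm x / \<delta>)) (at 0)"
          using r by (auto intro!: derivative_eq_intros)
        define S where "S = {t. r < norm (x + t *\<^sub>R axis i (1::real))} \<inter> {t. norm (x + t *\<^sub>R axis i (1::real)) < r + \<delta>}"
        have a: "open S" unfolding S_def by (intro open_Int open_Collect_less cn continuous_on_const)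
        have c: "(r + \<delta> - norm (x + t *\<^sub>R axis i 1)) / \<delta> = ?w (x + t *\<^sub>R axis i 1)" if "t \<in> S" for t
          using that r by (simp add: S_def radial_cutoff_def)
        have b: "0 \<in> S" using 3 by (simp add: S_def)
        have "((\<lambda>t. ?w (x + t *\<^sub>R axis i 1)) has_real_derivative - (x $ i / norm x / \<delta>)) (at 0)"
          by (rule has_field_derivative_transform_within_open[OF D a b c])
        then show ?thesis using 3 by simp
      qed
    qed
  qed
  moreover have "continuous_on UNIV ?w"
    unfolding radial_cutoff_def using r by (auto intro!: continuous_intros)
  moreover have "\<forall>i. ?G i \<in> borel_measurable borel" by (rule allI) measurable
  moreover have "\<exists>R K. 0 \<le> K \<and> (\<forall>x. R < norm x \<longrightarrow> ?w x = 0 \<and> (\<forall>i. ?G i x = 0)) \<and>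
        (\<forall>i x. \<bar>?G i x\<bar> \<le> K) \<and>
        (\<forall>i x t. \<bar>t\<bar> \<le> 1 \<longrightarrow> \<bar>?w (x + t *\<^sub>R axis i 1) - ?w x\<bar> \<le> K * \<bar>t\<bar>)"
  proof (rule exI[of _ "r + \<delta>"], rule exI[of _ "1 / \<delta>"], intro conjI allI impI)
    show "\<bar>?G i x\<bar> \<le> 1 / \<delta>" for i x
    proof -
      have "\<bar>x $ i\<bar> / norm x \<le> 1" using component_le_norm_cart[of x i] by (simp add: divide_le_eq)
      then have "\<bar>x $ i\<bar> / norm x / \<delta> \<le> 1 / \<delta>" using r by (intro divide_right_mono) auto
      then show ?thesis using r by (auto simp: indicator_def abs_mult)
    qed
    show "\<bar>?w (x + t *\<^sub>R axis i 1) - ?w x\<bar> \<le> 1 / \<delta> * \<bar>t\<bar>" for i x t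
      using lip[of "x + t *\<^sub>R axis i 1" x] by (simp add: norm_axis_1)
  qed (use r in \<open>auto simp: radial_cutoff_def field_simps\<close>)
  ultimately show ?thesis unfolding lipschitz_test_def by (intro conjI)
qed

section \<open>The mass field of a graph\<close>

definition Df :: "(real^'n \<Rightarrow> real^'m) \<Rightarrow> 'm \<Rightarrow> 'n \<Rightarrow> real^'n \<Rightarrow> real" where
  "Df f \<alpha> i = pd i (\<lambda>y. f y $ \<alpha>)"

definition D2f :: "(real^'n \<Rightarrow> real^'m) \<Rightarrow> 'm \<Rightarrow> 'n \<Rightarrow> 'n \<Rightarrow> real^'n \<Rightarrow> real" where
  "D2f f \<alpha> i j = pd i (pd j (\<lambda>y. f y $ \<alpha>))"

definition raised_Df :: "(real^'n \<Rightarrow> real^'m) \<Rightarrow> 'm \<Rightarrow> 'n \<Rightarrow> real^'n \<Rightarrow> real" where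
  "raised_Df f \<alpha> i x = (\<Sum>l\<in>UNIV. inverse_metric f x $ i $ l * Df f \<alpha> l x)"

text \<open>
  The mixed Hessian, that is, the matrix \<open>g\<^sup>-\<^sup>1 H\<^sub>\<alpha>\<close>.
\<close>

definition raised_D2f :: "(real^'n \<Rightarrow> real^'m) \<Rightarrow> 'm \<Rightarrow> 'n \<Rightarrow> 'n \<Rightarrow> real^'n \<Rightarrow> real" where
  "raised_D2f f \<alpha> i j x = (\<Sum>l\<in>UNIV. inverse_metric f x $ i $ l * D2f f \<alpha> l j x)"

text \<open>
  The coefficient of \<open>\<partial>\<^sub>i \<partial>\<^sub>k f\<^sup>\<alpha>\<close> in the \<open>j\<close>-th component of the mass field.  It depends on the
  first derivatives of \<open>f\<close> only, and this choice of it is antisymmetric in \<open>j\<close> and \<open>i\<close>.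
\<close>

definition flux_coeff :: "(real^'n \<Rightarrow> real^'m) \<Rightarrow> 'm \<Rightarrow> 'n \<Rightarrow> 'n \<Rightarrow> 'n \<Rightarrow> real^'n \<Rightarrow> real" where
  "flux_coeff f \<alpha> j i k x =
     inverse_metric f x $ i $ k * raised_Df f \<alpha> j x - inverse_metric f x $ j $ k * raised_Df f \<alpha> i x"

text \<open>
  The field \<open>g\<^sup>i\<^sup>k g\<^sup>j\<^sup>l (\<partial>\<^sub>k g\<^sub>i\<^sub>l - \<partial>\<^sub>l g\<^sub>i\<^sub>k)\<close>, grouped by second derivatives of \<open>f\<close>.
\<close>

definition mass_field :: "(real^'n \<Rightarrow> real^'m) \<Rightarrow> 'n \<Rightarrow> real^'n \<Rightarrow> real" where
  "mass_field f j x = (\<Sum>\<alpha>\<in>UNIV. \<Sum>i\<in>UNIV. \<Sum>k\<in>UNIV. flux_coeff f \<alpha> j i k x * D2f f \<alpha> i k x)"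

lemma sum_swap3:
  "(\<Sum>i\<in>A. \<Sum>k\<in>B. \<Sum>b\<in>C. F i k b) = (\<Sum>b\<in>C. \<Sum>i\<in>A. \<Sum>k\<in>B. F i k b)"
proof -
  have "(\<Sum>k\<in>B. \<Sum>b\<in>C. F i k b) = (\<Sum>b\<in>C. \<Sum>k\<in>B. F i k b)" for i by (rule sum.swap)
  then show ?thesis by (simp only:) (rule sum.swap)
qed

lemma sum_swap4:
  "(\<Sum>h\<in>A. \<Sum>i\<in>B. \<Sum>k\<in>C. \<Sum>b\<in>D. F h i k b) = (\<Sum>b\<in>D. \<Sum>h\<in>A. \<Sum>i\<in>B. \<Sum>k\<in>C. F h i k b)"
proof -
  have "(\<Sum>i\<in>B. \<Sum>k\<in>C. \<Sum>b\<in>D. F h i k b) = (\<Sum>b\<in>D. \<Sum>i\<in>B. \<Sum>k\<in>C. F h i k b)" for h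
    by (rule sum_swap3)
  then show ?thesis by (simp only:) (rule sum.swap)
qed

lemma Ck2D:
  fixes f :: "real^'n \<Rightarrow> real^'m"
  assumes "Ck 2 f"
  shows "f differentiable (at x)" "pd i f differentiable (at x)" "Ck 1 (Df f \<alpha> i)"
    "continuous_on S (D2f f \<alpha> i j)" "D2f f \<alpha> i j x = D2f f \<alpha> j i x" "pd i (Df f \<alpha> j) = D2f f \<alpha> i j"
    "pd i f x $ \<alpha> = Df f \<alpha> i x" "pd i (pd j f) x $ \<alpha> = D2f f \<alpha> i j x"
proof -
  show d: "f differentiable (at x)" "pd i f differentiable (at x)" for x i
    using assms by (auto simp: numeral_2_eq_2)
  have c: "Ck 2 (\<lambda>y. f y $ \<alpha>)" for \<alpha>
    by (rule Ck_bounded_linear[OF bounded_linear_vec_nth assms])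
  show "Ck 1 (Df f \<alpha> i)" using c[of \<alpha>] by (simp add: Df_def numeral_2_eq_2)
  show "continuous_on S (D2f f \<alpha> i j)"
    by (rule continuous_on_subset[OF _ subset_UNIV]) (use c[of \<alpha>] in \<open>simp add: D2f_def numeral_2_eq_2\<close>)
  show "D2f f \<alpha> i j x = D2f f \<alpha> j i x" unfolding D2f_def by (rule pd_commute_real[OF c])
  show "pd i (Df f \<alpha> j) = D2f f \<alpha> i j" by (simp add: Df_def D2f_def)
  have p: "pd i (\<lambda>y. f y $ \<alpha>) = (\<lambda>x. pd i f x $ \<alpha>)" for i \<alpha>
    by (intro ext pd_bounded_linear(2)[OF bounded_linear_vec_nth d(1)])
  then show "pd i f x $ \<alpha> = Df f \<alpha> i x" by (simp add: Df_def)
  show "pd i (pd j f) x $ \<alpha> = D2f f \<alpha> i j x"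
    unfolding D2f_def p by (rule pd_bounded_linear(2)[OF bounded_linear_vec_nth d(2), symmetric])
qed

lemma inverse_metric_sym:
  assumes "f differentiable (at x)"
  shows "inverse_metric f x $ i $ j = inverse_metric f x $ j $ i"
proof -
  let ?g = "induced_metric f x" and ?G = "inverse_metric f x"
  have "transpose ?g = ?g" by (simp add: transpose_def vec_eq_iff induced_metric_sym)
  then have "transpose ?G ** ?g = mat 1"
    using arg_cong[OF inverse_metric(1)[OF assms], of transpose] by (simp add: matrix_transpose_mul)
  then have "transpose ?G = transpose ?G ** (?g ** ?G)"
    by (simp add: inverse_metric(1)[OF assms])
  also have "\<dots> = ?G" using \<open>transpose ?G ** ?g = mat 1\<close> by (simp add: matrix_mul_assoc)
  finally have "transpose ?G $ i $ j = ?G $ i $ j" by simp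
  then show ?thesis by (simp add: transpose_def)
qed

lemma pd_induced_metric_Df:
  fixes f :: "real^'n \<Rightarrow> real^'m"
  assumes f: "Ck 2 f"
  shows "(\<lambda>y. induced_metric f y $ i $ k) differentiable (at x)"
    and "pd j (\<lambda>y. induced_metric f y $ i $ k) x
      = (\<Sum>\<beta>\<in>UNIV. D2f f \<beta> j i x * Df f \<beta> k x + Df f \<beta> i x * D2f f \<beta> j k x)"
proof -
  note D = Ck2D[OF f]
  have g: "induced_metric f y $ i $ k = (if i = k then 1 else 0) + (\<Sum>\<beta>\<in>UNIV. Df f \<beta> i y * Df f \<beta> k y)" for y
    using induced_metric_eq[OF D(1)] by (simp add: Df_def)
  have d: "(\<lambda>y. Df f \<beta> i y * Df f \<beta> k y) differentiable (at x)" for \<beta>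
    by (rule pd_mult(1)) (rule Ck1D(1)[OF D(3)])+
  have s: "(\<lambda>y. \<Sum>\<beta>\<in>UNIV. Df f \<beta> i y * Df f \<beta> k y) differentiable (at x)"
    by (rule pd_sum(1)) (rule d)
  then show "(\<lambda>y. induced_metric f y $ i $ k) differentiable (at x)"
    unfolding g by (intro differentiable_add differentiable_const)
  have "pd j (\<lambda>y. induced_metric f y $ i $ k) x = pd j (\<lambda>y. \<Sum>\<beta>\<in>UNIV. Df f \<beta> i y * Df f \<beta> k y) x"
    unfolding g by (subst pd_add[OF differentiable_const s]) (simp add: pd_eqI[OF has_derivative_const])
  also have "\<dots> = (\<Sum>\<beta>\<in>UNIV. pd j (\<lambda>y. Df f \<beta> i y * Df f \<beta> k y) x)"
    by (rule pd_sum(2)) (rule d)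
  also have "\<dots> = (\<Sum>\<beta>\<in>UNIV. D2f f \<beta> j i x * Df f \<beta> k x + Df f \<beta> i x * D2f f \<beta> j k x)"
    by (simp add: pd_mult(2)[OF Ck1D(1)[OF D(3)] Ck1D(1)[OF D(3)]] D(6))
  finally show "pd j (\<lambda>y. induced_metric f y $ i $ k) x
      = (\<Sum>\<beta>\<in>UNIV. D2f f \<beta> j i x * Df f \<beta> k x + Df f \<beta> i x * D2f f \<beta> j k x)" .
qed

lemma inverse_metric_differentiable:
  fixes f :: "real^'n \<Rightarrow> real^'m"
  assumes "Ck 2 f"
  shows "(\<lambda>y. inverse_metric f y $ i $ k) differentiable (at x)"
proof -
  have "(\<lambda>y. \<Sum>l\<in>UNIV. inverse_metric f y $ i $ l * (if l = k then 1 else 0)) differentiable (at x)"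
    by (rule solution_differentiable) (auto intro: Ck2D[OF assms])
  then show ?thesis by (simp add: if_distrib[of "\<lambda>c. _ * c"] cong: if_cong)
qed

text \<open>
  This is \<open>\<partial>\<^sub>j g\<^sup>-\<^sup>1 = - g\<^sup>-\<^sup>1 (\<partial>\<^sub>j g) g\<^sup>-\<^sup>1\<close>, written with the raised derivatives.
\<close>

lemma pd_inverse_metric:
  fixes f :: "real^'n \<Rightarrow> real^'m"
  assumes f: "Ck 2 f"
  shows "pd j (\<lambda>y. inverse_metric f y $ a $ b) x
    = - (\<Sum>\<beta>\<in>UNIV. raised_D2f f \<beta> a j x * raised_Df f \<beta> b x + raised_Df f \<beta> a x * raised_D2f f \<beta> b j x)"
proof -
  note D = Ck2D[OF f]
  define G where "G = inverse_metric f x"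
  define dG where "dG k = pd j (\<lambda>y. inverse_metric f y $ k $ b) x" for k
  define dg where "dg i k = pd j (\<lambda>y. induced_metric f y $ i $ k) x" for i k
  have Gs: "G $ i $ k = G $ k $ i" for i k unfolding G_def by (rule inverse_metric_sym[OF D(1)])
  have "(\<Sum>k\<in>UNIV. dg i k * G $ k $ b + induced_metric f x $ i $ k * dG k) = 0" for i
  proof -
    have d: "(\<lambda>y. induced_metric f y $ i $ k * inverse_metric f y $ k $ b) differentiable (at x)" for k
      by (rule pd_mult(1)[OF pd_induced_metric_Df(1)[OF f] inverse_metric_differentiable[OF f]])
    have "pd j (\<lambda>y. \<Sum>k\<in>UNIV. induced_metric f y $ i $ k * inverse_metric f y $ k $ b) x = 0"
      unfolding sum_inverse_metric(1)[OF D(1)] by (simp add: pd_eqI[OF has_derivative_const])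
    then show ?thesis
      unfolding pd_sum(2)[OF d] pd_mult(2)[OF pd_induced_metric_Df(1)[OF f] inverse_metric_differentiable[OF f]]
      by (simp add: dg_def dG_def G_def)
  qed
  then have e: "(\<Sum>k\<in>UNIV. induced_metric f x $ i $ k * dG k) = - (\<Sum>k\<in>UNIV. dg i k * G $ k $ b)" for i
    by (simp add: sum.distrib eq_neg_iff_add_eq_0 add.commute)
  have "dG a = (\<Sum>i\<in>UNIV. G $ a $ i * (\<Sum>k\<in>UNIV. induced_metric f x $ i $ k * dG k))"
    unfolding G_def by (rule metric_inverse_sum(2)[OF D(1), symmetric])
  also have "\<dots> = - (\<Sum>i\<in>UNIV. \<Sum>k\<in>UNIV. \<Sum>\<beta>\<in>UNIV.
      G $ a $ i * D2f f \<beta> i j x * (G $ b $ k * Df f \<beta> k x) + G $ a $ i * Df f \<beta> i x * (G $ b $ k * D2f f \<beta> k j x))"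
    unfolding e dg_def pd_induced_metric_Df(2)[OF f]
    by (simp add: sum_negf sum_distrib_left sum_distrib_right algebra_simps Gs[of _ b] D(5)[of _ j])
  also have "\<dots> = - (\<Sum>\<beta>\<in>UNIV. \<Sum>i\<in>UNIV. \<Sum>k\<in>UNIV.
      G $ a $ i * D2f f \<beta> i j x * (G $ b $ k * Df f \<beta> k x) + G $ a $ i * Df f \<beta> i x * (G $ b $ k * D2f f \<beta> k j x))"
    by (rule arg_cong[OF sum_swap3])
  also have "\<dots> = - (\<Sum>\<beta>\<in>UNIV. raised_D2f f \<beta> a j x * raised_Df f \<beta> b x + raised_Df f \<beta> a x * raised_D2f f \<beta> b j x)"
    by (simp add: raised_Df_def raised_D2f_def G_def sum_product sum.distrib)
  finally show ?thesis by (simp add: dG_def)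
qed

lemma raised_Df_differentiable:
  fixes f :: "real^'n \<Rightarrow> real^'m"
  assumes f: "Ck 2 f"
  shows "raised_Df f \<alpha> i differentiable (at x)"
proof -
  have "(\<lambda>y. \<Sum>l\<in>UNIV. inverse_metric f y $ i $ l * Df f \<alpha> l y) differentiable (at x)"
    by (rule solution_differentiable) (use Ck2D[OF f] Ck1D(1)[OF Ck2D(3)[OF f]] in auto)
  then show ?thesis by (simp add: raised_Df_def[abs_def])
qed

lemma pd_raised_Df:
  fixes f :: "real^'n \<Rightarrow> real^'m"
  assumes f: "Ck 2 f"
  shows "pd j (raised_Df f \<alpha> l) x = raised_D2f f \<alpha> l j x
    - (\<Sum>\<beta>\<in>UNIV. raised_D2f f \<beta> l j x * (\<Sum>m\<in>UNIV. raised_Df f \<beta> m x * Df f \<alpha> m x)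
        + raised_Df f \<beta> l x * (\<Sum>m\<in>UNIV. raised_D2f f \<beta> m j x * Df f \<alpha> m x))"
proof -
  note D = Ck2D[OF f]
  have d: "(\<lambda>y. inverse_metric f y $ l $ m * Df f \<alpha> m y) differentiable (at x)" for m
    by (rule pd_mult(1)[OF inverse_metric_differentiable[OF f] Ck1D(1)[OF D(3)]])
  have "pd j (raised_Df f \<alpha> l) x = (\<Sum>m\<in>UNIV. pd j (\<lambda>y. inverse_metric f y $ l $ m) x * Df f \<alpha> m x
      + inverse_metric f x $ l $ m * D2f f \<alpha> j m x)"
    unfolding raised_Df_def[abs_def] pd_sum(2)[OF d]
      pd_mult(2)[OF inverse_metric_differentiable[OF f] Ck1D(1)[OF D(3)]] D(6) ..
  also have "\<dots> = raised_D2f f \<alpha> l j x - (\<Sum>m\<in>UNIV. (\<Sum>\<beta>\<in>UNIV. raised_D2f f \<beta> l j x * raised_Df f \<beta> m x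
      + raised_Df f \<beta> l x * raised_D2f f \<beta> m j x) * Df f \<alpha> m x)"
    unfolding pd_inverse_metric[OF f]
    by (subst sum.distrib) (simp add: sum_negf raised_D2f_def D(5)[of _ j])
  also have "(\<Sum>m\<in>UNIV. (\<Sum>\<beta>\<in>UNIV. raised_D2f f \<beta> l j x * raised_Df f \<beta> m x
      + raised_Df f \<beta> l x * raised_D2f f \<beta> m j x) * Df f \<alpha> m x)
    = (\<Sum>\<beta>\<in>UNIV. raised_D2f f \<beta> l j x * (\<Sum>m\<in>UNIV. raised_Df f \<beta> m x * Df f \<alpha> m x)
        + raised_Df f \<beta> l x * (\<Sum>m\<in>UNIV. raised_D2f f \<beta> m j x * Df f \<alpha> m x))"
    unfolding sum_distrib_right
    by (subst sum.swap) (simp add: sum_distrib_left sum.distrib algebra_simps)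
  finally show ?thesis .
qed

lemma Ck1I:
  assumes "\<And>x. u differentiable (at x)" "\<And>i. continuous_on UNIV (pd i u)"
  shows "Ck 1 u"
  using assms by simp

lemma continuous_on_raised:
  fixes f :: "real^'n \<Rightarrow> real^'m"
  assumes f: "Ck 2 f"
  shows "continuous_on S (\<lambda>x. inverse_metric f x $ i $ k)" "continuous_on S (Df f \<alpha> i)"
    "continuous_on S (raised_Df f \<alpha> i)" "continuous_on S (raised_D2f f \<alpha> i j)"
proof -
  show c: "continuous_on S (\<lambda>x. inverse_metric f x $ i $ k)" for i k
    using inverse_metric_differentiable[OF f]
    by (intro continuous_at_imp_continuous_on ballI differentiable_imp_continuous_within)
  show "continuous_on S (Df f \<alpha> i)" for i by (rule Ck1D(3)[OF Ck2D(3)[OF f]])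
  then show "continuous_on S (raised_Df f \<alpha> i)"
    unfolding raised_Df_def[abs_def] by (intro continuous_on_sum continuous_on_mult c)
  show "continuous_on S (raised_D2f f \<alpha> i j)"
    unfolding raised_D2f_def[abs_def] by (intro continuous_on_sum continuous_on_mult c Ck2D(4)[OF f])
qed

lemma Ck1_inverse_metric:
  fixes f :: "real^'n \<Rightarrow> real^'m"
  assumes f: "Ck 2 f"
  shows "Ck 1 (\<lambda>x. inverse_metric f x $ i $ k)"
proof (rule Ck1I)
  show "continuous_on UNIV (pd j (\<lambda>x. inverse_metric f x $ i $ k))" for j
    unfolding pd_inverse_metric[OF f, abs_def]
    by (intro continuous_on_minus continuous_on_sum continuous_on_add continuous_on_mult continuous_on_raised[OF f])
qed (rule inverse_metric_differentiable[OF f])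

lemma Ck1_raised_Df:
  fixes f :: "real^'n \<Rightarrow> real^'m"
  assumes f: "Ck 2 f"
  shows "Ck 1 (raised_Df f \<alpha> i)"
proof (rule Ck1I)
  show "continuous_on UNIV (pd j (raised_Df f \<alpha> i))" for j
    unfolding pd_raised_Df[OF f, abs_def]
    by (intro continuous_on_diff continuous_on_sum continuous_on_add continuous_on_mult continuous_on_raised[OF f])
qed (rule raised_Df_differentiable[OF f])

lemma Ck1_mult:
  fixes u v :: "real^'n \<Rightarrow> real"
  assumes "Ck 1 u" "Ck 1 v"
  shows "Ck 1 (\<lambda>x. u x * v x)"
proof (rule Ck1I)
  show "(\<lambda>x. u x * v x) differentiable (at x)" for x
    by (rule pd_mult(1)[OF Ck1D(1)[OF assms(1)] Ck1D(1)[OF assms(2)]])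
  show "continuous_on UNIV (pd i (\<lambda>x. u x * v x))" for i
    unfolding pd_mult(2)[OF Ck1D(1)[OF assms(1)] Ck1D(1)[OF assms(2)], abs_def]
    by (intro continuous_on_add continuous_on_mult Ck1D[OF assms(1)] Ck1D[OF assms(2)])
qed

lemma Ck1_diff:
  fixes u v :: "real^'n \<Rightarrow> real"
  assumes "Ck 1 u" "Ck 1 v"
  shows "Ck 1 (\<lambda>x. u x - v x)"
proof (rule Ck1I)
  show "(\<lambda>x. u x - v x) differentiable (at x)" for x
    by (rule differentiable_diff[OF Ck1D(1)[OF assms(1)] Ck1D(1)[OF assms(2)]])
  show "continuous_on UNIV (pd i (\<lambda>x. u x - v x))" for i
    unfolding pd_diff[OF Ck1D(1)[OF assms(1)] Ck1D(1)[OF assms(2)], abs_def]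
    by (intro continuous_on_diff Ck1D[OF assms(1)] Ck1D[OF assms(2)])
qed

lemma Ck1_flux_coeff:
  fixes f :: "real^'n \<Rightarrow> real^'m"
  assumes f: "Ck 2 f"
  shows "Ck 1 (flux_coeff f \<alpha> j i k)"
  unfolding flux_coeff_def[abs_def]
  by (intro Ck1_diff Ck1_mult Ck1_inverse_metric[OF f] Ck1_raised_Df[OF f])

lemma pd_flux_coeff:
  fixes f :: "real^'n \<Rightarrow> real^'m"
  assumes f: "Ck 2 f"
  shows "pd j (flux_coeff f \<alpha> j i k) x =
    pd j (\<lambda>y. inverse_metric f y $ i $ k) x * raised_Df f \<alpha> j x + inverse_metric f x $ i $ k * pd j (raised_Df f \<alpha> j) x
    - (pd j (\<lambda>y. inverse_metric f y $ j $ k) x * raised_Df f \<alpha> i x + inverse_metric f x $ j $ k * pd j (raised_Df f \<alpha> i) x)"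
proof -
  have d: "(\<lambda>y. inverse_metric f y $ a $ k * raised_Df f \<alpha> b y) differentiable (at x)"
    and p: "pd j (\<lambda>y. inverse_metric f y $ a $ k * raised_Df f \<alpha> b y) x
    = pd j (\<lambda>y. inverse_metric f y $ a $ k) x * raised_Df f \<alpha> b x + inverse_metric f x $ a $ k * pd j (raised_Df f \<alpha> b) x" for a b
    using pd_mult[OF inverse_metric_differentiable[OF f] raised_Df_differentiable[OF f]] by auto
  show ?thesis unfolding flux_coeff_def[abs_def] pd_diff[OF d d] p ..
qed

section \<open>The divergence of the mass field is the scalar curvature\<close>

text \<open>
  The pointwise algebra behind the divergence formula.  The letters stand for \<open>G = g\<^sup>-\<^sup>1\<close>,
  \<open>a = \<nabla>f\<close>, \<open>p = g\<^sup>-\<^sup>1 \<nabla>f\<close>, \<open>A = g\<^sup>-\<^sup>1 H\<close>, while \<open>dG\<close> and \<open>dp\<close> are the derivatives of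
  \<open>G\<close> and \<open>p\<close>.  The left side is the divergence of the mass field with the formal third derivatives
  of \<open>f\<close> left out, the right side is the scalar curvature: the normal vectors
  \<open>(-\<nabla>f\<^sup>\<alpha>, e\<^sub>\<alpha>)\<close> have a Gram matrix whose inverse is \<open>\<delta>\<^sub>\<alpha>\<^sub>\<beta> - W\<^sub>\<alpha>\<^sub>\<beta>\<close>.  After expansion the
  terms with one trace cancel under exchange of \<open>\<alpha>\<close> and \<open>\<beta>\<close>, and the terms
  \<open>p \<bullet> H\<^sub>\<alpha> g\<^sup>-\<^sup>1 H\<^sub>\<beta> p\<close> cancel because \<open>H\<^sub>\<alpha> g\<^sup>-\<^sup>1 H\<^sub>\<beta>\<close> is symmetric in \<open>\<alpha>\<close> and \<open>\<beta>\<close>.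
\<close>

lemma contraction_identity:
  fixes G :: "'n::finite \<Rightarrow> 'n \<Rightarrow> real" and a :: "'m::finite \<Rightarrow> 'n \<Rightarrow> real" and H :: "'m \<Rightarrow> 'n \<Rightarrow> 'n \<Rightarrow> real"
  assumes Gs: "\<And>i j. G i j = G j i" and Hs: "\<And>\<alpha> i j. H \<alpha> i j = H \<alpha> j i"
    and flat: "\<And>\<alpha> \<beta> i j. (\<Sum>k\<in>UNIV. \<Sum>l\<in>UNIV. H \<alpha> i k * G k l * H \<beta> l j)
      = (\<Sum>k\<in>UNIV. \<Sum>l\<in>UNIV. H \<beta> i k * G k l * H \<alpha> l j)"
    and p: "\<And>\<alpha> i. p \<alpha> i = (\<Sum>l\<in>UNIV. G i l * a \<alpha> l)"
    and A: "\<And>\<alpha> i j. A \<alpha> i j = (\<Sum>l\<in>UNIV. G i l * H \<alpha> l j)"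
    and W: "\<And>\<alpha> \<beta>. W \<alpha> \<beta> = (\<Sum>m\<in>UNIV. p \<beta> m * a \<alpha> m)"
    and dG: "\<And>j i k. dG j i k = - (\<Sum>\<beta>\<in>UNIV. A \<beta> i j * p \<beta> k + p \<beta> i * A \<beta> k j)"
    and dp: "\<And>j \<alpha> l. dp j \<alpha> l = A \<alpha> l j
      - (\<Sum>\<beta>\<in>UNIV. A \<beta> l j * W \<alpha> \<beta> + p \<beta> l * (\<Sum>m\<in>UNIV. A \<beta> m j * a \<alpha> m))"
  shows "(\<Sum>\<alpha>\<in>UNIV. \<Sum>j\<in>UNIV. \<Sum>i\<in>UNIV. \<Sum>k\<in>UNIV.
      (dG j i k * p \<alpha> j + G i k * dp j \<alpha> j - (dG j j k * p \<alpha> i + G j k * dp j \<alpha> i)) * H \<alpha> i k)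
    = (\<Sum>\<alpha>\<in>UNIV. (\<Sum>i\<in>UNIV. A \<alpha> i i) * (\<Sum>i\<in>UNIV. A \<alpha> i i) - (\<Sum>i\<in>UNIV. \<Sum>j\<in>UNIV. A \<alpha> i j * A \<alpha> j i))
      - (\<Sum>\<alpha>\<in>UNIV. \<Sum>\<beta>\<in>UNIV. W \<alpha> \<beta> * ((\<Sum>i\<in>UNIV. A \<alpha> i i) * (\<Sum>i\<in>UNIV. A \<beta> i i)
          - (\<Sum>i\<in>UNIV. \<Sum>j\<in>UNIV. A \<alpha> i j * A \<beta> j i)))"
proof -
  define tr where "tr \<alpha> = (\<Sum>i\<in>UNIV. A \<alpha> i i)" for \<alpha>
  define tr2 where "tr2 \<alpha> \<beta> = (\<Sum>i\<in>UNIV. \<Sum>j\<in>UNIV. A \<alpha> i j * A \<beta> j i)" for \<alpha> \<beta>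
  define Q where "Q v \<alpha> \<beta> u = (\<Sum>k\<in>UNIV. \<Sum>j\<in>UNIV. v k * (\<Sum>i\<in>UNIV. H \<alpha> k i * A \<beta> i j) * u j)" for v \<alpha> \<beta> u
  define R where "R \<gamma> v u = (\<Sum>i\<in>UNIV. \<Sum>k\<in>UNIV. v i * H \<gamma> i k * u k)" for \<gamma> v u
  define q where "q \<alpha> \<beta> j = (\<Sum>m\<in>UNIV. A \<beta> m j * a \<alpha> m)" for \<alpha> \<beta> j
  have q: "q \<alpha> \<beta> j = (\<Sum>l\<in>UNIV. p \<alpha> l * H \<beta> l j)" for \<alpha> \<beta> j
    unfolding q_def A p sum_distrib_right by (subst sum.swap) (simp add: mult_ac Gs)
  have Rs: "R \<gamma> v u = R \<gamma> u v" for \<gamma> v u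
    unfolding R_def by (subst sum.swap) (simp add: mult_ac Hs)
  \<comment> \<open>The only use of flatness: \<open>Q v \<alpha> \<beta> u\<close> is \<open>v \<bullet> (H\<^sub>\<alpha> g\<^sup>-\<^sup>1 H\<^sub>\<beta>) u\<close>.\<close>
  have Qflat: "Q v \<alpha> \<beta> u = Q v \<beta> \<alpha> u" for v \<alpha> \<beta> u
  proof -
    have "(\<Sum>i\<in>UNIV. H \<alpha> k i * A \<beta> i j) = (\<Sum>i\<in>UNIV. H \<beta> k i * A \<alpha> i j)" for k j
      using flat[of \<alpha> k \<beta> j] by (simp add: A sum_distrib_left mult.assoc)
    then show ?thesis by (simp add: Q_def)
  qed
  \<comment> \<open>The monomials of the expansion are contracted to \<open>tr\<close>, \<open>tr2\<close>, \<open>Q\<close> and \<open>R\<close>.\<close>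
  have m1: "(\<Sum>j\<in>UNIV. \<Sum>i\<in>UNIV. \<Sum>k\<in>UNIV. G i k * u j * H \<alpha> i k) = (\<Sum>j\<in>UNIV. u j) * tr \<alpha>" for u \<alpha>
  proof -
    have "tr \<alpha> = (\<Sum>i\<in>UNIV. \<Sum>k\<in>UNIV. G i k * H \<alpha> i k)"
      unfolding tr_def A by (intro sum.cong refl) (simp add: Hs[of \<alpha>])
    then have "(\<Sum>j\<in>UNIV. u j) * tr \<alpha> = (\<Sum>j\<in>UNIV. u j * (\<Sum>i\<in>UNIV. \<Sum>k\<in>UNIV. G i k * H \<alpha> i k))"
      by (simp add: sum_distrib_right)
    then show ?thesis by (simp add: sum_distrib_left mult_ac)
  qed
  have m2: "(\<Sum>j\<in>UNIV. \<Sum>i\<in>UNIV. \<Sum>k\<in>UNIV. G j k * A \<beta> i j * H \<alpha> i k) = tr2 \<alpha> \<beta>" for \<alpha> \<beta>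
    unfolding tr2_def A[of \<alpha>] sum_distrib_right
    by (intro sum.cong refl) (simp add: Hs[of \<alpha>] mult_ac)
  have m3: "(\<Sum>j\<in>UNIV. \<Sum>i\<in>UNIV. \<Sum>k\<in>UNIV. A \<beta> i j * v k * u j * H \<alpha> i k) = Q v \<alpha> \<beta> u" for \<alpha> \<beta> v u
    unfolding Q_def sum_distrib_left sum_distrib_right sum_swap3[where F = "\<lambda>j i k. A \<beta> i j * v k * u j * H \<alpha> i k"]
    by (intro sum.cong refl) (simp add: Hs[of \<alpha>] mult_ac)
  have m4: "(\<Sum>j\<in>UNIV. \<Sum>i\<in>UNIV. \<Sum>k\<in>UNIV. v i * A \<beta> k j * u j * H \<alpha> i k) = Q v \<alpha> \<beta> u" for \<alpha> \<beta> v u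
    unfolding m3[symmetric] by (rule sum.cong[OF refl], subst sum.swap) (simp add: Hs[of \<alpha>] mult_ac)
  have m5: "(\<Sum>j\<in>UNIV. \<Sum>i\<in>UNIV. \<Sum>k\<in>UNIV. A \<beta> j j * v k * u i * H \<alpha> i k) = tr \<beta> * R \<alpha> v u" for \<alpha> \<beta> v u
    unfolding tr_def Rs[of \<alpha> v u] sum_distrib_right unfolding R_def sum_distrib_left by (simp add: mult_ac)
  have m6: "(\<Sum>j\<in>UNIV. \<Sum>i\<in>UNIV. \<Sum>k\<in>UNIV. v j * A \<beta> k j * u i * H \<alpha> i k) = Q u \<alpha> \<beta> v" for \<alpha> \<beta> v u
    unfolding m4[symmetric] by (simp add: mult_ac)
  have m7: "(\<Sum>j\<in>UNIV. \<Sum>i\<in>UNIV. \<Sum>k\<in>UNIV. G j k * (v i * q \<gamma> \<beta> j) * H \<alpha> i k) = Q (p \<gamma>) \<beta> \<alpha> v" for \<alpha> \<beta> \<gamma> v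
  proof -
    have "(\<Sum>j\<in>UNIV. \<Sum>i\<in>UNIV. \<Sum>k\<in>UNIV. G j k * (v i * q \<gamma> \<beta> j) * H \<alpha> i k)
        = (\<Sum>j\<in>UNIV. \<Sum>i\<in>UNIV. q \<gamma> \<beta> j * A \<alpha> j i * v i)"
      unfolding A sum_distrib_left sum_distrib_right
      by (intro sum.cong refl) (simp add: Hs[of \<alpha>] mult_ac)
    also have "\<dots> = (\<Sum>j\<in>UNIV. \<Sum>i\<in>UNIV. \<Sum>k\<in>UNIV. p \<gamma> k * H \<beta> k j * A \<alpha> j i * v i)"
      unfolding q sum_distrib_right ..
    also have "\<dots> = (\<Sum>k\<in>UNIV. \<Sum>j\<in>UNIV. \<Sum>i\<in>UNIV. p \<gamma> k * H \<beta> k j * A \<alpha> j i * v i)"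
      by (rule sum_swap3)
    also have "\<dots> = (\<Sum>k\<in>UNIV. \<Sum>i\<in>UNIV. \<Sum>j\<in>UNIV. p \<gamma> k * H \<beta> k j * A \<alpha> j i * v i)"
      by (intro sum.cong refl sum.swap)
    finally show ?thesis by (simp add: Q_def sum_distrib_left sum_distrib_right mult_ac)
  qed
  define E where "E \<alpha> \<beta> j i k =
      - (A \<beta> i j * p \<beta> k * p \<alpha> j * H \<alpha> i k) - p \<beta> i * A \<beta> k j * p \<alpha> j * H \<alpha> i k
      - W \<alpha> \<beta> * (G i k * A \<beta> j j * H \<alpha> i k) - G i k * (p \<beta> j * q \<alpha> \<beta> j) * H \<alpha> i k
      + A \<beta> j j * p \<beta> k * p \<alpha> i * H \<alpha> i k + p \<beta> j * A \<beta> k j * p \<alpha> i * H \<alpha> i k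
      + W \<alpha> \<beta> * (G j k * A \<beta> i j * H \<alpha> i k) + G j k * (p \<beta> i * q \<alpha> \<beta> j) * H \<alpha> i k" for \<alpha> \<beta> j i k
  have E: "(\<Sum>j\<in>UNIV. \<Sum>i\<in>UNIV. \<Sum>k\<in>UNIV. E \<alpha> \<beta> j i k)
      = - 2 * Q (p \<beta>) \<alpha> \<beta> (p \<alpha>) - W \<alpha> \<beta> * (tr \<beta> * tr \<alpha>) - R \<beta> (p \<alpha>) (p \<beta>) * tr \<alpha>
        + tr \<beta> * R \<alpha> (p \<beta>) (p \<alpha>) + 2 * Q (p \<alpha>) \<alpha> \<beta> (p \<beta>) + W \<alpha> \<beta> * tr2 \<alpha> \<beta>" for \<alpha> \<beta>
  proof -
    have "(\<Sum>j\<in>UNIV. p \<beta> j * q \<alpha> \<beta> j) = R \<beta> (p \<alpha>) (p \<beta>)"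
      unfolding q R_def sum_distrib_left by (subst sum.swap) (simp add: mult_ac)
    then show ?thesis
      unfolding E_def sum.distrib sum_subtractf sum_negf sum_distrib_left[symmetric] m1 m2 m3 m4 m5 m6 m7
      by (simp add: tr_def Qflat[of "p \<alpha>" \<beta> \<alpha>])
  qed
  have pt: "(dG j i k * p \<alpha> j + G i k * dp j \<alpha> j - (dG j j k * p \<alpha> i + G j k * dp j \<alpha> i)) * H \<alpha> i k
      = G i k * A \<alpha> j j * H \<alpha> i k - G j k * A \<alpha> i j * H \<alpha> i k + (\<Sum>\<beta>\<in>UNIV. E \<alpha> \<beta> j i k)" for \<alpha> j i k
  proof -
    have 1: "dG j i k * p \<alpha> l * h = (\<Sum>\<beta>\<in>UNIV. - (A \<beta> i j * p \<beta> k * p \<alpha> l * h) - p \<beta> i * A \<beta> k j * p \<alpha> l * h)" for j i k l h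
      unfolding dG sum_negf[symmetric] sum_distrib_right by (intro sum.cong refl) (simp add: algebra_simps)
    have 2: "g * dp j \<alpha> l * h = g * A \<alpha> l j * h
        - (\<Sum>\<beta>\<in>UNIV. W \<alpha> \<beta> * (g * A \<beta> l j * h) + g * (p \<beta> l * q \<alpha> \<beta> j) * h)" for j l g h
      unfolding dp q_def[symmetric]
      by (simp add: sum_distrib_left sum_distrib_right sum.distrib algebra_simps)
    have "(dG j i k * p \<alpha> j + G i k * dp j \<alpha> j - (dG j j k * p \<alpha> i + G j k * dp j \<alpha> i)) * H \<alpha> i k
        = dG j i k * p \<alpha> j * H \<alpha> i k + G i k * dp j \<alpha> j * H \<alpha> i k - (dG j j k * p \<alpha> i * H \<alpha> i k + G j k * dp j \<alpha> i * H \<alpha> i k)"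
      by (simp add: algebra_simps)
    also have "\<dots> = G i k * A \<alpha> j j * H \<alpha> i k - G j k * A \<alpha> i j * H \<alpha> i k + (\<Sum>\<beta>\<in>UNIV. E \<alpha> \<beta> j i k)"
      unfolding 1 2 E_def sum.distrib sum_subtractf sum_negf by simp
    finally show ?thesis .
  qed
  have "(\<Sum>j\<in>UNIV. \<Sum>i\<in>UNIV. \<Sum>k\<in>UNIV.
      (dG j i k * p \<alpha> j + G i k * dp j \<alpha> j - (dG j j k * p \<alpha> i + G j k * dp j \<alpha> i)) * H \<alpha> i k)
    = tr \<alpha> * tr \<alpha> - tr2 \<alpha> \<alpha> + (\<Sum>\<beta>\<in>UNIV. - 2 * Q (p \<beta>) \<alpha> \<beta> (p \<alpha>) - W \<alpha> \<beta> * (tr \<beta> * tr \<alpha>)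
        - R \<beta> (p \<alpha>) (p \<beta>) * tr \<alpha> + tr \<beta> * R \<alpha> (p \<beta>) (p \<alpha>) + 2 * Q (p \<alpha>) \<alpha> \<beta> (p \<beta>) + W \<alpha> \<beta> * tr2 \<alpha> \<beta>)" for \<alpha>
    by (simp add: pt sum.distrib sum_subtractf sum_swap4[of "\<lambda>j i k \<beta>. E \<alpha> \<beta> j i k"] E m1 m2 flip: tr_def)
  note per_\<alpha> = this
  have Qsw: "(\<Sum>\<alpha>\<in>UNIV. \<Sum>\<beta>\<in>UNIV. Q (p \<beta>) \<alpha> \<beta> (p \<alpha>)) = (\<Sum>\<alpha>\<in>UNIV. \<Sum>\<beta>\<in>UNIV. Q (p \<alpha>) \<alpha> \<beta> (p \<beta>))"
    by (subst sum.swap) (simp add: Qflat)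
  have Rsw: "(\<Sum>\<alpha>\<in>UNIV. \<Sum>\<beta>\<in>UNIV. R \<beta> (p \<alpha>) (p \<beta>) * tr \<alpha>) = (\<Sum>\<alpha>\<in>UNIV. \<Sum>\<beta>\<in>UNIV. tr \<beta> * R \<alpha> (p \<beta>) (p \<alpha>))"
    by (subst sum.swap) (simp add: mult.commute)
  show ?thesis
    unfolding per_\<alpha> tr_def[symmetric] tr2_def[symmetric] sum.distrib sum_subtractf sum_distrib_left[symmetric] right_diff_distrib
    unfolding Qsw Rsw by (simp add: mult.commute[of "tr _" "tr _"])
qed

text \<open>
  The second fundamental form is the normal part of \<open>(0, \<partial>\<^sub>i \<partial>\<^sub>j f)\<close>.  In the second equation the
  double sum is the contribution of the tangential part of that vector.
\<close>

lemma second_ff_inner: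
  fixes f :: "real^'n \<Rightarrow> real^'m"
  assumes f: "Ck 2 f"
  shows "is_normal f x \<xi> \<Longrightarrow> second_ff f x i j \<bullet> \<xi> = pd i (pd j f) x \<bullet> snd \<xi>"
    and "second_ff f x i j \<bullet> second_ff f x k l = (\<Sum>\<alpha>\<in>UNIV. D2f f \<alpha> i j x * D2f f \<alpha> k l x)
      - (\<Sum>\<alpha>\<in>UNIV. \<Sum>\<beta>\<in>UNIV. (\<Sum>m\<in>UNIV. raised_Df f \<beta> m x * Df f \<alpha> m x) * (D2f f \<alpha> i j x * D2f f \<beta> k l x))"
proof -
  note D = Ck2D[OF f]
  define T2 where "T2 i j = pd i (pd j (graph_map f)) x" for i j
  have T: "pd j (graph_map f) = (\<lambda>y. (axis j 1, pd j f y))" for j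
    using tangent_eq[OF D(1)] by (auto simp: tangent_def)
  have T2: "T2 i j = (0, pd i (pd j f) x)" for i j
  proof -
    have "((\<lambda>y. (axis j 1 :: real^'n, pd j f y)) has_derivative
        (\<lambda>d. (0, frechet_derivative (pd j f) (at x) d))) (at x)"
      by (intro has_derivative_Pair has_derivative_const has_derivative_frechet D(2))
    from pd_eqI[OF this] show ?thesis by (simp add: T2_def T pd_def)
  qed
  have tT: "tangent f x k \<bullet> T2 i j = (\<Sum>\<alpha>\<in>UNIV. Df f \<alpha> k x * D2f f \<alpha> i j x)" for k i j
    by (simp add: T2 tangent_eq[OF D(1)] inner_vec_def[of "pd k f x"] D(7,8))
  have B: "second_ff f x i j = T2 i j - (\<Sum>l\<in>UNIV. (\<Sum>k\<in>UNIV. inverse_metric f x $ l $ k * (tangent f x k \<bullet> T2 i j)) *\<^sub>R tangent f x l)" for i j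
    by (simp add: second_ff_def normal_part_def T2_def)
  have nB: "second_ff f x i j \<bullet> \<xi> = T2 i j \<bullet> \<xi>" if "is_normal f x \<xi>" for \<xi> i j
    using that by (simp add: B inner_diff_left inner_sum_left is_normal_def)
  then show "is_normal f x \<xi> \<Longrightarrow> second_ff f x i j \<bullet> \<xi> = pd i (pd j f) x \<bullet> snd \<xi>"
    by (simp add: T2 inner_prod_def)
  have norm: "is_normal f x (second_ff f x k l)" for k l
    using normal_part_normal[OF D(1)] by (simp add: is_normal_def second_ff_def)
  have "second_ff f x i j \<bullet> second_ff f x k l = T2 i j \<bullet> second_ff f x k l" by (rule nB[OF norm])
  also have "\<dots> = T2 i j \<bullet> T2 k l
      - (\<Sum>m\<in>UNIV. (\<Sum>k'\<in>UNIV. inverse_metric f x $ m $ k' * (tangent f x k' \<bullet> T2 k l)) * (tangent f x m \<bullet> T2 i j))"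
    by (simp add: B[of k l] inner_diff_right inner_sum_right inner_commute)
  also have "T2 i j \<bullet> T2 k l = (\<Sum>\<alpha>\<in>UNIV. D2f f \<alpha> i j x * D2f f \<alpha> k l x)"
    by (simp add: T2 inner_vec_def[of "pd i (pd j f) x"] D(8))
  also have "(\<Sum>m\<in>UNIV. (\<Sum>k'\<in>UNIV. inverse_metric f x $ m $ k' * (tangent f x k' \<bullet> T2 k l)) * (tangent f x m \<bullet> T2 i j))
      = (\<Sum>m\<in>UNIV. (\<Sum>\<beta>\<in>UNIV. raised_Df f \<beta> m x * D2f f \<beta> k l x) * (\<Sum>\<alpha>\<in>UNIV. Df f \<alpha> m x * D2f f \<alpha> i j x))"
  proof -
    have "(\<Sum>k'\<in>UNIV. inverse_metric f x $ m $ k' * (\<Sum>\<beta>\<in>UNIV. Df f \<beta> k' x * D2f f \<beta> k l x))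
        = (\<Sum>\<beta>\<in>UNIV. raised_Df f \<beta> m x * D2f f \<beta> k l x)" for m
      unfolding raised_Df_def sum_distrib_left sum_distrib_right by (subst sum.swap) (simp add: mult_ac)
    then show ?thesis by (simp add: tT)
  qed
  also have "\<dots> = (\<Sum>m\<in>UNIV. \<Sum>\<alpha>\<in>UNIV. \<Sum>\<beta>\<in>UNIV. raised_Df f \<beta> m x * Df f \<alpha> m x * (D2f f \<alpha> i j x * D2f f \<beta> k l x))"
    unfolding sum_product by (subst sum.swap) (simp add: mult_ac)
  also have "\<dots> = (\<Sum>\<alpha>\<in>UNIV. \<Sum>\<beta>\<in>UNIV. \<Sum>m\<in>UNIV. raised_Df f \<beta> m x * Df f \<alpha> m x * (D2f f \<alpha> i j x * D2f f \<beta> k l x))"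
    by (rule sum_swap3[symmetric])
  finally show "second_ff f x i j \<bullet> second_ff f x k l = (\<Sum>\<alpha>\<in>UNIV. D2f f \<alpha> i j x * D2f f \<alpha> k l x)
      - (\<Sum>\<alpha>\<in>UNIV. \<Sum>\<beta>\<in>UNIV. (\<Sum>m\<in>UNIV. raised_Df f \<beta> m x * Df f \<alpha> m x) * (D2f f \<alpha> i j x * D2f f \<beta> k l x))"
    by (simp add: sum_distrib_right)
qed

lemma scalar_curvature_expansion:
  fixes f :: "real^'n \<Rightarrow> real^'m"
  assumes f: "Ck 2 f"
  shows "scalar_curvature f x
    = (\<Sum>\<alpha>\<in>UNIV. (\<Sum>i\<in>UNIV. raised_D2f f \<alpha> i i x) * (\<Sum>i\<in>UNIV. raised_D2f f \<alpha> i i x)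
          - (\<Sum>i\<in>UNIV. \<Sum>j\<in>UNIV. raised_D2f f \<alpha> i j x * raised_D2f f \<alpha> j i x))
      - (\<Sum>\<alpha>\<in>UNIV. \<Sum>\<beta>\<in>UNIV. (\<Sum>m\<in>UNIV. raised_Df f \<beta> m x * Df f \<alpha> m x)
          * ((\<Sum>i\<in>UNIV. raised_D2f f \<alpha> i i x) * (\<Sum>i\<in>UNIV. raised_D2f f \<beta> i i x)
          - (\<Sum>i\<in>UNIV. \<Sum>j\<in>UNIV. raised_D2f f \<alpha> i j x * raised_D2f f \<beta> j i x)))"
proof -
  note D = Ck2D[OF f]
  define G where "G i j = inverse_metric f x $ i $ j" for i j
  define H where "H \<alpha> i j = D2f f \<alpha> i j x" for \<alpha> i j
  define A where "A \<alpha> i j = raised_D2f f \<alpha> i j x" for \<alpha> i j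
  define W where "W \<alpha> \<beta> = (\<Sum>m\<in>UNIV. raised_Df f \<beta> m x * Df f \<alpha> m x)" for \<alpha> \<beta>
  have Gs: "G i j = G j i" for i j unfolding G_def by (rule inverse_metric_sym[OF D(1)])
  have Hs: "H \<alpha> i j = H \<alpha> j i" for \<alpha> i j unfolding H_def by (rule D(5))
  have A: "A \<alpha> i j = (\<Sum>l\<in>UNIV. G i l * H \<alpha> l j)" for \<alpha> i j
    by (simp add: A_def G_def H_def raised_D2f_def)
  define C where "C \<alpha> \<beta> = (\<Sum>i\<in>UNIV. A \<alpha> i i) * (\<Sum>i\<in>UNIV. A \<beta> i i)
      - (\<Sum>i\<in>UNIV. \<Sum>j\<in>UNIV. A \<alpha> i j * A \<beta> j i)" for \<alpha> \<beta>
  have pair: "(\<Sum>i\<in>UNIV. \<Sum>j\<in>UNIV. \<Sum>k\<in>UNIV. \<Sum>l\<in>UNIV. G i l * G j k * (H \<alpha> i l * H \<beta> j k - H \<alpha> i k * H \<beta> j l))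
      = C \<alpha> \<beta>" for \<alpha> \<beta>
  proof -
    have t: "(\<Sum>i\<in>UNIV. A \<alpha> i i) = (\<Sum>i\<in>UNIV. \<Sum>l\<in>UNIV. G i l * H \<alpha> i l)" for \<alpha>
      unfolding A by (intro sum.cong refl) (simp add: Hs[of \<alpha>])
    have "(\<Sum>i\<in>UNIV. A \<alpha> i i) * (\<Sum>i\<in>UNIV. A \<beta> i i)
        = (\<Sum>i\<in>UNIV. \<Sum>j\<in>UNIV. \<Sum>l\<in>UNIV. \<Sum>k\<in>UNIV. G i l * G j k * (H \<alpha> i l * H \<beta> j k))"
      unfolding t sum_product by (simp add: mult_ac)
    also have "\<dots> = (\<Sum>i\<in>UNIV. \<Sum>j\<in>UNIV. \<Sum>k\<in>UNIV. \<Sum>l\<in>UNIV. G i l * G j k * (H \<alpha> i l * H \<beta> j k))"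
      by (intro sum.cong refl sum.swap)
    finally have 1: "(\<Sum>i\<in>UNIV. A \<alpha> i i) * (\<Sum>i\<in>UNIV. A \<beta> i i) = \<dots>" .
    have "(\<Sum>i\<in>UNIV. \<Sum>j\<in>UNIV. A \<alpha> i j * A \<beta> j i) = (\<Sum>i\<in>UNIV. \<Sum>j\<in>UNIV. A \<alpha> j i * A \<beta> i j)"
      by (rule sum.swap)
    also have "\<dots> = (\<Sum>i\<in>UNIV. \<Sum>j\<in>UNIV. \<Sum>k\<in>UNIV. \<Sum>l\<in>UNIV. G i l * G j k * (H \<alpha> i k * H \<beta> j l))"
      unfolding A sum_product by (intro sum.cong refl) (simp add: Hs[of \<alpha>] Hs[of \<beta>] mult_ac)
    finally show ?thesis unfolding C_def 1 by (simp add: right_diff_distrib sum_subtractf)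
  qed
  have "scalar_curvature f x = (\<Sum>i\<in>UNIV. \<Sum>j\<in>UNIV. \<Sum>k\<in>UNIV. \<Sum>l\<in>UNIV.
        (\<Sum>\<alpha>\<in>UNIV. G i l * G j k * (H \<alpha> i l * H \<alpha> j k - H \<alpha> i k * H \<alpha> j l))
      - (\<Sum>\<alpha>\<in>UNIV. \<Sum>\<beta>\<in>UNIV. W \<alpha> \<beta> * (G i l * G j k * (H \<alpha> i l * H \<beta> j k - H \<alpha> i k * H \<beta> j l))))"
    unfolding scalar_curvature_def riemann_def second_ff_inner(2)[OF f]
    unfolding G_def[symmetric] H_def[symmetric] W_def[symmetric]
    by (intro sum.cong refl) (simp add: sum_distrib_left sum_subtractf algebra_simps)
  also have "\<dots> = (\<Sum>\<alpha>\<in>UNIV. C \<alpha> \<alpha>) - (\<Sum>\<alpha>\<in>UNIV. \<Sum>\<beta>\<in>UNIV. W \<alpha> \<beta> * C \<alpha> \<beta>)"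
  proof -
    have swap: "(\<Sum>i\<in>UNIV. \<Sum>j\<in>UNIV. \<Sum>k\<in>UNIV. \<Sum>l\<in>UNIV. \<Sum>\<alpha>\<in>UNIV. F \<alpha> i j k l)
        = (\<Sum>\<alpha>\<in>UNIV. \<Sum>i\<in>UNIV. \<Sum>j\<in>UNIV. \<Sum>k\<in>UNIV. \<Sum>l\<in>UNIV. F \<alpha> i j k l)"
      for F :: "'m \<Rightarrow> 'n \<Rightarrow> 'n \<Rightarrow> 'n \<Rightarrow> 'n \<Rightarrow> real"
    proof -
      have "(\<Sum>j\<in>UNIV. \<Sum>k\<in>UNIV. \<Sum>l\<in>UNIV. \<Sum>\<alpha>\<in>UNIV. F \<alpha> i j k l)
          = (\<Sum>\<alpha>\<in>UNIV. \<Sum>j\<in>UNIV. \<Sum>k\<in>UNIV. \<Sum>l\<in>UNIV. F \<alpha> i j k l)" for i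
        by (rule sum_swap4)
      then show ?thesis by (simp only:) (rule sum.swap)
    qed
    show ?thesis
      unfolding sum_subtractf unfolding swap unfolding sum_distrib_left[symmetric] pair ..
  qed
  finally show ?thesis by (simp add: C_def A_def W_def)
qed

text \<open>
  The equation of Ricci for the normal vectors \<open>(-\<nabla>f\<^sup>\<alpha>, e\<^sub>\<alpha>)\<close> and \<open>(-\<nabla>f\<^sup>\<beta>, e\<^sub>\<beta>)\<close>: the second
  fundamental form in the direction of the former is the Hessian of \<open>f\<^sup>\<alpha>\<close>.
\<close>

lemma flat_normal_bundle_commute:
  fixes f :: "real^'n \<Rightarrow> real^'m"
  assumes f: "Ck 2 f" and flat: "flat_normal_bundle f"
  shows "(\<Sum>k\<in>UNIV. \<Sum>l\<in>UNIV. D2f f \<alpha> i k x * inverse_metric f x $ k $ l * D2f f \<beta> l j x)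
    = (\<Sum>k\<in>UNIV. \<Sum>l\<in>UNIV. D2f f \<beta> i k x * inverse_metric f x $ k $ l * D2f f \<alpha> l j x)"
proof -
  note D = Ck2D[OF f]
  define \<xi> :: "'m \<Rightarrow> (real^'n) \<times> (real^'m)" where "\<xi> \<gamma> = (- (\<chi> i. Df f \<gamma> i x), axis \<gamma> 1)" for \<gamma>
  have n: "is_normal f x (\<xi> \<gamma>)" for \<gamma>
    by (simp add: is_normal_def tangent_eq[OF D(1)] \<xi>_def inner_axis inner_axis' D(7))
  have B: "second_ff f x i j \<bullet> \<xi> \<gamma> = D2f f \<gamma> i j x" for i j \<gamma>
    unfolding second_ff_inner(1)[OF f n] by (simp add: \<xi>_def inner_axis D(8))
  have "normal_curvature f x i j (\<xi> \<beta>) = 0"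
    using flat n unfolding flat_normal_bundle_def by blast
  then have "normal_curvature f x i j (\<xi> \<beta>) \<bullet> \<xi> \<alpha> = 0" by simp
  then have "(\<Sum>l\<in>UNIV. shape_operator f x (\<xi> \<beta>) $ l $ j * D2f f \<alpha> i l x)
      = (\<Sum>l\<in>UNIV. shape_operator f x (\<xi> \<beta>) $ l $ i * D2f f \<alpha> l j x)"
    by (simp add: normal_curvature_def inner_sum_left inner_diff_left B sum_subtractf)
  then have e: "(\<Sum>k\<in>UNIV. \<Sum>l\<in>UNIV. inverse_metric f x $ k $ l * D2f f \<beta> j l x * D2f f \<alpha> i k x)
      = (\<Sum>l\<in>UNIV. \<Sum>k\<in>UNIV. inverse_metric f x $ l $ k * D2f f \<beta> i k x * D2f f \<alpha> l j x)"
    by (simp add: shape_operator_def B sum_distrib_right)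
  have "(\<Sum>k\<in>UNIV. \<Sum>l\<in>UNIV. D2f f \<alpha> i k x * inverse_metric f x $ k $ l * D2f f \<beta> l j x)
      = (\<Sum>l\<in>UNIV. \<Sum>k\<in>UNIV. inverse_metric f x $ l $ k * D2f f \<beta> i k x * D2f f \<alpha> l j x)"
    unfolding e[symmetric] by (simp add: D(5)[of \<beta> j] mult_ac)
  also have "\<dots> = (\<Sum>k\<in>UNIV. \<Sum>l\<in>UNIV. inverse_metric f x $ l $ k * D2f f \<beta> i k x * D2f f \<alpha> l j x)"
    by (rule sum.swap)
  also have "\<dots> = (\<Sum>k\<in>UNIV. \<Sum>l\<in>UNIV. D2f f \<beta> i k x * inverse_metric f x $ k $ l * D2f f \<alpha> l j x)"
    by (intro sum.cong refl, subst inverse_metric_sym[OF D(1)]) (simp add: mult_ac)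
  finally show ?thesis .
qed

text \<open>
  The products \<open>flux_coeff \<cdot> \<partial>\<^sub>j D2f\<close>, which would complete the left side to the divergence of the
  mass field, involve third derivatives; they sum to zero by antisymmetry whenever they exist.
\<close>

lemma divergence_flux_coeff:
  fixes f :: "real^'n \<Rightarrow> real^'m"
  assumes f: "Ck 2 f" and flat: "flat_normal_bundle f"
  shows "(\<Sum>\<alpha>\<in>UNIV. \<Sum>j\<in>UNIV. \<Sum>i\<in>UNIV. \<Sum>k\<in>UNIV. pd j (flux_coeff f \<alpha> j i k) x * D2f f \<alpha> i k x)
    = scalar_curvature f x"
  unfolding pd_flux_coeff[OF f] scalar_curvature_expansion[OF f]
proof (rule contraction_identity[where a = "\<lambda>\<alpha> m. Df f \<alpha> m x" and A = "\<lambda>\<alpha> i j. raised_D2f f \<alpha> i j x"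
        and W = "\<lambda>\<alpha> \<beta>. \<Sum>m\<in>UNIV. raised_Df f \<beta> m x * Df f \<alpha> m x" and p = "\<lambda>\<alpha> i. raised_Df f \<alpha> i x"
        and H = "\<lambda>\<alpha> i j. D2f f \<alpha> i j x" and G = "\<lambda>i j. inverse_metric f x $ i $ j"
        and dG = "\<lambda>j i k. pd j (\<lambda>y. inverse_metric f y $ i $ k) x" and dp = "\<lambda>j \<alpha> l. pd j (raised_Df f \<alpha> l) x"])
  show "inverse_metric f x $ i $ j = inverse_metric f x $ j $ i" for i j
    by (rule inverse_metric_sym[OF Ck2D(1)[OF f]])
  show "D2f f \<alpha> i j x = D2f f \<alpha> j i x" for \<alpha> i j by (rule Ck2D(5)[OF f])
qed (rule flat_normal_bundle_commute[OF f flat] raised_Df_def raised_D2f_def refl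
      pd_inverse_metric[OF f] pd_raised_Df[OF f])+

section \<open>The flux of the mass field through spheres\<close>

lemma lipschitz_test_integrable:
  fixes h :: "real^'n \<Rightarrow> real"
  assumes w: "lipschitz_test w G" and h: "continuous_on UNIV h"
  shows "integrable lborel (\<lambda>x. w x * h x)" "integrable lborel (\<lambda>x. G i x * h x)"
proof -
  obtain R K where RK: "0 \<le> K" "\<And>x. R < norm x \<Longrightarrow> w x = 0" "\<And>i x. R < norm x \<Longrightarrow> G i x = 0"
    "\<And>x. \<bar>w x\<bar> \<le> K" "\<And>i x. \<bar>G i x\<bar> \<le> K"
    "\<And>i x t. \<bar>t\<bar> \<le> 1 \<Longrightarrow> \<bar>w (x + t *\<^sub>R axis i 1) - w x\<bar> \<le> K * \<bar>t\<bar>"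
    by (rule lipschitz_testE[OF w], rule that)
  have [measurable]: "w \<in> borel_measurable borel" "G i \<in> borel_measurable borel" "h \<in> borel_measurable borel" for i
    using lipschitz_test_measurable[OF w] h by (auto intro: borel_measurable_continuous_onI)
  have "continuous_on (cball 0 R) h" using h continuous_on_subset by blast
  from compact_imp_bounded[OF compact_continuous_image[OF this]]
  obtain B where B: "\<forall>x\<in>cball 0 R. \<bar>h x\<bar> \<le> B" by (auto simp: bounded_iff)
  have *: "\<bar>u x * h x\<bar> \<le> K * \<bar>B\<bar>" if "\<And>x. R < norm x \<Longrightarrow> u x = 0" "\<And>x. \<bar>u x\<bar> \<le> K" for u x
  proof (cases "norm x \<le> R")
    case True
    then have "\<bar>h x\<bar> \<le> \<bar>B\<bar>" using B by force
    then show ?thesis unfolding abs_mult using that(2) RK(1) by (intro mult_mono) auto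
  qed (use that RK(1) in simp)
  show "integrable lborel (\<lambda>x. w x * h x)" "integrable lborel (\<lambda>x. G i x * h x)"
    using RK * by (auto intro!: integrable_bounded_support[where B = "K * \<bar>B\<bar>" and R = R])
qed

lemma integral_sum4:
  fixes F :: "'a \<Rightarrow> 'b \<Rightarrow> 'c \<Rightarrow> 'd \<Rightarrow> 'e \<Rightarrow> real"
  assumes i: "\<And>a b c d. integrable M (F a b c d)"
  shows "(\<integral>x. (\<Sum>a\<in>A. \<Sum>b\<in>B. \<Sum>c\<in>C. \<Sum>d\<in>D. F a b c d x) \<partial>M)
    = (\<Sum>a\<in>A. \<Sum>b\<in>B. \<Sum>c\<in>C. \<Sum>d\<in>D. \<integral>x. F a b c d x \<partial>M)"
proof -
  have 1: "(\<integral>x. (\<Sum>d\<in>D. F a b c d x) \<partial>M) = (\<Sum>d\<in>D. \<integral>x. F a b c d x \<partial>M)" 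
    "integrable M (\<lambda>x. \<Sum>d\<in>D. F a b c d x)" for a b c
    by (rule Bochner_Integration.integral_sum[OF i], rule Bochner_Integration.integrable_sum[OF i])
  have 2: "(\<integral>x. (\<Sum>c\<in>C. \<Sum>d\<in>D. F a b c d x) \<partial>M) = (\<Sum>c\<in>C. \<Sum>d\<in>D. \<integral>x. F a b c d x \<partial>M)" 
    "integrable M (\<lambda>x. \<Sum>c\<in>C. \<Sum>d\<in>D. F a b c d x)" for a b
    unfolding 1(1)[symmetric]
    by (rule Bochner_Integration.integral_sum[OF 1(2)], rule Bochner_Integration.integrable_sum[OF 1(2)])
  have 3: "(\<integral>x. (\<Sum>b\<in>B. \<Sum>c\<in>C. \<Sum>d\<in>D. F a b c d x) \<partial>M) = (\<Sum>b\<in>B. \<Sum>c\<in>C. \<Sum>d\<in>D. \<integral>x. F a b c d x \<partial>M)" 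
    "integrable M (\<lambda>x. \<Sum>b\<in>B. \<Sum>c\<in>C. \<Sum>d\<in>D. F a b c d x)" for a
    unfolding 2(1)[symmetric]
    by (rule Bochner_Integration.integral_sum[OF 2(2)], rule Bochner_Integration.integrable_sum[OF 2(2)])
  show ?thesis unfolding 3(1)[symmetric] by (rule Bochner_Integration.integral_sum[OF 3(2)])
qed

text \<open>
  Integration by parts for the field \<open>X\<^sup>j = \<Sum> c\<^sup>j\<^sup>i \<partial>\<^sub>i u\<close> with antisymmetric \<open>c\<close> and \<open>u = \<partial>\<^sub>k f\<^sup>\<alpha>\<close>:
  the sum over \<open>i\<close> and \<open>j\<close> of \<open>\<integral> \<partial>\<^sub>j (w c\<^sup>j\<^sup>i) \<partial>\<^sub>i u\<close> is unchanged when the derivatives are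
  exchanged, and changes sign when the indices are, so it vanishes.
\<close>

lemma weak_divergence_mass_field:
  fixes f :: "real^'n \<Rightarrow> real^'m"
  assumes f: "Ck 2 f" and flat: "flat_normal_bundle f" and w: "lipschitz_test w G"
  shows "(\<integral>x. (\<Sum>j\<in>UNIV. G j x * mass_field f j x) \<partial>lborel) = - (\<integral>x. w x * scalar_curvature f x \<partial>lborel)"
proof -
  note D = Ck2D[OF f]
  have c: "continuous_on UNIV (flux_coeff f \<alpha> j i k)" "continuous_on UNIV (pd l (flux_coeff f \<alpha> j i k))" for \<alpha> j i k l
    using Ck1D(2,3)[OF Ck1_flux_coeff[OF f]] by auto
  \<comment> \<open>\<open>P\<close> and \<open>N\<close> are the two parts of \<open>\<integral> \<partial>\<^sub>j (w c\<^sup>j\<^sup>i) \<partial>\<^sub>i u\<close> given by the product rule.\<close>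
  define P where "P \<alpha> j i k = (\<integral>x. G j x * (flux_coeff f \<alpha> j i k x * D2f f \<alpha> i k x) \<partial>lborel)" for \<alpha> j i k
  define N where "N \<alpha> j i k = (\<integral>x. w x * (pd j (flux_coeff f \<alpha> j i k) x * D2f f \<alpha> i k x) \<partial>lborel)" for \<alpha> j i k
  have i: "integrable lborel (\<lambda>x. G l x * (flux_coeff f \<alpha> j i k x * D2f f \<alpha> i' k x))"
    "integrable lborel (\<lambda>x. w x * (pd l (flux_coeff f \<alpha> j i k) x * D2f f \<alpha> i' k x))" for \<alpha> j i k l i'
    by (intro lipschitz_test_integrable[OF w] continuous_on_mult c D(4))+
  have anti: "flux_coeff f \<alpha> i j k = (\<lambda>x. - flux_coeff f \<alpha> j i k x)" for \<alpha> i j k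
    by (rule ext) (simp add: flux_coeff_def)
  have pd_anti: "pd l (flux_coeff f \<alpha> i j k) x = - pd l (flux_coeff f \<alpha> j i k) x" for \<alpha> i j k l x
    unfolding anti[of \<alpha> i j k]
    by (rule pd_bounded_linear(2)[OF bounded_linear_minus[OF bounded_linear_ident] Ck1D(1)[OF Ck1_flux_coeff[OF f]]])
  have split: "(\<integral>x. (G l x * flux_coeff f \<alpha> j i k x + w x * pd l (flux_coeff f \<alpha> j i k) x) * D2f f \<alpha> i' k x \<partial>lborel)
      = (\<integral>x. G l x * (flux_coeff f \<alpha> j i k x * D2f f \<alpha> i' k x) \<partial>lborel)
        + (\<integral>x. w x * (pd l (flux_coeff f \<alpha> j i k) x * D2f f \<alpha> i' k x) \<partial>lborel)" for l \<alpha> j i k i'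
    using i[of l \<alpha> j i k i'] by (simp add: distrib_right mult.assoc)
  have PN: "P \<alpha> j i k + N \<alpha> j i k = - (P \<alpha> i j k + N \<alpha> i j k)" for \<alpha> j i k
  proof -
    have "P \<alpha> j i k + N \<alpha> j i k
        = (\<integral>x. (G i x * flux_coeff f \<alpha> j i k x + w x * pd i (flux_coeff f \<alpha> j i k) x) * D2f f \<alpha> j k x \<partial>lborel)"
      using integral_pd_swap[where i = i and j = j,
          OF lipschitz_test_mult[OF w Ck1_flux_coeff[OF f, of \<alpha> j i k]] D(3)[of \<alpha> k]]
      by (simp add: split P_def N_def D(6))
    also have "\<dots> = - (P \<alpha> i j k + N \<alpha> i j k)"
      unfolding split P_def N_def pd_anti[of _ \<alpha> i j k] unfolding anti[of \<alpha> i j k] by simp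
    finally show ?thesis .
  qed
  have "(\<Sum>j\<in>UNIV. \<Sum>i\<in>UNIV. P \<alpha> j i k + N \<alpha> j i k) = 0" for \<alpha> k
  proof -
    have "(\<Sum>j\<in>UNIV. \<Sum>i\<in>UNIV. P \<alpha> j i k + N \<alpha> j i k) = - (\<Sum>j\<in>UNIV. \<Sum>i\<in>UNIV. P \<alpha> i j k + N \<alpha> i j k)"
      unfolding sum_negf[symmetric] by (intro sum.cong refl PN)
    also have "(\<Sum>j\<in>UNIV. \<Sum>i\<in>UNIV. P \<alpha> i j k + N \<alpha> i j k) = (\<Sum>j\<in>UNIV. \<Sum>i\<in>UNIV. P \<alpha> j i k + N \<alpha> j i k)"
      by (rule sum.swap)
    finally show ?thesis by simp
  qed
  then have "(\<Sum>\<alpha>\<in>UNIV. \<Sum>k\<in>UNIV. \<Sum>j\<in>UNIV. \<Sum>i\<in>UNIV. P \<alpha> j i k + N \<alpha> j i k) = 0" by simp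
  then have zero: "(\<Sum>\<alpha>\<in>UNIV. \<Sum>j\<in>UNIV. \<Sum>i\<in>UNIV. \<Sum>k\<in>UNIV. P \<alpha> j i k + N \<alpha> j i k) = 0"
    by (simp only: sum_swap3[of "\<lambda>j i k. P _ j i k + N _ j i k"])
  have "(\<integral>x. (\<Sum>j\<in>UNIV. G j x * mass_field f j x) \<partial>lborel) = (\<Sum>j\<in>UNIV. \<Sum>\<alpha>\<in>UNIV. \<Sum>i\<in>UNIV. \<Sum>k\<in>UNIV. P \<alpha> j i k)"
    unfolding mass_field_def P_def sum_distrib_left
    by (rule integral_sum4[where F = "\<lambda>j \<alpha> i k x. G j x * (flux_coeff f \<alpha> j i k x * D2f f \<alpha> i k x)"]) (rule i(1))
  also have "\<dots> = (\<Sum>\<alpha>\<in>UNIV. \<Sum>j\<in>UNIV. \<Sum>i\<in>UNIV. \<Sum>k\<in>UNIV. P \<alpha> j i k)" by (rule sum.swap)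
  also have "\<dots> = - (\<Sum>\<alpha>\<in>UNIV. \<Sum>j\<in>UNIV. \<Sum>i\<in>UNIV. \<Sum>k\<in>UNIV. N \<alpha> j i k)"
    using zero[unfolded sum.distrib] by (rule eq_neg_iff_add_eq_0[THEN iffD2])
  also have "(\<Sum>\<alpha>\<in>UNIV. \<Sum>j\<in>UNIV. \<Sum>i\<in>UNIV. \<Sum>k\<in>UNIV. N \<alpha> j i k) = (\<integral>x. w x * scalar_curvature f x \<partial>lborel)"
    unfolding divergence_flux_coeff[OF f flat, symmetric] N_def sum_distrib_left
    by (rule integral_sum4[where F = "\<lambda>\<alpha> j i k x. w x * (pd j (flux_coeff f \<alpha> j i k) x * D2f f \<alpha> i k x)", symmetric])
       (rule i(2))
  finally show ?thesis .
qed

lemma continuous_on_mass_field: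
  fixes f :: "real^'n \<Rightarrow> real^'m"
  assumes f: "Ck 2 f"
  shows "continuous_on S (mass_field f j)"
  unfolding mass_field_def[abs_def]
  by (intro continuous_on_sum continuous_on_mult Ck1D(3)[OF Ck1_flux_coeff[OF f]] Ck2D(4)[OF f])

lemma sphere_area_cong:
  fixes h h' :: "'a::euclidean_space \<Rightarrow> real"
  assumes r: "r > 0" and "h \<in> borel_measurable borel" "h' \<in> borel_measurable borel"
    and eq: "\<And>x. norm x = r \<Longrightarrow> h x = h' x"
  shows "(\<integral>x. h x \<partial>sphere_area r) = (\<integral>x. h' x \<partial>sphere_area r)"
proof -
  have "indicator (ball 0 r - {0}) x * h ((r / norm x) *\<^sub>R x)
      = indicator (ball 0 r - {0}) x * h' ((r / norm x) *\<^sub>R x)" for x :: 'a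
    using r eq[of "(r / norm x) *\<^sub>R x"] by (cases "x = 0") auto
  then show ?thesis
    unfolding sphere_area_integral[OF r assms(2)] sphere_area_integral[OF r assms(3)] by (simp only:)
qed

text \<open>
  The divergence theorem for the mass field on a ball.  Both sides are limits of the weak identity
  for cutoffs of the ball of radius \<open>r\<close> with vanishing thickness.
\<close>

theorem flux_mass_field:
  fixes f :: "real^'n \<Rightarrow> real^'m"
  assumes f: "Ck 2 f" and flat: "flat_normal_bundle f" and S: "integrable lborel (scalar_curvature f)" and r: "r > 0"
  shows "(\<integral>x. (\<Sum>j\<in>UNIV. mass_field f j x * (x $ j / r)) \<partial>sphere_area r)
    = (\<integral>x. indicator (cball 0 r) x * scalar_curvature f x \<partial>lborel)"
proof -
  define k where "k x = (\<Sum>j\<in>UNIV. mass_field f j x * (x $ j / norm x))" for x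
  define d where "d m = 1 / real (Suc m)" for m
  have d: "d m > 0" for m by (simp add: d_def)
  have [measurable]: "mass_field f j \<in> borel_measurable borel" for j
    by (rule borel_measurable_continuous_onI[OF continuous_on_mass_field[OF f]])
  have [measurable]: "scalar_curvature f \<in> borel_measurable borel" using S by auto
  have km[measurable]: "k \<in> borel_measurable borel" unfolding k_def by measurable
  have kc: "continuous_on (UNIV - {0}) k"
    unfolding k_def by (intro continuous_intros continuous_on_mass_field[OF f]) auto
  define A where "A m = {x::real^'n. r \<le> norm x \<and> norm x < r + d m}" for m
  have eq: "real (Suc m) * (\<integral>x. indicator (A m) x * k x \<partial>lborel)
      = (\<integral>x. radial_cutoff r (d m) x * scalar_curvature f x \<partial>lborel)" for m
  proof -
    have "real (Suc m) * (indicator (A m) x * k x)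
        = - (\<Sum>j\<in>UNIV. - (indicator (A m) x * (x $ j / norm x) / d m) * mass_field f j x)" for x
      by (simp add: k_def sum_negf sum_distrib_left d_def mult_ac)
    then have "real (Suc m) * (\<integral>x. indicator (A m) x * k x \<partial>lborel)
        = - (\<integral>x. (\<Sum>j\<in>UNIV. - (indicator (A m) x * (x $ j / norm x) / d m) * mass_field f j x) \<partial>lborel)"
      by (simp only: integral_mult_right_zero[symmetric] integral_minus)
    also have "\<dots> = (\<integral>x. radial_cutoff r (d m) x * scalar_curvature f x \<partial>lborel)"
      unfolding A_def weak_divergence_mass_field[OF f flat radial_cutoff_lipschitz_test[OF r d]] by simp
    finally show ?thesis .
  qed
  have "(\<lambda>m. real (Suc m) * (\<integral>x. indicator (A m) x * k x \<partial>lborel)) \<longlonglongrightarrow> (\<integral>x. k x \<partial>sphere_area r)"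
    unfolding A_def d_def by (rule thin_shell_limit[OF r km kc])
  moreover have "(\<lambda>m. \<integral>x. radial_cutoff r (d m) x * scalar_curvature f x \<partial>lborel)
      \<longlonglongrightarrow> (\<integral>x. indicator (cball 0 r) x * scalar_curvature f x \<partial>lborel)"
  proof (rule integral_dominated_convergence)
    show "integrable lborel (\<lambda>x. \<bar>scalar_curvature f x\<bar>)" using S by auto
    show "AE x in lborel. (\<lambda>m. radial_cutoff r (d m) x * scalar_curvature f x)
        \<longlonglongrightarrow> indicator (cball 0 r) x * scalar_curvature f x"
    proof (intro AE_I2 tendsto_mult tendsto_const)
      fix x :: "real^'n"
      show "(\<lambda>m. radial_cutoff r (d m) x) \<longlonglongrightarrow> indicator (cball 0 r) x"
      proof (cases "norm x \<le> r")
        case True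
        then have "radial_cutoff r (d m) x = 1" for m using d[of m] by (simp add: radial_cutoff_def)
        then show ?thesis using True by simp
      next
        case False
        obtain N where N: "inverse (real (Suc N)) < norm x - r" using reals_Archimedean[of "norm x - r"] False by auto
        have "radial_cutoff r (d m) x = 0" if "m \<ge> N" for m
        proof -
          have "d m < norm x - r"
            using N le_imp_inverse_le[of "real (Suc N)" "real (Suc m)"] that by (simp add: d_def inverse_eq_divide)
          then have "(r + d m - norm x) / d m \<le> 0" using d[of m] by (intro divide_nonpos_pos) auto
          then show ?thesis by (simp add: radial_cutoff_def)
        qed
        then have "eventually (\<lambda>m. radial_cutoff r (d m) x = indicator (cball 0 r) x) sequentially"
          using False by (auto simp: eventually_sequentially)
        then show ?thesis by (rule tendsto_eventually)
      qed
    qed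
    show "AE x in lborel. norm (radial_cutoff r (d m) x * scalar_curvature f x) \<le> \<bar>scalar_curvature f x\<bar>" for m
      by (intro AE_I2) (simp add: radial_cutoff_def abs_mult mult_left_le_one_le)
    show "(\<lambda>x. radial_cutoff r (d m) x * scalar_curvature f x) \<in> borel_measurable lborel" for m
      unfolding radial_cutoff_def by measurable
    show "(\<lambda>x. indicator (cball 0 r) x * scalar_curvature f x) \<in> borel_measurable lborel"
      using S by (intro borel_measurable_times borel_measurable_indicator) auto
  qed
  ultimately have "(\<integral>x. k x \<partial>sphere_area r) = (\<integral>x. indicator (cball 0 r) x * scalar_curvature f x \<partial>lborel)"
    unfolding eq using LIMSEQ_unique by blast
  moreover have "(\<integral>x. (\<Sum>j\<in>UNIV. mass_field f j x * (x $ j / r)) \<partial>sphere_area r) = (\<integral>x. k x \<partial>sphere_area r)"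
    by (rule sphere_area_cong[OF r]) (auto simp: k_def)
  ultimately show ?thesis by simp
qed

section \<open>Asymptotics and the mass\<close>

text \<open>
  The eigenvalues of the induced metric are at least \<open>1\<close>, so its inverse is a contraction.
\<close>

lemma inverse_metric_le_1:
  assumes "f differentiable (at x)"
  shows "\<bar>inverse_metric f x $ i $ j\<bar> \<le> 1"
proof -
  define v where "v = inverse_metric f x *v axis j 1"
  have "induced_metric f x *v v = axis j 1"
    by (simp add: v_def matrix_vector_mul_assoc inverse_metric(1)[OF assms])
  then have "v \<bullet> v \<le> v $ j" using induced_metric_pos[OF assms, of v] by (simp add: inner_axis)
  moreover have "v $ j \<le> norm v" using component_le_norm_cart[of v j] by simp
  ultimately have "norm v * norm v \<le> 1 * norm v" by (simp add: dot_square_norm power2_eq_square)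
  then have "norm v \<le> 1" by (cases "v = 0") auto
  moreover have "v $ i = inverse_metric f x $ i $ j"
    by (simp add: v_def matrix_vector_mult_basis column_def)
  ultimately show ?thesis using component_le_norm_cart[of v i] by simp
qed

text \<open>
  The deviation from the Euclidean metric is quadratic in the first derivatives of \<open>f\<close>.
\<close>

lemma inverse_metric_eq_delta_minus:
  fixes f :: "real^'n \<Rightarrow> real^'m"
  assumes f: "Ck 2 f"
  shows "inverse_metric f x $ i $ j = (if i = j then 1 else 0) - (\<Sum>\<beta>\<in>UNIV. raised_Df f \<beta> i x * Df f \<beta> j x)"
proof -
  have "(if i = j then 1 else 0) = (\<Sum>k\<in>UNIV. inverse_metric f x $ i $ k * induced_metric f x $ k $ j)"
    by (rule sum_inverse_metric(2)[OF Ck2D(1)[OF f], symmetric])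
  also have "\<dots> = (\<Sum>k\<in>UNIV. inverse_metric f x $ i $ k * (if k = j then 1 else 0)
      + inverse_metric f x $ i $ k * (\<Sum>\<beta>\<in>UNIV. Df f \<beta> k x * Df f \<beta> j x))"
    by (simp only: induced_metric_eq[OF Ck2D(1)[OF f]] Df_def[symmetric] distrib_left)
  also have "\<dots> = inverse_metric f x $ i $ j + (\<Sum>k\<in>UNIV. \<Sum>\<beta>\<in>UNIV. inverse_metric f x $ i $ k * Df f \<beta> k x * Df f \<beta> j x)"
    by (simp add: sum.distrib sum_distrib_left mult.assoc if_distrib[of "\<lambda>c. _ * c"] cong: if_cong)
  also have "(\<Sum>k\<in>UNIV. \<Sum>\<beta>\<in>UNIV. inverse_metric f x $ i $ k * Df f \<beta> k x * Df f \<beta> j x)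
      = (\<Sum>\<beta>\<in>UNIV. raised_Df f \<beta> i x * Df f \<beta> j x)"
    unfolding raised_Df_def sum_distrib_right by (rule sum.swap)
  finally show ?thesis by simp
qed

text \<open>
  The components of the vector field whose flux through spheres defines the mass.
\<close>

definition ADM_field :: "(real^'n \<Rightarrow> real^'m) \<Rightarrow> 'n \<Rightarrow> real^'n \<Rightarrow> real" where
  "ADM_field f j x = (\<Sum>i\<in>UNIV. pd i (\<lambda>y. induced_metric f y $ i $ j) x - pd j (\<lambda>y. induced_metric f y $ i $ i) x)"

text \<open>
  The same expression as the mass field, with \<open>g\<^sup>-\<^sup>1\<close> replaced by the Euclidean metric.
\<close>

lemma ADM_field_eq:
  fixes f :: "real^'n \<Rightarrow> real^'m"
  assumes f: "Ck 2 f"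
  shows "ADM_field f j x = (\<Sum>\<beta>\<in>UNIV. \<Sum>i\<in>UNIV. \<Sum>k\<in>UNIV.
    ((if i = k then 1 else 0) * Df f \<beta> j x - (if j = k then 1 else 0) * Df f \<beta> i x) * D2f f \<beta> i k x)"
proof -
  have "ADM_field f j x = (\<Sum>i\<in>UNIV. \<Sum>\<beta>\<in>UNIV. Df f \<beta> j x * D2f f \<beta> i i x - Df f \<beta> i x * D2f f \<beta> i j x)"
    unfolding ADM_field_def pd_induced_metric_Df(2)[OF f] sum_subtractf[symmetric]
    by (intro sum.cong refl) (simp add: Ck2D(5)[OF f, of _ j] algebra_simps)
  also have "\<dots> = (\<Sum>\<beta>\<in>UNIV. \<Sum>i\<in>UNIV. Df f \<beta> j x * D2f f \<beta> i i x - Df f \<beta> i x * D2f f \<beta> i j x)"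
    by (rule sum.swap)
  also have "\<dots> = (\<Sum>\<beta>\<in>UNIV. \<Sum>i\<in>UNIV. \<Sum>k\<in>UNIV.
    ((if i = k then 1 else 0) * Df f \<beta> j x - (if j = k then 1 else 0) * Df f \<beta> i x) * D2f f \<beta> i k x)"
    by (intro sum.cong refl)
       (simp add: left_diff_distrib sum_subtractf if_distrib[of "\<lambda>c. c * _"] cong: if_cong)
  finally show ?thesis .
qed

lemma continuous_on_ADM_field:
  fixes f :: "real^'n \<Rightarrow> real^'m"
  assumes f: "Ck 2 f"
  shows "continuous_on S (ADM_field f j)"
  unfolding ADM_field_eq[OF f, abs_def]
  by (intro continuous_on_sum continuous_on_mult continuous_on_diff continuous_on_const
      continuous_on_raised(2)[OF f] Ck2D(4)[OF f])

text \<open>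
  By \<open>ADM_field_eq\<close> every term of the difference carries a factor \<open>g\<^sup>-\<^sup>1 - \<delta> = O(|x|\<^sup>-\<^sup>p)\<close>, one first
  derivative and one second derivative of \<open>f\<close>.
\<close>

lemma mass_field_minus_ADM_field_decay:
  fixes f :: "real^'n \<Rightarrow> real^'m"
  assumes f: "Ck 2 f"
    and D1: "\<And>\<alpha> i. Df f \<alpha> i \<in> O[at_infinity](\<lambda>x. norm x powr (- p / 2))"
    and D2: "\<And>\<alpha> i j. D2f f \<alpha> i j \<in> O[at_infinity](\<lambda>x. norm x powr (- p / 2 - 1))"
  shows "(\<lambda>x. mass_field f j x - ADM_field f j x) \<in> O[at_infinity](\<lambda>x. norm x powr (- 2 * p - 1))"
proof -
  define a where "a s = (\<lambda>x::real^'n. norm x powr s)" for s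
  have am: "(\<lambda>x. u x * v x) \<in> O[at_infinity](a (s + t))"
    if "u \<in> O[at_infinity](a s)" "v \<in> O[at_infinity](a t)" for u v :: "real^'n \<Rightarrow> real" and s t
    using landau_o.big.mult[OF that] by (simp add: a_def powr_add)
  have D1a: "Df f \<alpha> i \<in> O[at_infinity](a (- p / 2))" for \<alpha> i using D1 by (simp add: a_def)
  have D2a: "D2f f \<alpha> i k \<in> O[at_infinity](a (- p / 2 - 1))" for \<alpha> i k using D2 by (simp add: a_def)
  have G: "(\<lambda>x. inverse_metric f x $ i $ k) \<in> O[at_infinity](a 0)" for i k
  proof (rule landau_o.bigI[of 1])
    have "eventually (\<lambda>x::real^'n. 1 \<le> norm x) at_infinity" by (auto simp: eventually_at_infinity)
    then show "eventually (\<lambda>x. norm (inverse_metric f x $ i $ k) \<le> 1 * norm (a 0 x)) at_infinity"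
    proof eventually_elim
      case (elim x)
      then have "x \<noteq> 0" by auto
      then show ?case using inverse_metric_le_1[OF Ck2D(1)[OF f]] by (simp add: a_def)
    qed
  qed simp
  have P: "raised_Df f \<alpha> i \<in> O[at_infinity](a (- p / 2))" for \<alpha> i
    unfolding raised_Df_def[abs_def] by (intro big_sum_in_bigo) (use am[OF G D1a] in simp)
  define d where "d i k = (if i = k then 1 else 0 :: real)" for i k :: 'n
  have Gd: "(\<lambda>x. inverse_metric f x $ i $ k - d i k) \<in> O[at_infinity](a (- p))" for i k
  proof -
    have "(\<lambda>x. \<Sum>\<beta>\<in>UNIV. raised_Df f \<beta> i x * Df f \<beta> k x) \<in> O[at_infinity](a (- p))"
      by (intro big_sum_in_bigo) (use am[OF P D1a] in simp)
    then show ?thesis unfolding inverse_metric_eq_delta_minus[OF f] d_def by simp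
  qed
  have Pd: "(\<lambda>x. raised_Df f \<alpha> i x - Df f \<alpha> i x) \<in> O[at_infinity](a (- (3 * p / 2)))" for \<alpha> i
  proof -
    have "(\<lambda>x. \<Sum>l\<in>UNIV. (inverse_metric f x $ i $ l - d i l) * Df f \<alpha> l x) \<in> O[at_infinity](a (- (3 * p / 2)))"
      by (intro big_sum_in_bigo) (use am[OF Gd D1a] in simp)
    also have "(\<lambda>x. \<Sum>l\<in>UNIV. (inverse_metric f x $ i $ l - d i l) * Df f \<alpha> l x) = (\<lambda>x. raised_Df f \<alpha> i x - Df f \<alpha> i x)"
      by (rule ext)
         (simp add: raised_Df_def d_def left_diff_distrib sum_subtractf if_distrib[of "\<lambda>c. c * _"] cong: if_cong)
    finally show ?thesis .
  qed
  have entry: "(\<lambda>x. inverse_metric f x $ i $ k * raised_Df f \<beta> l x - d i k * Df f \<beta> l x)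
      \<in> O[at_infinity](a (- (3 * p / 2)))" for i k l \<beta>
  proof -
    have "(\<lambda>x. (inverse_metric f x $ i $ k - d i k) * raised_Df f \<beta> l x + d i k * (raised_Df f \<beta> l x - Df f \<beta> l x))
        \<in> O[at_infinity](a (- (3 * p / 2)))"
      using am[OF Gd P] Pd by (intro sum_in_bigo(1)) (simp_all add: d_def)
    then show ?thesis by (simp add: algebra_simps)
  qed
  have eq: "mass_field f j x - ADM_field f j x = (\<Sum>\<beta>\<in>UNIV. \<Sum>i\<in>UNIV. \<Sum>k\<in>UNIV.
      ((inverse_metric f x $ i $ k * raised_Df f \<beta> j x - d i k * Df f \<beta> j x)
       - (inverse_metric f x $ j $ k * raised_Df f \<beta> i x - d j k * Df f \<beta> i x)) * D2f f \<beta> i k x)" for x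
    unfolding mass_field_def ADM_field_eq[OF f] flux_coeff_def d_def[symmetric] sum_subtractf[symmetric]
    by (intro sum.cong refl) (simp add: algebra_simps)
  have "(\<lambda>x. mass_field f j x - ADM_field f j x) \<in> O[at_infinity](a (- (3 * p / 2) + (- p / 2 - 1)))"
    unfolding eq by (intro big_sum_in_bigo am sum_in_bigo(2) entry D2a)
  also have "- (3 * p / 2) + (- p / 2 - 1) = - 2 * p - 1" by simp
  finally show ?thesis by (simp only: a_def)
qed

lemma sphere_area_integrand_integrable:
  fixes h :: "'a::euclidean_space \<Rightarrow> real"
  assumes r: "r > 0" and h: "continuous_on UNIV h" and B: "\<And>x. norm x = r \<Longrightarrow> \<bar>h x\<bar> \<le> B"
  shows "integrable lborel (\<lambda>x. indicator (ball 0 r - {0}) x * h ((r / norm x) *\<^sub>R x))"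
    and "\<bar>indicator (ball 0 r - {0}) x * h ((r / norm x) *\<^sub>R x)\<bar> \<le> indicator (ball 0 r) x * B"
proof -
  have [measurable]: "h \<in> borel_measurable borel" using h by (rule borel_measurable_continuous_onI)
  have b: "\<bar>h ((r / norm x) *\<^sub>R x)\<bar> \<le> B" if "x \<noteq> 0" for x using that r by (intro B) simp
  show "\<bar>indicator (ball 0 r - {0}) x * h ((r / norm x) *\<^sub>R x)\<bar> \<le> indicator (ball 0 r) x * B" for x
    \<comment> \<open>A multiple of a basis vector lies on the sphere, so \<open>B\<close> is nonnegative; this settles \<open>x = 0\<close>.\<close>
    using b[of x] B[of "r *\<^sub>R (SOME b. b \<in> Basis)"] r some_in_eq[of "Basis :: 'a set"]
    by (cases "x = 0") (auto simp: indicator_def)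
  show "integrable lborel (\<lambda>x. indicator (ball 0 r - {0}) x * h ((r / norm x) *\<^sub>R x))"
  proof (rule integrable_bounded_support[where B = "\<bar>B\<bar>" and R = r])
    show "\<bar>indicator (ball 0 r - {0}) x * h ((r / norm x) *\<^sub>R x)\<bar> \<le> \<bar>B\<bar>" for x
      using b[of x] by (cases "x = 0") (auto simp: indicator_def)
    show "(\<lambda>x. indicator (ball 0 r - {0}) x * h ((r / norm x) *\<^sub>R x)) \<in> borel_measurable borel"
      by (intro borel_measurable_times borel_measurable_indicator) auto
  qed (auto simp: indicator_def)
qed

lemma sphere_area_integral_bound:
  fixes h :: "'a::euclidean_space \<Rightarrow> real"
  assumes r: "r > 0" and h: "continuous_on UNIV h" and B: "\<And>x. norm x = r \<Longrightarrow> \<bar>h x\<bar> \<le> B"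
  shows "\<bar>\<integral>x. h x \<partial>sphere_area r\<bar> \<le> real DIM('a) / r * (B * measure lborel (ball (0::'a) r))"
proof -
  note i = sphere_area_integrand_integrable[OF r h B]
  have "\<bar>\<integral>x. indicator (ball 0 r - {0}) x * h ((r / norm x) *\<^sub>R x) \<partial>lborel\<bar>
      \<le> (\<integral>x. \<bar>indicator (ball 0 r - {0}) x * h ((r / norm x) *\<^sub>R x)\<bar> \<partial>lborel)"
    by (rule integral_abs_bound)
  also have "\<dots> \<le> (\<integral>x. indicator (ball (0::'a) r) x * B \<partial>lborel)"
  proof (rule integral_mono)
    show "integrable lborel (\<lambda>x. indicator (ball (0::'a) r) x * B)"
      by (rule integrable_bounded_support[where B = "\<bar>B\<bar>" and R = r]) (auto simp: indicator_def)
  qed (use i in auto)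
  also have "\<dots> = B * measure lborel (ball (0::'a) r)" by simp
  finally have le: "\<bar>\<integral>x. indicator (ball 0 r - {0}) x * h ((r / norm x) *\<^sub>R x) \<partial>lborel\<bar>
      \<le> B * measure lborel (ball (0::'a) r)" .
  then show ?thesis
    using r mult_left_mono[OF le, of "real DIM('a) / r"]
    by (simp add: sphere_area_integral[OF r borel_measurable_continuous_onI[OF h]] abs_mult)
qed

lemma sphere_area_integral_diff:
  fixes h h' :: "'a::euclidean_space \<Rightarrow> real"
  assumes r: "r > 0" and h: "continuous_on UNIV h" "continuous_on UNIV h'"
  shows "(\<integral>x. h x - h' x \<partial>sphere_area r) = (\<integral>x. h x \<partial>sphere_area r) - (\<integral>x. h' x \<partial>sphere_area r)"
proof -
  have i: "integrable lborel (\<lambda>x. indicator (ball 0 r - {0}) x * u ((r / norm x) *\<^sub>R x))"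
    if u: "continuous_on UNIV u" for u :: "'a \<Rightarrow> real"
  proof -
    have "continuous_on (sphere 0 r) u" using u continuous_on_subset by blast
    then obtain B where "\<forall>x\<in>sphere 0 r. \<bar>u x\<bar> \<le> B"
      using compact_imp_bounded[OF compact_continuous_image[of "sphere 0 r" u]] by (auto simp: bounded_iff)
    then have "\<bar>u x\<bar> \<le> B" if "norm x = r" for x using that by simp
    then show ?thesis by (rule sphere_area_integrand_integrable(1)[OF r u])
  qed
  have m: "h \<in> borel_measurable borel" "h' \<in> borel_measurable borel" "(\<lambda>x. h x - h' x) \<in> borel_measurable borel"
    using h by (auto intro!: borel_measurable_continuous_onI continuous_on_diff)
  show ?thesis
    unfolding sphere_area_integral[OF r m(1)] sphere_area_integral[OF r m(2)] sphere_area_integral[OF r m(3)]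
    by (simp add: right_diff_distrib i[OF h(1)] i[OF h(2)])
qed

text \<open>
  The mass as a total curvature.  The error \<open>e r\<close> made by passing to the mass field is at most a
  constant times \<open>r\<^sup>-\<^sup>2\<^sup>p\<^sup>-\<^sup>1\<close> times the area \<open>r\<^sup>n\<^sup>-\<^sup>1\<close> of the sphere, and the exponent
  \<open>n - 2 - 2 p\<close> is negative.
\<close>

theorem ADM_flux_tendsto:
  fixes f :: "real^'n \<Rightarrow> real^'m"
  assumes af: "asymptotically_flat f" and flat: "flat_normal_bundle f"
  shows "(ADM_flux (induced_metric f) \<longlongrightarrow>
    1 / (2 * (real CARD('n) - 1) * unit_sphere_volume TYPE(real^'n)) * (\<integral>x. scalar_curvature f x \<partial>lborel)) at_top"
proof -
  obtain p where f: "Ck 2 f" and S: "integrable lborel (scalar_curvature f)"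
    and p: "p > (real CARD('n) - 2) / 2"
    and D1: "\<And>\<alpha> i. Df f \<alpha> i \<in> O[at_infinity](\<lambda>x. norm x powr (- p / 2))"
    and D2: "\<And>\<alpha> i j. D2f f \<alpha> i j \<in> O[at_infinity](\<lambda>x. norm x powr (- p / 2 - 1))"
    using af unfolding asymptotically_flat_def Df_def D2f_def by blast
  define n where "n = real CARD('n)"
  define \<kappa> where "\<kappa> = 1 / (2 * (n - 1) * unit_sphere_volume TYPE(real^'n))"
  define e where "e r = (\<integral>x. (\<Sum>j\<in>UNIV. (mass_field f j x - ADM_field f j x) * (x $ j / r)) \<partial>sphere_area r)" for r
  have flux: "ADM_flux (induced_metric f) r
      = \<kappa> * ((\<integral>x. indicator (cball 0 r) x * scalar_curvature f x \<partial>lborel) - e r)" if r: "r > 0" for r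
  proof -
    have c: "continuous_on UNIV (\<lambda>x. \<Sum>j\<in>UNIV. mass_field f j x * (x $ j / r))"
      "continuous_on UNIV (\<lambda>x. \<Sum>j\<in>UNIV. ADM_field f j x * (x $ j / r))"
      using r by (auto intro!: continuous_intros continuous_on_mass_field[OF f] continuous_on_ADM_field[OF f])
    have e: "e r = (\<integral>x. (\<Sum>j\<in>UNIV. mass_field f j x * (x $ j / r)) \<partial>sphere_area r)
        - (\<integral>x. (\<Sum>j\<in>UNIV. ADM_field f j x * (x $ j / r)) \<partial>sphere_area r)"
      unfolding e_def left_diff_distrib sum_subtractf by (rule sphere_area_integral_diff[OF r c])
    have eq: "(\<Sum>i\<in>UNIV. \<Sum>j\<in>UNIV. (pd i (\<lambda>y. induced_metric f y $ i $ j) x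
        - pd j (\<lambda>y. induced_metric f y $ i $ i) x) * (x $ j / r)) = (\<Sum>j\<in>UNIV. ADM_field f j x * (x $ j / r))" for x
      unfolding ADM_field_def sum_distrib_right by (rule sum.swap)
    show ?thesis
      unfolding ADM_flux_def eq e flux_mass_field[OF f flat S r] \<kappa>_def n_def by simp
  qed
  have e0: "(e \<longlongrightarrow> 0) at_top"
  proof -
    have "\<forall>j. \<exists>C R. \<forall>x. R \<le> norm x \<longrightarrow> \<bar>mass_field f j x - ADM_field f j x\<bar> \<le> C * norm x powr (- 2 * p - 1)"
    proof
      fix j
      obtain C where "eventually (\<lambda>x. norm (mass_field f j x - ADM_field f j x)
          \<le> C * norm (norm x powr (- 2 * p - 1))) at_infinity"
        by (rule landau_o.bigE[OF mass_field_minus_ADM_field_decay[OF f D1 D2, of j]])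
      then show "\<exists>C R. \<forall>x. R \<le> norm x \<longrightarrow> \<bar>mass_field f j x - ADM_field f j x\<bar> \<le> C * norm x powr (- 2 * p - 1)"
        unfolding eventually_at_infinity by auto
    qed
    then obtain C R where CR: "\<And>j x. R j \<le> norm x \<Longrightarrow>
        \<bar>mass_field f j x - ADM_field f j x\<bar> \<le> C j * norm x powr (- 2 * p - 1)" by metis
    define K where "K = (\<Sum>j\<in>UNIV. \<bar>C j\<bar>)"
    define R0 where "R0 = 1 + (\<Sum>j\<in>UNIV. \<bar>R j\<bar>)"
    have RR: "R j \<le> R0" for j
      using member_le_sum[of j UNIV "\<lambda>j. \<bar>R j\<bar>"] by (simp add: R0_def)
    have R0: "R0 \<ge> 1" by (simp add: R0_def sum_nonneg)
    define \<omega> where "\<omega> = unit_ball_vol n"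
    have bound: "\<bar>e r\<bar> \<le> n * K * \<omega> * r powr (n - 2 - 2 * p)" if r: "r \<ge> R0" for r
    proof -
      have r0: "r > 0" using r R0 by simp
      have "\<bar>e r\<bar> \<le> real DIM(real^'n) / r * (K * r powr (- 2 * p - 1) * measure lborel (ball (0::real^'n) r))"
        unfolding e_def
      proof (rule sphere_area_integral_bound[OF r0])
        show "continuous_on UNIV (\<lambda>x. \<Sum>j\<in>UNIV. (mass_field f j x - ADM_field f j x) * (x $ j / r))"
          using r0 by (auto intro!: continuous_intros continuous_on_mass_field[OF f] continuous_on_ADM_field[OF f])
        fix x :: "real^'n" assume x: "norm x = r"
        have "\<bar>(mass_field f j x - ADM_field f j x) * (x $ j / r)\<bar> \<le> \<bar>C j\<bar> * r powr (- 2 * p - 1)" for j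
        proof -
          have "\<bar>x $ j / r\<bar> \<le> 1" using component_le_norm_cart[of x j] x r0 by simp
          moreover have "\<bar>mass_field f j x - ADM_field f j x\<bar> \<le> \<bar>C j\<bar> * r powr (- 2 * p - 1)"
          proof -
            have "\<bar>mass_field f j x - ADM_field f j x\<bar> \<le> C j * r powr (- 2 * p - 1)"
              using CR[of j x] RR[of j] r x by simp
            also have "\<dots> \<le> \<bar>C j\<bar> * r powr (- 2 * p - 1)" by (intro mult_right_mono) auto
            finally show ?thesis .
          qed
          ultimately have "\<bar>mass_field f j x - ADM_field f j x\<bar> * \<bar>x $ j / r\<bar> \<le> \<bar>C j\<bar> * r powr (- 2 * p - 1) * 1"
            by (intro mult_mono) auto
          then show ?thesis by (simp only: abs_mult mult_1_right)
        qed
        then have "(\<Sum>j\<in>UNIV. \<bar>(mass_field f j x - ADM_field f j x) * (x $ j / r)\<bar>) \<le> (\<Sum>j\<in>UNIV. \<bar>C j\<bar> * r powr (- 2 * p - 1))"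
          by (rule sum_mono)
        then show "\<bar>\<Sum>j\<in>UNIV. (mass_field f j x - ADM_field f j x) * (x $ j / r)\<bar> \<le> K * r powr (- 2 * p - 1)"
          unfolding K_def sum_distrib_right by (rule order_trans[OF sum_abs])
      qed
      also have "\<dots> = n * K * \<omega> * (r powr (- 2 * p - 1) * r powr n * r powr (- 1))"
        using r0 by (simp add: content_ball n_def \<omega>_def powr_realpow powr_minus divide_inverse mult_ac)
      also have "r powr (- 2 * p - 1) * r powr n * r powr (- 1) = r powr (n - 2 - 2 * p)"
        unfolding powr_add[symmetric] by (rule arg_cong) simp
      finally show ?thesis .
    qed
    have "((\<lambda>r. r powr (n - 2 - 2 * p)) \<longlongrightarrow> 0) at_top"
      using p by (intro tendsto_neg_powr filterlim_ident) (simp add: n_def)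
    then have "((\<lambda>r. n * K * \<omega> * r powr (n - 2 - 2 * p)) \<longlongrightarrow> 0) at_top"
      by (rule tendsto_mult_right_zero)
    moreover have "eventually (\<lambda>r. norm (e r) \<le> n * K * \<omega> * r powr (n - 2 - 2 * p)) at_top"
      using bound by (auto intro: eventually_at_top_linorderI[of R0])
    ultimately show ?thesis by (rule Lim_null_comparison[rotated])
  qed
  have S0: "((\<lambda>r. \<integral>x. indicator (cball 0 r) x * scalar_curvature f x \<partial>lborel)
      \<longlongrightarrow> (\<integral>x. scalar_curvature f x \<partial>lborel)) at_top"
  proof (rule integral_dominated_convergence_at_top[where w = "\<lambda>x. \<bar>scalar_curvature f x\<bar>"])
    show "AE x in lborel. ((\<lambda>r. indicator (cball 0 r) x * scalar_curvature f x) \<longlongrightarrow> scalar_curvature f x) at_top"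
    proof (rule AE_I2, rule tendsto_eventually)
      fix x :: "real^'n"
      show "eventually (\<lambda>r. indicator (cball 0 r) x * scalar_curvature f x = scalar_curvature f x) at_top"
        by (rule eventually_at_top_linorderI[of "norm x"]) simp
    qed
    show "(\<lambda>x. indicator (cball 0 r) x * scalar_curvature f x) \<in> borel_measurable lborel" for r
      using S by (intro borel_measurable_times borel_measurable_indicator) auto
    show "eventually (\<lambda>r. AE x in lborel. norm (indicator (cball 0 r) x * scalar_curvature f x) \<le> \<bar>scalar_curvature f x\<bar>) at_top"
      by (intro always_eventually allI AE_I2) (simp add: indicator_def)
  qed (use S in auto)
  have "((\<lambda>r. \<kappa> * ((\<integral>x. indicator (cball 0 r) x * scalar_curvature f x \<partial>lborel) - e r))
      \<longlongrightarrow> \<kappa> * ((\<integral>x. scalar_curvature f x \<partial>lborel) - 0)) at_top"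
    by (intro tendsto_intros S0 e0)
  moreover have "eventually (\<lambda>r. ADM_flux (induced_metric f) r
      = \<kappa> * ((\<integral>x. indicator (cball 0 r) x * scalar_curvature f x \<partial>lborel) - e r)) at_top"
    using eventually_gt_at_top[of "0::real"] by eventually_elim (rule flux)
  ultimately show ?thesis
    unfolding \<kappa>_def[symmetric, folded n_def] by (simp add: tendsto_cong \<kappa>_def n_def)
qed

theorem corollary1p4:
  fixes f :: "real^'n \<Rightarrow> real^'m"
  assumes "CARD('n) \<ge> 2"
    and "asymptotically_flat f"
    and "\<And>x. scalar_curvature f x \<ge> 0"
    and "flat_normal_bundle f"
  shows "(ADM_flux (induced_metric f) \<longlongrightarrow> ADM_mass (induced_metric f)) at_top
         \<and> ADM_mass (induced_metric f) \<ge> 0"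
proof -
  define m where "m = 1 / (2 * (real CARD('n) - 1) * unit_sphere_volume TYPE(real^'n)) * (\<integral>x. scalar_curvature f x \<partial>lborel)"
  have lim: "(ADM_flux (induced_metric f) \<longlongrightarrow> m) at_top"
    unfolding m_def by (rule ADM_flux_tendsto[OF assms(2,4)])
  then have "ADM_mass (induced_metric f) = m"
    unfolding ADM_mass_def by (intro tendsto_Lim) auto
  moreover have "m \<ge> 0"
    unfolding m_def using assms(1,3)
    by (intro mult_nonneg_nonneg integral_nonneg divide_nonneg_nonneg) (auto simp: unit_sphere_volume_eq)
  ultimately show ?thesis using lim by simp
qed

end
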